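(* Let $\Omega$ be a bounded Lipschitz domain in $\mathbb{R}^n$, $n\ge2$. Let $Q>0$ be a constant such that $$Q\,P_\Omega(E)\ \ge\ \min\big(|E|,|\Omega\setminus E|\big)^{1-1/n}\qquad\text{for every measurable } E\subseteq\Omega ,$$ and let $\mathcal{C}>0$ be a constant such that $$H_{n-1}\big(\partial^* E\cap\partial\Omega\big)\ \le\ \mathcal{C}\,P_\Omega(E)\qquad\text{for every measurable } E\subseteq\Omega \text{ with } |E|\le \tfrac{|\Omega|}{2}.$$ Let $A$ be an N-function, and let $u$ be a nonnegative Lipschitz function in $\Omega$ such that one of the following holds: (i) $u=0$ in a set $E\subseteq\Omega$ with $|E|=\epsilon>0$; (ii) $u=0$ in a set $F\subseteq\partial\Omega$ with $H_{n-1}(F)=\epsilon>0$; (iii) $u=0$ in a set $G\subseteq\Omega$ with $H_{n-1}(\Pi(G))=\epsilon>0$ for some orthogonal projection $\Pi$ of $\mathbb{R}^n$ onto a hyperplane. Then $\tilde u\in\mathrm{Lip}(\tilde\Omega)$ and $$\|D\tilde u\|_{\mathcal{L}_A(\tilde\Omega)}\ \le\ \left(\frac{n\,c_n^{1/n}}{\gamma}\right)\|Du\|_{\mathcal{L}_A(\Omega)}$$ for some constant $\gamma>0$ depending at most on $n,\mathcal{C},Q,|\Omega|,\epsilon$.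
   Context: $|\cdot|$ denotes Lebesgue measure of sets, $H_{n-1}$ is $(n-1)$-dimensional Hausdorff measure, $c_n$ is the measure of the unit ball of $\mathbb{R}^n$, and $D$ denotes the gradient. $P_\Omega(E)$ is the De Giorgi perimeter of $E$ relative to $\Omega$. $\partial^*E$ is the essential (measure-theoretic) boundary of $E$: the set of points of $\mathbb{R}^n$ at which both $E$ and $\mathbb{R}^n\setminus E$ have positive upper Lebesgue density. Constants $Q$, $\mathcal{C}$ as in the claim exist for every bounded Lipschitz domain. Lipschitz functions on $\Omega$ are extended continuously to $\overline\Omega$. For a real measurable function $u$ on $\Omega$: the distribution function is $\mu(t)=|\{x\in\Omega:u(x)>t\}|$, $t\in\mathbb{R}$; the decreasing rearrangement is $u^*(s)=\inf\{t\in\mathbb{R}:\mu(t)\le s\}$, $s\in[0,|\Omega|]$; the Schwarz symmetrization is $\tilde u(x)=u^*(c_n|x|^n)$, $x\in\tilde\Omega$, where $\tilde\Omega$ is the (open) ball centred at the origin with the same measure as $\Omega$. An N-function is an increasing continuous convex function $A:[0,+\infty)\to[0,+\infty)$ with $\lim_{t\to0}A(t)/t=0$ and $\lim_{t\to+\infty}A(t)/t=+\infty$. The Orlicz space $\mathcal{L}_A(\Omega)$ consists of the measurable $u$ on $\Omega$ with $\int_\Omega A(|u|/\lambda)\,dx<+\infty$ for some $\lambda>0$, with norm $\|u\|_{\mathcal{L}_A(\Omega)}=\inf\{\lambda>0:\int_\Omega A(|u|/\lambda)\,dx\le1\}$; $\|Du\|_{\mathcal{L}_A}$ means the norm of $|Du|$.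 *)

theory Defs
  imports "HOL-Analysis.Analysis"
begin

text \<open>
  The (outer) Hausdorff measure of dimension \<open>k\<close>, normalised so that it agrees with
  \<open>k\<close>-dimensional Lebesgue measure on flat pieces.  The case distinction only matters for
  \<open>k = 0\<close>, where the empty set must not contribute; \<^term>\<open>bounded\<close> is needed because
  \<^term>\<open>diameter\<close> is real-valued.
\<close>

definition hausdorff_measure :: "nat \<Rightarrow> 'a::euclidean_space set \<Rightarrow> ennreal" where
  "hausdorff_measure k E =
     (SUP \<delta>\<in>{0::real<..}.
        INF C\<in>{C :: nat \<Rightarrow> 'a set. E \<subseteq> (\<Union>i. C i) \<and> (\<forall>i. bounded (C i) \<and> diameter (C i) \<le> \<delta>)}.
          \<Sum>i. if C i = {} then 0
              else ennreal (unit_ball_vol (real k) * (diameter (C i) / 2) ^ k))"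

definition divergence :: "('a::euclidean_space \<Rightarrow> 'a) \<Rightarrow> 'a \<Rightarrow> real" where
  "divergence \<phi> x = (\<Sum>b\<in>Basis. frechet_derivative \<phi> (at x) b \<bullet> b)"

definition C1_compact_support :: "'a::euclidean_space set \<Rightarrow> ('a \<Rightarrow> 'a) \<Rightarrow> bool" where
  "C1_compact_support \<Omega> \<phi> \<longleftrightarrow>
     (\<forall>x. \<phi> differentiable (at x)) \<and>
     (\<forall>v. continuous_on UNIV (\<lambda>x. frechet_derivative \<phi> (at x) v)) \<and>
     (\<exists>K. compact K \<and> K \<subseteq> \<Omega> \<and> (\<forall>x. x \<notin> K \<longrightarrow> \<phi> x = 0))"

text \<open>
  De Giorgi perimeter of \<open>E\<close> relative to the open set \<open>\<Omega>\<close>.  Truncating negative values by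
  \<^term>\<open>ennreal\<close> is harmless, since the zero field is admissible.
\<close>

definition perimeter :: "'a::euclidean_space set \<Rightarrow> 'a set \<Rightarrow> ennreal" where
  "perimeter \<Omega> E =
     (SUP \<phi>\<in>{\<phi>. C1_compact_support \<Omega> \<phi> \<and> (\<forall>x. norm (\<phi> x) \<le> 1)}.
        ennreal (LINT x:E|lebesgue. divergence \<phi> x))"

definition upper_density :: "'a::euclidean_space set \<Rightarrow> 'a \<Rightarrow> ereal" where
  "upper_density E x =
     Limsup (at_right 0)
       (\<lambda>r. ereal (measure lebesgue (E \<inter> ball x r) / measure lebesgue (ball x r)))"

definition essential_boundary :: "'a::euclidean_space set \<Rightarrow> 'a set" where
  "essential_boundary E = {x. 0 < upper_density E x \<and> 0 < upper_density (- E) x}"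

text \<open>
  Near each boundary point, in suitable orthonormal coordinates, the domain is the region below
  the graph of a Lipschitz function; \<open>\<nu>\<close> is the vertical direction and \<open>x - (x \<bullet> \<nu>) *\<^sub>R \<nu>\<close>
  the horizontal component of \<open>x\<close>.
\<close>

definition bounded_lipschitz_domain :: "'a::euclidean_space set \<Rightarrow> bool" where
  "bounded_lipschitz_domain \<Omega> \<longleftrightarrow>
     open \<Omega> \<and> connected \<Omega> \<and> \<Omega> \<noteq> {} \<and> bounded \<Omega> \<and>
     (\<forall>x0\<in>frontier \<Omega>. \<exists>r \<nu> g L. 0 < r \<and> norm \<nu> = 1 \<and>
        L-lipschitz_on {y. y \<bullet> \<nu> = 0} (g :: 'a \<Rightarrow> real) \<and>
        \<Omega> \<inter> ball x0 r = {x \<in> ball x0 r. x \<bullet> \<nu> < g (x - (x \<bullet> \<nu>) *\<^sub>R \<nu>)})"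

definition continuous_extension :: "'a::euclidean_space set \<Rightarrow> ('a \<Rightarrow> real) \<Rightarrow> 'a \<Rightarrow> real" where
  "continuous_extension \<Omega> u x = (if x \<in> \<Omega> then u x else Lim (at x within \<Omega>) u)"

definition orthogonal_projection_onto :: "'a::euclidean_space set \<Rightarrow> ('a \<Rightarrow> 'a) \<Rightarrow> bool" where
  "orthogonal_projection_onto S p \<longleftrightarrow>
     (\<forall>x. p x \<in> S \<and> (\<forall>y\<in>S. orthogonal (x - p x) (y - p x)))"

text \<open>
  The pointwise gradient.  Lipschitz functions are differentiable almost everywhere, so the
  value at points of non-differentiability is irrelevant for the norms below.
\<close>

definition gradient :: "('a::euclidean_space \<Rightarrow> real) \<Rightarrow> 'a \<Rightarrow> 'a" where
  "gradient u x = (if \<exists>D. GDERIV u x :> D then THE D. GDERIV u x :> D else 0)"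

definition distribution_function :: "'a::euclidean_space set \<Rightarrow> ('a \<Rightarrow> real) \<Rightarrow> real \<Rightarrow> real" where
  "distribution_function \<Omega> u t = measure lebesgue {x\<in>\<Omega>. u x > t}"

text \<open>
  \<^term>\<open>Inf\<close> is the real infimum.  For \<open>u\<close> bounded and \<open>\<Omega>\<close> of finite measure the set is
  nonempty and bounded below whenever \<open>0 \<le> s < |\<Omega>|\<close>, which is the range needed on the
  open symmetrized ball.
\<close>

definition decreasing_rearrangement :: "'a::euclidean_space set \<Rightarrow> ('a \<Rightarrow> real) \<Rightarrow> real \<Rightarrow> real" where
  "decreasing_rearrangement \<Omega> u s = Inf {t. distribution_function \<Omega> u t \<le> s}"

definition schwarz_symmetrization :: "'a::euclidean_space set \<Rightarrow> ('a \<Rightarrow> real) \<Rightarrow> 'a \<Rightarrow> real" where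
  "schwarz_symmetrization \<Omega> u x =
     decreasing_rearrangement \<Omega> u (unit_ball_vol (real DIM('a)) * norm x ^ DIM('a))"

definition symmetrized_ball :: "'a::euclidean_space set \<Rightarrow> 'a set" where
  "symmetrized_ball \<Omega> = ball 0 (root DIM('a) (measure lebesgue \<Omega> / unit_ball_vol (real DIM('a))))"

lemma measure_symmetrized_ball:
  fixes \<Omega> :: "'a::euclidean_space set"
  shows "measure lebesgue (symmetrized_ball \<Omega>) = measure lebesgue \<Omega>"
proof -
  have pos: "unit_ball_vol (real DIM('a)) > 0"
    by simp
  have "measure lebesgue \<Omega> / unit_ball_vol (real DIM('a)) \<ge> 0"
    using pos by (intro divide_nonneg_pos) auto
  then show ?thesis
    using less_imp_neq[OF pos, symmetric] by (simp add: symmetrized_ball_def content_ball)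
qed

text \<open>Here ``increasing'' is read in the weak sense.\<close>

definition N_function :: "(real \<Rightarrow> real) \<Rightarrow> bool" where
  "N_function A \<longleftrightarrow>
     (\<forall>t\<ge>0. 0 \<le> A t) \<and> mono_on {0..} A \<and> continuous_on {0..} A \<and> convex_on {0..} A \<and>
     ((\<lambda>t. A t / t) \<longlongrightarrow> 0) (at_right 0) \<and> filterlim (\<lambda>t. A t / t) at_top at_top"

text \<open>
  The Luxemburg norm with values in \<^typ>\<open>ennreal\<close>: it is \<open>\<infinity>\<close> exactly when a measurable \<open>f\<close>
  does not belong to the Orlicz space.
\<close>

definition orlicz_norm :: "(real \<Rightarrow> real) \<Rightarrow> 'a::euclidean_space set \<Rightarrow> ('a \<Rightarrow> real) \<Rightarrow> ennreal" where
  "orlicz_norm A \<Omega> f =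
     (INF l\<in>{l. 0 < l \<and> (\<integral>\<^sup>+x\<in>\<Omega>. ennreal (A (\<bar>f x\<bar> / l)) \<partial>lebesgue) \<le> 1}. ennreal l)"

end

theory Submission
  imports Defs
begin

text \<open>
  Write \<open>\<mu>\<close> for the distribution function of \<open>u\<close> and \<open>D(t)\<close> for the integral of \<open>|Du|\<close> over
  \<open>{u \<ge> t}\<close>.  Everything follows from one differential inequality: at every level \<open>t > 0\<close>, the lower
  left derivative of \<open>- D\<close> is at least \<open>\<gamma> |{u \<ge> t}| powr (1 - 1/n)\<close>.

  The inequality comes from testing the perimeter of \<open>{u \<ge> t}\<close> against a field \<open>\<phi>\<close> and replacing the
  indicator by \<open>u\<close> clamped between \<open>t - h\<close> and \<open>t\<close>, divided by \<open>h\<close>.  Integration by parts bounds the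
  result by \<open>(D(t - h) - D(t)) / h\<close>, so the perimeter is at most the left derivative
  (\<open>perimeter_superlevel_lower_bound\<close>).  Here the pointwise gradient has to be the distributional one,
  which is Rademacher's theorem (\<open>rademacher\<close>); it is reduced to lines and proved there by Vitali
  coverings.

  It remains to bound the perimeter of \<open>{u \<ge> t}\<close> below (\<open>level_set_dini\<close>).  If \<open>{u \<ge> t}\<close> fills at most
  half of \<open>\<Omega>\<close>, this is the isoperimetric inequality.  Otherwise the three hypotheses on the zero set act:
  a zero set of positive measure keeps the complement large; a zero set on the boundary lies in the
  essential boundary of \<open>{u < t}\<close>, so the trace inequality applies to \<open>{u < t}\<close>; and for a zero set with a
  large projection, each line over the projection either leaves \<open>\<Omega>\<close> through the essential boundary of
  \<open>{u < t}\<close>, or carries a full oscillation of the clamped function, whose integral is again controlled by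
  \<open>D(t - h) - D(t)\<close> (\<open>projection_of_zero_set_bound\<close>).

  Integrating the differential inequality between the levels \<open>u*(s')\<close> and \<open>u*(s)\<close> gives
  \<open>\<gamma> s powr (1 - 1/n) (u*(s) - u*(s'))\<close> as a lower bound for the integral of \<open>|Du|\<close> over the band between
  them, whose measure is at most \<open>s' - s\<close> (\<open>ustar_band\<close>).  With \<open>|Du| \<le> L\<close> this makes the symmetrization
  Lipschitz.  With Jensen's inequality on the bands belonging to a partition of the symmetrized ball into
  thin annuli, it bounds the integral of \<open>A\<close> of a difference quotient of the symmetrization by the
  integral of \<open>A(|Du|)\<close>, and Fatou's lemma passes to the gradient (\<open>schwarz_convex_integral_le\<close>).
\<close>

section \<open>Difference quotients of Lipschitz functions along lines\<close>

text \<open>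
  Being a countable intersection of open sets for continuous \<open>f\<close>, these sets avoid the measurability
  questions that Dini derivatives would raise.
\<close>

definition low_slope :: "('a::real_normed_vector \<Rightarrow> real) \<Rightarrow> 'a \<Rightarrow> real \<Rightarrow> 'a set" where
  "low_slope f v p = {x. \<forall>d>0. \<exists>h. h \<noteq> 0 \<and> \<bar>h\<bar> < d \<and> (f (x + h *\<^sub>R v) - f x) / h < p}"

definition high_slope :: "('a::real_normed_vector \<Rightarrow> real) \<Rightarrow> 'a \<Rightarrow> real \<Rightarrow> 'a set" where
  "high_slope f v q = {x. \<forall>d>0. \<exists>h. h \<noteq> 0 \<and> \<bar>h\<bar> < d \<and> q < (f (x + h *\<^sub>R v) - f x) / h}"

lemma high_slope_uminus: "high_slope f v q = low_slope (\<lambda>x. - f x) v (- q)"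
  unfolding high_slope_def low_slope_def
proof (intro Collect_cong)
  fix x
  have "(q < (f (x + h *\<^sub>R v) - f x) / h) = ((- f (x + h *\<^sub>R v) - - f x) / h < - q)" for h
    using minus_divide_left[of "f (x + h *\<^sub>R v) - f x" h] by (auto simp: algebra_simps)
  then show "(\<forall>d>0. \<exists>h. h \<noteq> 0 \<and> \<bar>h\<bar> < d \<and> q < (f (x + h *\<^sub>R v) - f x) / h) =
    (\<forall>d>0. \<exists>h. h \<noteq> 0 \<and> \<bar>h\<bar> < d \<and> (- f (x + h *\<^sub>R v) - - f x) / h < - q)"
    by auto
qed

lemma low_slope_borel:
  fixes f :: "'a::euclidean_space \<Rightarrow> real"
  assumes "continuous_on UNIV f"
  shows "low_slope f v p \<in> sets borel"
proof -
  have eq: "low_slope f v p =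
    (\<Inter>k. \<Union>h\<in>{h. h \<noteq> 0 \<and> \<bar>h\<bar> < inverse (real (Suc k))}. {x. (f (x + h *\<^sub>R v) - f x) / h < p})"
    (is "_ = ?R")
  proof
    show "low_slope f v p \<subseteq> ?R"
      unfolding low_slope_def by fastforce
    show "?R \<subseteq> low_slope f v p"
    proof
      fix x assume x: "x \<in> ?R"
      show "x \<in> low_slope f v p"
        unfolding low_slope_def
      proof (safe)
        fix d :: real assume "0 < d"
        then obtain k where k: "inverse (real (Suc k)) < d"
          using reals_Archimedean by blast
        then show "\<exists>h. h \<noteq> 0 \<and> \<bar>h\<bar> < d \<and> (f (x + h *\<^sub>R v) - f x) / h < p"
        proof -
          obtain h where "h \<noteq> 0" "\<bar>h\<bar> < inverse (real (Suc k))" "(f (x + h *\<^sub>R v) - f x) / h < p"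
            using x by blast
          then show ?thesis using k by (intro exI[of _ h]) auto
        qed
      qed
    qed
  qed
  have cf: "continuous_on UNIV (\<lambda>x. f (x + h *\<^sub>R v))" for h
    by (rule continuous_on_compose2[OF assms]) (auto intro!: continuous_intros)
  have "open {x. (f (x + h *\<^sub>R v) - f x) / h < p}" if "h \<noteq> 0" for h
    using that by (intro open_Collect_less continuous_intros cf assms) auto
  then have "open (\<Union>h\<in>{h. h \<noteq> 0 \<and> \<bar>h\<bar> < inverse (real (Suc k))}. {x. (f (x + h *\<^sub>R v) - f x) / h < p})" for k
    by auto
  then show ?thesis
    unfolding eq by (intro sets.countable_INT) auto
qed

lemma high_slope_borel:
  fixes f :: "'a::euclidean_space \<Rightarrow> real"
  assumes "continuous_on UNIV f"
  shows "high_slope f v p \<in> sets borel"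
  unfolding high_slope_uminus by (rule low_slope_borel) (intro continuous_intros assms)

text \<open>
  Vitali's covering theorem for intervals with one end at the covered point.  A strictly increasing
  \<open>F\<close> keeps disjoint intervals disjoint, so the same family also serves as a covering of the image.
\<close>

lemma expanding_vitali:
  fixes F :: "real \<Rightarrow> real"
  assumes mono: "strict_mono F"
    and cov: "\<And>x d. x \<in> K \<Longrightarrow> 0 < d \<Longrightarrow>
       \<exists>h. h \<noteq> 0 \<and> \<bar>h\<bar> < d \<and> P (min x (x + h)) (max x (x + h))"
  obtains C :: "(real \<times> real) set" where "countable C"
    "\<And>c r. (c, r) \<in> C \<Longrightarrow> 0 < r \<and> P (c - r) (c + r)"
    "disjoint_family_on (\<lambda>(c, r). {c - r..c + r}) C"
    "disjoint_family_on (\<lambda>(c, r). {F (c - r)..F (c + r)}) C"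
    "negligible (K - (\<Union>(c, r)\<in>C. {c - r..c + r}))"
proof -
  let ?K = "{(c, r). 0 < r \<and> P (c - r) (c + r)}"
  have V: "\<exists>i. i \<in> ?K \<and> x \<in> cball (fst i) (snd i) \<and> snd i < d" if xd: "x \<in> K" "0 < d" for x d
  proof -
    obtain h where h: "h \<noteq> 0" "\<bar>h\<bar> < d" "P (min x (x + h)) (max x (x + h))"
      using cov[OF xd] by blast
    have e: "x + h / 2 - \<bar>h\<bar> / 2 = min x (x + h)" "x + h / 2 + \<bar>h\<bar> / 2 = max x (x + h)"
      by (auto simp: min_def max_def abs_if)
    show ?thesis
      by (rule exI[of _ "(x + h / 2, \<bar>h\<bar> / 2)"]) (use h e in \<open>auto simp: dist_real_def\<close>)
  qed
  obtain C where C: "countable C" "C \<subseteq> ?K"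
     "pairwise (\<lambda>i j. disjnt (cball (fst i) (snd i)) (cball (fst j) (snd j))) C"
     "negligible (K - (\<Union>i \<in> C. cball (fst i) (snd i)))"
    using Vitali_covering_theorem_cballs[of ?K snd K fst] V by (smt (verit) case_prodD mem_Collect_eq prod.collapse)
  have U: "(\<Union>(c, r)\<in>C. {c - r..c + r}) = (\<Union>i\<in>C. cball (fst i) (snd i))"
    by (auto simp: cball_eq_atLeastAtMost split_beta)
  have dj: "disjoint_family_on (\<lambda>(c, r). {c - r..c + r}) C"
    using C(3) by (auto simp: disjoint_family_on_def pairwise_def disjnt_def cball_eq_atLeastAtMost split_beta)
  have dj2: "disjoint_family_on (\<lambda>(c, r). {F (c - r)..F (c + r)}) C"
    unfolding disjoint_family_on_def
  proof (intro ballI impI)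
    fix i j assume ij: "i \<in> C" "j \<in> C" "i \<noteq> j"
    obtain c r c' r' where e: "i = (c, r)" "j = (c', r')" by fastforce
    have r: "0 < r" "0 < r'" using C(2) ij e by auto
    have "{c - r..c + r} \<inter> {c' - r'..c' + r'} = {}"
      using disjoint_family_onD[OF dj ij(1,2)] ij(3) e by auto
    then have "c + r < c' - r' \<or> c' + r' < c - r"
      using r by (auto simp: disjoint_iff)
    then have "F (c + r) < F (c' - r') \<or> F (c' + r') < F (c - r)"
      using mono by (auto simp: strict_mono_def)
    then show "(case i of (c, r) \<Rightarrow> {F (c - r)..F (c + r)}) \<inter> (case j of (c, r) \<Rightarrow> {F (c - r)..F (c + r)}) = {}"
      by (auto simp: e)
  qed
  show thesis
    by (rule that[OF C(1) _ dj dj2]) (use C(2,4) U in auto)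
qed

lemma emeasure_lebesgue_mono_null:
  assumes "A \<subseteq> B \<union> N" "B \<in> sets lebesgue" "negligible N"
  shows "emeasure lebesgue A \<le> emeasure lebesgue B"
proof -
  have N: "N \<in> null_sets lebesgue" using assms(3) by (simp add: negligible_iff_null_sets)
  have "emeasure lebesgue A \<le> emeasure lebesgue (B \<union> N)"
    using assms N by (intro emeasure_mono) auto
  also have "\<dots> = emeasure lebesgue B"
    using assms(2) N by (rule emeasure_Un_null_set)
  finally show ?thesis .
qed

text \<open>
  The image of \<open>K\<close> has measure at most \<open>p |K|\<close> because of the small slopes, and at least \<open>q |K|\<close> because
  of the large ones; as \<open>p < q\<close>, both are zero.
\<close>

lemma compact_slopes_null:
  fixes F :: "real \<Rightarrow> real"
  assumes mono: "strict_mono F" and lip: "M-lipschitz_on UNIV F"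
    and K: "compact K" "K \<subseteq> low_slope F 1 p \<inter> high_slope F 1 q" and pq: "0 < p" "p < q"
  shows "emeasure lborel K = 0"
proof -
  have contF: "continuous_on UNIV F"
    using lip by (rule lipschitz_on_continuous_on)
  have Fm: "F x \<le> F y \<longleftrightarrow> x \<le> y" for x y
    using mono by (simp add: strict_mono_less_eq)
  have FK: "compact (F ` K)"
    using K(1) contF by (meson compact_continuous_image continuous_on_subset subset_UNIV)
  have fin: "emeasure lborel K < \<infinity>" "emeasure lborel (F ` K) < \<infinity>"
    using emeasure_bounded_finite[OF compact_imp_bounded] K(1) FK by auto
  have quot: "(F (x + h) - F x) / h = (F (max x (x+h)) - F (min x (x+h))) / (max x (x+h) - min x (x+h))"
    if "h \<noteq> 0" for x h :: real
    using that minus_divide_divide[of "F (x + h) - F x" h] by (auto simp: min_def max_def)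
  \<comment> \<open>The covering intervals lie in an open set little larger than \<open>K\<close> and have slope at most \<open>p\<close>.
    What they miss is null, and a Lipschitz map sends it to a null set.\<close>
  have up: "emeasure lborel (F ` K) \<le> ennreal p * emeasure lborel K"
  proof (rule ennreal_le_epsilon)
    fix e :: real assume e: "0 < e"
    obtain U where U: "open U" "K \<subseteq> U" "emeasure lborel (U - K) < ennreal (e / p)"
      using outer_regular_lborel[of K "e / p"] K(1) pq e by (auto intro: borel_compact)
    let ?P = "\<lambda>a b. {a..b} \<subseteq> U \<and> F b - F a \<le> p * (b - a)"
    have "\<exists>h. h \<noteq> 0 \<and> \<bar>h\<bar> < d \<and> ?P (min x (x + h)) (max x (x + h))" if x: "x \<in> K" "0 < d" for x d
    proof -
      obtain s where s: "0 < s" "ball x s \<subseteq> U"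
        using U x openE by (metis subsetD)
      obtain h where h: "h \<noteq> 0" "\<bar>h\<bar> < min s d" "(F (x + h) - F x) / h < p"
        using K(2) x s(1) unfolding low_slope_def by (auto dest!: spec[of _ "min s d"] subsetD)
      have "max x (x+h) - min x (x+h) > 0" using h(1) by (auto simp: min_def max_def)
      then have "F (max x (x+h)) - F (min x (x+h)) \<le> p * (max x (x+h) - min x (x+h))"
        using h(3) quot[OF h(1), of x] by (simp add: pos_divide_less_eq)
      moreover have "{min x (x+h)..max x (x+h)} \<subseteq> ball x s"
        using h(2) by (auto simp: dist_real_def)
      ultimately show ?thesis using s h by (intro exI[of _ h]) auto
    qed
    from expanding_vitali[of F K ?P, OF mono this] obtain C where C: "countable C"
      "\<And>c r. (c, r) \<in> C \<Longrightarrow> 0 < r \<and> ?P (c - r) (c + r)"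
      "disjoint_family_on (\<lambda>(c, r). {c - r..c + r}) C"
      "disjoint_family_on (\<lambda>(c, r). {F (c - r)..F (c + r)}) C"
      "negligible (K - (\<Union>(c, r)\<in>C. {c - r..c + r}))"
      by (auto simp: algebra_simps)
    let ?N = "K - (\<Union>(c, r)\<in>C. {c - r..c + r})"
    have N: "negligible (F ` ?N)"
    proof (rule negligible_locally_Lipschitz_image[OF _ C(5)])
      show "\<exists>T B. open T \<and> x \<in> T \<and> (\<forall>y\<in>?N \<inter> T. norm (F y - F x) \<le> B * norm (y - x))" for x
        using lipschitz_on_normD[OF lip] by (intro exI[of _ UNIV] exI[of _ M]) auto
    qed simp
    have "F ` K \<subseteq> (\<Union>(c, r)\<in>C. {F (c - r)..F (c + r)}) \<union> F ` ?N"
    proof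
      fix y assume "y \<in> F ` K"
      then obtain x where x: "x \<in> K" "y = F x" by blast
      show "y \<in> (\<Union>(c, r)\<in>C. {F (c - r)..F (c + r)}) \<union> F ` ?N"
      proof (cases "x \<in> ?N")
        case False
        then obtain c r where cr: "(c, r) \<in> C" "x \<in> {c - r..c + r}" using x by blast
        then have "y \<in> {F (c - r)..F (c + r)}" using Fm x by simp
        then show ?thesis using cr(1) by blast
      qed (use x in blast)
    qed
    moreover have m1: "(\<Union>(c, r)\<in>C. {F (c - r)..F (c + r)}) \<in> sets borel"
      using C(1) by (intro sets.countable_UN'') auto
    ultimately have "emeasure lebesgue (F ` K) \<le> emeasure lebesgue (\<Union>(c, r)\<in>C. {F (c - r)..F (c + r)})"
      using N by (intro emeasure_lebesgue_mono_null) auto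
    also have "\<dots> = emeasure lborel (\<Union>(c, r)\<in>C. {F (c - r)..F (c + r)})"
      using m1 by simp
    also have "\<dots> = (\<integral>\<^sup>+i. emeasure lborel (case i of (c, r) \<Rightarrow> {F (c - r)..F (c + r)}) \<partial>count_space C)"
      using C(1,4) by (intro emeasure_UN_countable) auto
    also have "\<dots> \<le> (\<integral>\<^sup>+i. ennreal p * emeasure lborel (case i of (c, r) \<Rightarrow> {c - r..c + r}) \<partial>count_space C)"
    proof (rule nn_integral_mono, clarify)
      fix c r assume "(c, r) \<in> space (count_space C)"
      then have r: "0 < r" "F (c + r) - F (c - r) \<le> p * ((c + r) - (c - r))" using C(2) by auto
      then show "emeasure lborel {F (c - r)..F (c + r)} \<le> ennreal p * emeasure lborel {c - r..c + r}"
        using Fm pq by (simp add: ennreal_mult'[symmetric] ennreal_leI)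
    qed
    also have "\<dots> = ennreal p * (\<integral>\<^sup>+i. emeasure lborel (case i of (c, r) \<Rightarrow> {c - r..c + r}) \<partial>count_space C)"
      by (intro nn_integral_cmult) auto
    also have "\<dots> = ennreal p * emeasure lborel (\<Union>(c, r)\<in>C. {c - r..c + r})"
      using C(1,3) by (subst emeasure_UN_countable) auto
    also have "\<dots> \<le> ennreal p * emeasure lborel U"
    proof -
      have "(\<Union>(c, r)\<in>C. {c - r..c + r}) \<subseteq> U" using C(2) by fastforce
      then show ?thesis using U(1) by (intro mult_left_mono emeasure_mono) auto
    qed
    also have "\<dots> \<le> ennreal p * (emeasure lborel K + ennreal (e / p))"
    proof -
      have "emeasure lborel U = emeasure lborel K + emeasure lborel (U - K)"
        using U K(1) by (subst plus_emeasure) (auto simp: Un_absorb1 borel_compact intro!: sets.Diff)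
      then show ?thesis using U(3) by (intro mult_left_mono) (auto intro: add_left_mono)
    qed
    also have "\<dots> = ennreal p * emeasure lborel K + ennreal e"
      using pq e by (simp add: distrib_left ennreal_mult'[symmetric])
    finally show "emeasure lborel (F ` K) \<le> ennreal p * emeasure lborel K + ennreal e"
      using FK by (simp add: borel_compact)
  qed
  \<comment> \<open>Now the images of the covering intervals lie in an open set little larger than \<open>F ` K\<close>.\<close>
  have low: "ennreal q * emeasure lborel K \<le> emeasure lborel (F ` K)"
  proof (rule ennreal_le_epsilon)
    fix e :: real assume e: "0 < e"
    obtain U where U: "open U" "F ` K \<subseteq> U" "emeasure lborel (U - F ` K) < ennreal e"
      using outer_regular_lborel[of "F ` K" e] FK e by (auto intro: borel_compact)
    let ?P = "\<lambda>a b. {F a..F b} \<subseteq> U \<and> q * (b - a) \<le> F b - F a"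
    have "\<exists>h. h \<noteq> 0 \<and> \<bar>h\<bar> < d \<and> ?P (min x (x + h)) (max x (x + h))" if x: "x \<in> K" "0 < d" for x d
    proof -
      obtain s where s: "0 < s" "ball (F x) s \<subseteq> U"
        using U x openE by (metis image_subset_iff)
      have Mpos: "0 \<le> M" using lip lipschitz_on_nonneg by blast
      define s' where "s' = s / (M + 1)"
      have s': "0 < s'" "M * s' < s" using s Mpos by (auto simp: s'_def field_simps)
      obtain h where h: "h \<noteq> 0" "\<bar>h\<bar> < min s' d" "q < (F (x + h) - F x) / h"
        using K(2) x s'(1) unfolding high_slope_def by (auto dest!: spec[of _ "min s' d"] subsetD)
      have "max x (x+h) - min x (x+h) > 0" using h(1) by (auto simp: min_def max_def)
      then have "q * (max x (x+h) - min x (x+h)) \<le> F (max x (x+h)) - F (min x (x+h))"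
        using h(3) quot[OF h(1), of x] by (simp add: pos_less_divide_eq)
      moreover have "{F (min x (x+h))..F (max x (x+h))} \<subseteq> ball (F x) s"
      proof -
        have "\<bar>F (x + h) - F x\<bar> \<le> M * \<bar>h\<bar>"
          using lipschitz_onD[OF lip, of "x + h" x] by (simp add: dist_real_def)
        also have "\<dots> \<le> M * s'" using h(2) Mpos by (intro mult_left_mono) auto
        finally have "\<bar>F (x + h) - F x\<bar> < s" using s' by simp
        then show ?thesis by (auto simp: dist_real_def min_def max_def split: if_splits)
      qed
      ultimately show ?thesis using s h by (intro exI[of _ h]) auto
    qed
    from expanding_vitali[of F K ?P, OF mono this] obtain C where C: "countable C"
      "\<And>c r. (c, r) \<in> C \<Longrightarrow> 0 < r \<and> ?P (c - r) (c + r)"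
      "disjoint_family_on (\<lambda>(c, r). {c - r..c + r}) C"
      "disjoint_family_on (\<lambda>(c, r). {F (c - r)..F (c + r)}) C"
      "negligible (K - (\<Union>(c, r)\<in>C. {c - r..c + r}))"
      by (auto simp: algebra_simps)
    let ?N = "K - (\<Union>(c, r)\<in>C. {c - r..c + r})"
    have m1: "(\<Union>(c, r)\<in>C. {c - r..c + r}) \<in> sets borel"
      using C(1) by (intro sets.countable_UN'') auto
    have "emeasure lebesgue K \<le> emeasure lebesgue (\<Union>(c, r)\<in>C. {c - r..c + r})"
      by (rule emeasure_lebesgue_mono_null[OF _ _ C(5)]) (use m1 in auto)
    then have "emeasure lborel K \<le> emeasure lborel (\<Union>(c, r)\<in>C. {c - r..c + r})"
      using m1 K(1) by (simp add: borel_compact)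
    then have "ennreal q * emeasure lborel K \<le> ennreal q * emeasure lborel (\<Union>(c, r)\<in>C. {c - r..c + r})"
      by (intro mult_left_mono) auto
    also have "\<dots> = ennreal q * (\<integral>\<^sup>+i. emeasure lborel (case i of (c, r) \<Rightarrow> {c - r..c + r}) \<partial>count_space C)"
      using C(1,3) by (subst emeasure_UN_countable) auto
    also have "\<dots> = (\<integral>\<^sup>+i. ennreal q * emeasure lborel (case i of (c, r) \<Rightarrow> {c - r..c + r}) \<partial>count_space C)"
      by (intro nn_integral_cmult[symmetric]) auto
    also have "\<dots> \<le> (\<integral>\<^sup>+i. emeasure lborel (case i of (c, r) \<Rightarrow> {F (c - r)..F (c + r)}) \<partial>count_space C)"
    proof (rule nn_integral_mono, clarify)
      fix c r assume "(c, r) \<in> space (count_space C)"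
      then have r: "0 < r" "q * ((c + r) - (c - r)) \<le> F (c + r) - F (c - r)" using C(2) by auto
      then show "ennreal q * emeasure lborel {c - r..c + r} \<le> emeasure lborel {F (c - r)..F (c + r)}"
        using Fm pq by (simp add: ennreal_mult'[symmetric] ennreal_leI)
    qed
    also have "\<dots> = emeasure lborel (\<Union>(c, r)\<in>C. {F (c - r)..F (c + r)})"
      using C(1,4) by (intro emeasure_UN_countable[symmetric]) auto
    also have "\<dots> \<le> emeasure lborel U"
    proof -
      have "(\<Union>(c, r)\<in>C. {F (c - r)..F (c + r)}) \<subseteq> U" using C(2) by fastforce
      then show ?thesis using U(1) by (intro emeasure_mono) auto
    qed
    also have "\<dots> = emeasure lborel (F ` K) + emeasure lborel (U - F ` K)"
      using U FK by (subst plus_emeasure) (auto simp: Un_absorb1 borel_compact intro!: sets.Diff)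
    also have "\<dots> \<le> emeasure lborel (F ` K) + ennreal e"
      using U(3) by (intro add_left_mono) auto
    finally show "ennreal q * emeasure lborel K \<le> emeasure lborel (F ` K) + ennreal e" .
  qed
  obtain m where m: "emeasure lborel K = ennreal m" "0 \<le> m"
    using fin(1) by (cases "emeasure lborel K") auto
  have "ennreal (q * m) \<le> ennreal (p * m)"
    using order_trans[OF low up] pq m by (simp add: ennreal_mult')
  then have "q * m \<le> p * m" using pq m by (simp add: ennreal_le_iff)
  then have "m = 0" using pq m(2) by (smt (verit) mult_less_cancel_right)
  then show ?thesis using m by simp
qed

text \<open>
  Adding the linear function with slope \<open>L + 1\<close> makes \<open>f\<close> strictly increasing and shifts all slopes by
  \<open>L + 1\<close>, which reduces the claim to the preceding lemma on compact subsets.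
\<close>

lemma slope_gap_null_real:
  fixes f :: "real \<Rightarrow> real"
  assumes lip: "L-lipschitz_on UNIV f" and pq: "p < q"
  shows "low_slope f 1 p \<inter> high_slope f 1 q \<in> null_sets lborel"
proof -
  let ?E = "low_slope f 1 p \<inter> high_slope f 1 q"
  have cont: "continuous_on UNIV f" using lip by (rule lipschitz_on_continuous_on)
  have E: "?E \<in> sets borel" using low_slope_borel[OF cont] high_slope_borel[OF cont] by auto
  have L: "0 \<le> L" using lip lipschitz_on_nonneg by blast
  define F where "F x = f x + (L + 1) * x" for x
  have fl: "\<bar>f x - f y\<bar> \<le> L * \<bar>x - y\<bar>" for x y
    using lipschitz_onD[OF lip, of x y] by (simp add: dist_real_def)
  have mono: "strict_mono F"
  proof (rule strict_monoI)
    fix x y :: real assume "x < y"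
    then show "F x < F y" using fl[of x y] by (simp add: F_def algebra_simps)
  qed
  have lipF: "(L + (L + 1))-lipschitz_on UNIV F"
    unfolding F_def using L
    by (intro lipschitz_on_add lip lipschitz_onI)
       (auto simp: dist_real_def abs_mult right_diff_distrib[symmetric])
  have quot: "(F (x + h) - F x) / h = (f (x + h) - f x) / h + (L + 1)" if "h \<noteq> 0" for x h
    using that by (simp add: F_def field_simps)
  have shift: "low_slope F 1 (p + (L + 1)) = low_slope f 1 p" "high_slope F 1 (q + (L + 1)) = high_slope f 1 q"
    by (auto simp: low_slope_def high_slope_def quot cong: conj_cong)
  have "emeasure lebesgue ?E \<le> 0"
  proof (rule ennreal_le_epsilon)
    fix e :: real assume e: "0 < e"
    obtain T where T: "closed T" "T \<subseteq> ?E" "?E - T \<in> lmeasurable" "emeasure lebesgue (?E - T) < ennreal e"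
      using sets_lebesgue_inner_closed[of ?E e] E e by auto
    have null: "emeasure lborel (T \<inter> cball 0 (real k)) = 0" for k
    proof (cases "T \<inter> cball 0 (real k) = {}")
      case False
      then obtain x where x: "x \<in> low_slope f 1 p" using T by auto
      then have "\<exists>h. h \<noteq> 0 \<and> \<bar>h\<bar> < 1 \<and> (f (x + h *\<^sub>R 1) - f x) / h < p"
        unfolding low_slope_def using zero_less_one by blast
      then obtain h where h: "h \<noteq> 0" "(f (x + h) - f x) / h < p"
        by auto
      have "\<bar>(f (x + h) - f x) / h\<bar> \<le> L"
        using fl[of "x + h" x] h(1) by (simp add: abs_divide pos_divide_le_eq)
      then have "0 < p + (L + 1)" using h(2) by linarith
      then show ?thesis
        by (intro compact_slopes_null[OF mono lipF, of _ "p + (L + 1)" "q + (L + 1)"])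
           (use T pq in \<open>auto simp: shift closed_Int_compact\<close>)
    qed simp
    have "T = (\<Union>k. T \<inter> cball 0 (real k))" by (auto simp: real_arch_simple)
    moreover have "(\<Union>k. T \<inter> cball 0 (real k)) \<in> null_sets lborel"
      using null T(1) by (intro null_sets_UN) (auto simp: null_sets_def)
    ultimately have "emeasure lborel T = 0" by (metis null_setsD1)
    then have "emeasure lebesgue T = 0" using T(1) by simp
    moreover have "emeasure lebesgue ?E = emeasure lebesgue (?E - T) + emeasure lebesgue T"
      using T(1,2) E by (subst plus_emeasure) (auto simp: Un_absorb2)
    ultimately show "emeasure lebesgue ?E \<le> 0 + ennreal e" using T(4) by auto
  qed
  then show ?thesis using E by auto
qed

text \<open>
  The difference quotients are bounded, so without a limit their lower and upper limits are distinct
  reals; rational bounds between them keep the exceptional set a countable union.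
\<close>

lemma slope_gap_exists:
  fixes f :: "'a::real_normed_vector \<Rightarrow> real"
  assumes lip: "L-lipschitz_on UNIV f"
    and no: "\<nexists>l. ((\<lambda>h. (f (x + h *\<^sub>R v) - f x) / h) \<longlongrightarrow> l) (at 0)"
  shows "\<exists>p\<in>\<rat>. \<exists>q\<in>\<rat>. p < q \<and> x \<in> low_slope f v p \<inter> high_slope f v q"
proof -
  let ?Q = "\<lambda>h. ereal ((f (x + h *\<^sub>R v) - f x) / h)"
  have bd: "\<bar>(f (x + h *\<^sub>R v) - f x) / h\<bar> \<le> L * norm v" for h
  proof (cases "h = 0")
    case True then show ?thesis using lipschitz_on_nonneg[OF lip] by simp
  next
    case False
    have "\<bar>f (x + h *\<^sub>R v) - f x\<bar> \<le> L * (\<bar>h\<bar> * norm v)"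
      using lipschitz_onD[OF lip, of "x + h *\<^sub>R v" x] by (simp add: dist_norm)
    then show ?thesis using False by (simp add: abs_divide field_simps)
  qed
  have lb: "ereal (- (L * norm v)) \<le> Liminf (at 0) ?Q"
  proof (intro Liminf_bounded always_eventually allI)
    show "ereal (- (L * norm v)) \<le> ?Q h" for h using bd[of h] unfolding ereal_less_eq abs_le_iff by linarith
  qed
  have ub: "Limsup (at 0) ?Q \<le> ereal (L * norm v)"
  proof (intro Limsup_bounded always_eventually allI)
    show "?Q h \<le> ereal (L * norm v)" for h using bd[of h] unfolding ereal_less_eq abs_le_iff by linarith
  qed
  have le: "Liminf (at 0) ?Q \<le> Limsup (at 0) ?Q"
    by (rule Liminf_le_Limsup) simp
  have "Liminf (at 0) ?Q \<noteq> Limsup (at 0) ?Q"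
  proof
    assume eq: "Liminf (at 0) ?Q = Limsup (at 0) ?Q"
    obtain l where l: "Limsup (at 0) ?Q = ereal l"
      using lb ub eq by (cases "Limsup (at 0) ?Q") auto
    have "(?Q \<longlongrightarrow> ereal l) (at 0)"
      using eq l by (intro Liminf_eq_Limsup) auto
    then show False using no by auto
  qed
  then have "Liminf (at 0) ?Q < Limsup (at 0) ?Q" using le by simp
  then obtain a where a: "Liminf (at 0) ?Q < ereal a" "ereal a < Limsup (at 0) ?Q"
    using ereal_dense2 by blast
  then obtain b where b: "ereal a < ereal b" "ereal b < Limsup (at 0) ?Q"
    using ereal_dense2 by blast
  obtain p where p: "p \<in> \<rat>" "a < p" "p < b" using Rats_dense_in_real[of a b] b by auto
  obtain q where q: "q \<in> \<rat>" "p < q" "q < b" using Rats_dense_in_real[of p b] p by auto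
  have "\<exists>\<^sub>F h in at 0. ?Q h < ereal p"
  proof (rule ccontr)
    assume "\<not> ?thesis"
    then have "\<forall>\<^sub>F h in at 0. ereal p \<le> ?Q h" by (simp add: not_frequently not_less)
    then have "ereal p \<le> Liminf (at 0) ?Q" by (rule Liminf_bounded)
    then have "ereal p < ereal a" using a(1) by (rule le_less_trans)
    then show False using p by simp
  qed
  moreover have "\<exists>\<^sub>F h in at 0. ereal q < ?Q h"
  proof (rule ccontr)
    assume "\<not> ?thesis"
    then have "\<forall>\<^sub>F h in at 0. ?Q h \<le> ereal q" by (simp add: not_frequently not_less)
    then have "Limsup (at 0) ?Q \<le> ereal q" by (rule Limsup_bounded)
    with b(2) have "ereal b < ereal q" by (rule less_le_trans)
    then show False using q by simp
  qed
  ultimately have "x \<in> low_slope f v p \<inter> high_slope f v q"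
    by (fastforce simp: low_slope_def high_slope_def frequently_at dist_real_def)
  then show ?thesis using p q by blast
qed

lemma nn_integral_lborel_translate:
  fixes g :: "'a::euclidean_space \<Rightarrow> ennreal"
  assumes [measurable]: "g \<in> borel_measurable borel"
  shows "(\<integral>\<^sup>+x. g (x + c) \<partial>lborel) = (\<integral>\<^sup>+x. g x \<partial>lborel)"
proof -
  have "(\<integral>\<^sup>+x. g x \<partial>lborel) = (\<integral>\<^sup>+x. g x \<partial>distr lborel borel ((+) c))"
    by (simp add: lborel_distr_plus)
  also have "\<dots> = (\<integral>\<^sup>+x. g (c + x) \<partial>lborel)"
    by (subst nn_integral_distr) auto
  finally show ?thesis by (simp add: add.commute)
qed

text \<open>
  By Tonelli and translation invariance, the measure of \<open>M\<close> times the infinite length of a line is the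
  integral of the lengths of the sections.
\<close>

lemma null_on_lines_imp_null:
  fixes M :: "'a::euclidean_space set"
  assumes M[measurable]: "M \<in> sets borel"
    and lines: "\<And>x. {s. x + s *\<^sub>R v \<in> M} \<in> null_sets lborel"
  shows "M \<in> null_sets lborel"
proof -
  have "(\<integral>\<^sup>+x. (\<integral>\<^sup>+s. indicator M (x + s *\<^sub>R v) \<partial>lborel) \<partial>(lborel :: 'a measure)) = 0"
  proof -
    have "(\<integral>\<^sup>+s. indicator M (x + s *\<^sub>R v) \<partial>lborel) = 0" for x
    proof -
      have "(\<integral>\<^sup>+s. indicator M (x + s *\<^sub>R v) \<partial>lborel) = (\<integral>\<^sup>+s. indicator {s. x + s *\<^sub>R v \<in> M} s \<partial>lborel)"
        by (intro nn_integral_cong) (auto simp: indicator_def)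
      also have "\<dots> = emeasure lborel {s. x + s *\<^sub>R v \<in> M}"
        using lines by (intro nn_integral_indicator) (auto simp: null_sets_def)
      finally show ?thesis using lines by auto
    qed
    then show ?thesis by simp
  qed
  also have "(\<integral>\<^sup>+x. (\<integral>\<^sup>+s. indicator M (x + s *\<^sub>R v) \<partial>lborel) \<partial>(lborel :: 'a measure)) =
      (\<integral>\<^sup>+s. (\<integral>\<^sup>+x. indicator M (x + s *\<^sub>R v) \<partial>lborel) \<partial>lborel)"
    by (rule lborel_pair.Fubini'[symmetric]) measurable
  also have "\<dots> = (\<integral>\<^sup>+s. emeasure lborel M \<partial>(lborel :: real measure))"
    using nn_integral_lborel_translate[of "indicator M"] by simp
  finally have "emeasure lborel M * emeasure lborel (UNIV :: real set) = 0" by simp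
  then have "emeasure lborel M = 0" by simp
  then show ?thesis by auto
qed

lemma AE_directional_derivative:
  fixes f :: "'a::euclidean_space \<Rightarrow> real"
  assumes lip: "L-lipschitz_on UNIV f"
  shows "AE x in lborel. \<exists>l. ((\<lambda>h. (f (x + h *\<^sub>R v) - f x) / h) \<longlongrightarrow> l) (at 0)"
proof -
  have cont: "continuous_on UNIV f" using lip by (rule lipschitz_on_continuous_on)
  let ?I = "{(p, q). p \<in> \<rat> \<and> q \<in> \<rat> \<and> p < q}"
  let ?N = "\<Union>(p, q)\<in>?I. low_slope f v p \<inter> high_slope f v q"
  have "countable ?I"
    by (rule countable_subset[of _ "\<rat> \<times> \<rat>"]) (auto intro: countable_SIGMA countable_rat)
  have M: "low_slope f v p \<inter> high_slope f v q \<in> null_sets lborel" if "p < q" for p q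
  proof (rule null_on_lines_imp_null)
    show "low_slope f v p \<inter> high_slope f v q \<in> sets borel"
      using low_slope_borel[OF cont] high_slope_borel[OF cont] by auto
    fix x
    let ?g = "\<lambda>s. f (x + s *\<^sub>R v)"
    have "(L * norm v)-lipschitz_on UNIV ?g"
    proof (rule lipschitz_onI)
      show "dist (?g s) (?g t) \<le> L * norm v * dist s t" for s t
        using lipschitz_onD[OF lip, of "x + s *\<^sub>R v" "x + t *\<^sub>R v"]
        by (simp add: dist_norm scaleR_diff_left[symmetric] mult_ac)
    qed (use lipschitz_on_nonneg[OF lip] in simp)
    then have "low_slope ?g 1 p \<inter> high_slope ?g 1 q \<in> null_sets lborel"
      using that by (rule slope_gap_null_real)
    moreover have "low_slope ?g 1 p \<inter> high_slope ?g 1 q = {s. x + s *\<^sub>R v \<in> low_slope f v p \<inter> high_slope f v q}"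
      by (auto simp: low_slope_def high_slope_def scaleR_add_left add.assoc)
    ultimately show "{s. x + s *\<^sub>R v \<in> low_slope f v p \<inter> high_slope f v q} \<in> null_sets lborel" by simp
  qed
  have "?N \<in> null_sets lborel"
    using M \<open>countable ?I\<close> by (intro null_sets_UN') auto
  then show ?thesis
  proof (rule AE_I')
    show "{x \<in> space lborel. \<nexists>l. ((\<lambda>h. (f (x + h *\<^sub>R v) - f x) / h) \<longlongrightarrow> l) (at 0)} \<subseteq> ?N"
      using slope_gap_exists[OF lip, where v = v] by blast
  qed
qed

section \<open>Rademacher's theorem\<close>

text \<open>
  Directional derivatives are evaluated along the steps \<open>1 / (k + 1)\<close>, and by an upper limit, so that for
  Lipschitz \<open>f\<close> the function \<open>dir_deriv f v\<close> is Borel and bounded even where the limit does not exist.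
\<close>

definition dquot :: "('a::real_normed_vector \<Rightarrow> real) \<Rightarrow> 'a \<Rightarrow> nat \<Rightarrow> 'a \<Rightarrow> real" where
  "dquot f v k x = (f (x + inverse (real (Suc k)) *\<^sub>R v) - f x) / inverse (real (Suc k))"

definition dir_deriv :: "('a::real_normed_vector \<Rightarrow> real) \<Rightarrow> 'a \<Rightarrow> 'a \<Rightarrow> real" where
  "dir_deriv f v x = real_of_ereal (limsup (\<lambda>k. ereal (dquot f v k x)))"

lemma lipschitz_step:
  fixes f :: "'a::real_normed_vector \<Rightarrow> real"
  assumes "L-lipschitz_on UNIV f"
  shows "\<bar>f (x + v) - f x\<bar> \<le> L * norm v"
  using lipschitz_onD[OF assms, of "x + v" x] by (simp add: dist_norm)

lemma dquot_bound:
  fixes f :: "'a::real_normed_vector \<Rightarrow> real"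
  assumes "L-lipschitz_on UNIV f"
  shows "\<bar>dquot f v k x\<bar> \<le> L * norm v"
proof -
  let ?h = "inverse (real (Suc k))"
  have "\<bar>f (x + ?h *\<^sub>R v) - f x\<bar> \<le> (L * norm v) * ?h"
    using lipschitz_step[OF assms, of x "?h *\<^sub>R v"] by (simp add: mult_ac)
  then show ?thesis
    unfolding dquot_def by (simp add: abs_divide divide_le_eq del: of_nat_Suc)
qed

lemma dquot_tendsto:
  assumes "((\<lambda>h. (f (x + h *\<^sub>R v) - f x) / h) \<longlongrightarrow> l) (at 0)"
  shows "(\<lambda>k. dquot f v k x) \<longlonglongrightarrow> l"
proof -
  have "filterlim (\<lambda>k. inverse (real (Suc k))) (at 0) sequentially"
    by (intro filterlim_atI LIMSEQ_inverse_real_of_nat) (auto intro: always_eventually)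
  from filterlim_compose[OF assms this] show ?thesis
    unfolding dquot_def .
qed

lemma dir_deriv_eqI:
  assumes "(\<lambda>k. dquot f v k x) \<longlonglongrightarrow> l"
  shows "dir_deriv f v x = l"
proof -
  have "limsup (\<lambda>k. ereal (dquot f v k x)) = ereal l"
    using assms by (intro lim_imp_Limsup) auto
  then show ?thesis by (simp add: dir_deriv_def)
qed

lemma dir_deriv_bound:
  fixes f :: "'a::real_normed_vector \<Rightarrow> real"
  assumes lip: "L-lipschitz_on UNIV f"
  shows "\<bar>dir_deriv f v x\<bar> \<le> L * norm v"
proof -
  have 1: "ereal (- (L * norm v)) \<le> ereal (dquot f v k x)" "ereal (dquot f v k x) \<le> ereal (L * norm v)" for k
    using dquot_bound[OF lip, of v k x] unfolding ereal_less_eq abs_le_iff by linarith+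
  have "ereal (- (L * norm v)) \<le> liminf (\<lambda>k. ereal (dquot f v k x))"
    by (rule Liminf_bounded) (use 1 in simp)
  also have "\<dots> \<le> limsup (\<lambda>k. ereal (dquot f v k x))"
    by (rule Liminf_le_Limsup) simp
  finally have a: "ereal (- (L * norm v)) \<le> limsup (\<lambda>k. ereal (dquot f v k x))" .
  have b: "limsup (\<lambda>k. ereal (dquot f v k x)) \<le> ereal (L * norm v)"
    by (rule Limsup_bounded) (use 1 in simp)
  show ?thesis
    using a b unfolding dir_deriv_def by (cases "limsup (\<lambda>k. ereal (dquot f v k x))") auto
qed

lemma AE_dir_deriv:
  fixes f :: "'a::euclidean_space \<Rightarrow> real"
  assumes lip: "L-lipschitz_on UNIV f"
  shows "AE x in lborel. ((\<lambda>h. (f (x + h *\<^sub>R v) - f x) / h) \<longlongrightarrow> dir_deriv f v x) (at 0)"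
  using AE_directional_derivative[OF lip, of v]
proof eventually_elim
  case (elim x)
  then show ?case using dir_deriv_eqI[OF dquot_tendsto] by metis
qed

lemma dquot_measurable [measurable]:
  fixes f :: "'a::euclidean_space \<Rightarrow> real"
  assumes "f \<in> borel_measurable borel"
  shows "dquot f v k \<in> borel_measurable borel"
  using assms unfolding dquot_def[abs_def] by measurable

lemma dir_deriv_measurable [measurable]:
  fixes f :: "'a::euclidean_space \<Rightarrow> real"
  assumes [measurable]: "f \<in> borel_measurable borel"
  shows "dir_deriv f v \<in> borel_measurable borel"
  unfolding dir_deriv_def[abs_def] by measurable

lemma integral_lborel_translate:
  fixes g :: "'a::euclidean_space \<Rightarrow> real"
  assumes [measurable]: "g \<in> borel_measurable borel"
  shows "(\<integral>x. g (x + c) \<partial>lborel) = (\<integral>x. g x \<partial>lborel)"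
proof -
  have "(\<integral>x. g x \<partial>lborel) = (\<integral>x. g x \<partial>distr lborel borel ((+) c))"
    by (simp add: lborel_distr_plus)
  also have "\<dots> = (\<integral>x. g (c + x) \<partial>lborel)"
    by (subst integral_distr) auto
  finally show ?thesis by (simp add: add.commute)
qed

lemma lipschitz_borel_measurable:
  fixes f :: "'a::euclidean_space \<Rightarrow> real"
  assumes "L-lipschitz_on UNIV f"
  shows "f \<in> borel_measurable borel"
  using lipschitz_on_continuous_on[OF assms] by (rule borel_measurable_continuous_onI)

lemma bounded_indicator_integrable:
  fixes g :: "'a::euclidean_space \<Rightarrow> real"
  assumes [measurable]: "g \<in> borel_measurable borel" "B \<in> sets borel" and "bounded B" "\<And>x. \<bar>g x\<bar> \<le> C"
  shows "integrable lborel (\<lambda>x. g x * indicator B x)"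
proof (rule integrableI_bounded_set[of B _ _ C])
  show "emeasure lborel B < \<infinity>" using emeasure_bounded_finite[OF \<open>bounded B\<close>] .
  show "AE x\<in>B in lborel. norm (g x * indicator B x) \<le> C"
    using assms(4) by (auto simp: indicator_def)
qed (auto simp: indicator_def)

text \<open>
  The difference quotient in direction \<open>v + w\<close> is the quotient in direction \<open>v\<close> plus a translate of the
  quotient in direction \<open>w\<close>.  Moved onto the indicator of the box, the translation disappears in the limit.
\<close>

lemma dir_deriv_box_integral_add:
  fixes f :: "'a::euclidean_space \<Rightarrow> real"
  assumes lip: "L-lipschitz_on UNIV f"
  shows "(\<integral>x. dir_deriv f (v + w) x * indicator (box l u) x \<partial>lborel) =
     (\<integral>x. dir_deriv f v x * indicator (box l u) x \<partial>lborel) +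
     (\<integral>x. dir_deriv f w x * indicator (box l u) x \<partial>lborel)"
proof -
  let ?B = "box l u"
  let ?h = "\<lambda>k. inverse (real (Suc k))"
  note [measurable] = lipschitz_borel_measurable[OF lip]
  have L: "0 \<le> L" using lip lipschitz_on_nonneg by blast
  have AEq: "AE x in lborel. (\<lambda>k. dquot f z k x) \<longlonglongrightarrow> dir_deriv f z x" for z
    using AE_dir_deriv[OF lip, of z] by eventually_elim (rule dquot_tendsto)
  have h0: "(\<lambda>k. x - ?h k *\<^sub>R v) \<longlonglongrightarrow> x" for x
    using tendsto_diff[OF tendsto_const[of x] tendsto_scaleR[OF LIMSEQ_inverse_real_of_nat tendsto_const[of v]]] by simp
  have lim: "(\<lambda>k. \<integral>x. dquot f z k x * indicator ?B x \<partial>lborel) \<longlonglongrightarrow>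
      (\<integral>x. dir_deriv f z x * indicator ?B x \<partial>lborel)" for z
  proof (rule integral_dominated_convergence[where w = "\<lambda>x. (L * norm z) * indicator ?B x"])
    show "integrable lborel (\<lambda>x. L * norm z * indicator ?B x)"
      by (rule bounded_indicator_integrable[where C = "\<bar>L * norm z\<bar>"]) auto
    show "AE x in lborel. (\<lambda>k. dquot f z k x * indicator ?B x) \<longlonglongrightarrow> dir_deriv f z x * indicator ?B x"
      using AEq[of z] by eventually_elim (intro tendsto_intros)
    show "AE x in lborel. norm (dquot f z k x * indicator ?B x) \<le> L * norm z * indicator ?B x" for k
      using dquot_bound[OF lip, of z k] by (auto simp: indicator_def)
  qed measurable
  obtain R where R: "\<And>x. x \<in> ?B \<Longrightarrow> norm x \<le> R"
    using bounded_box[of l u] unfolding bounded_iff by blast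
  have lim2: "(\<lambda>k. \<integral>x. dquot f w k x * indicator ?B (x - ?h k *\<^sub>R v) \<partial>lborel) \<longlonglongrightarrow>
      (\<integral>x. dir_deriv f w x * indicator ?B x \<partial>lborel)"
  proof (rule integral_dominated_convergence[where w = "\<lambda>x. (L * norm w) * indicator (cball 0 (R + norm v)) x"])
    show "integrable lborel (\<lambda>x. L * norm w * indicator (cball 0 (R + norm v)) x)"
      by (rule bounded_indicator_integrable[where C = "\<bar>L * norm w\<bar>"]) auto
    have fr: "AE x in lborel. x \<notin> frontier ?B"
    proof (rule AE_I')
      have "negligible (frontier ?B)" by (intro negligible_convex_frontier convex_box)
      then show "frontier ?B \<in> null_sets lborel"
        by (simp add: negligible_iff_null_sets null_sets_completion_iff)
    qed auto
    show "AE x in lborel. (\<lambda>k. dquot f w k x * indicator ?B (x - ?h k *\<^sub>R v)) \<longlonglongrightarrow> dir_deriv f w x * indicator ?B x"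
      using AEq[of w] fr
    proof eventually_elim
      case (elim x)
      have "\<forall>\<^sub>F k in sequentially. indicator ?B (x - ?h k *\<^sub>R v) = (indicator ?B x :: real)"
      proof (cases "x \<in> ?B")
        case True
        have "\<forall>\<^sub>F k in sequentially. x - ?h k *\<^sub>R v \<in> ?B"
          using topological_tendstoD[OF h0 open_box True] .
        then show ?thesis by eventually_elim (use True in simp)
      next
        case False
        then have x: "x \<in> - closure ?B" using elim(2) interior_open[OF open_box[of l u]] by (auto simp: frontier_def)
        have "\<forall>\<^sub>F k in sequentially. x - ?h k *\<^sub>R v \<in> - closure ?B"
          by (rule topological_tendstoD[OF h0 _ x]) auto
        then show ?thesis
          by eventually_elim (use False closure_subset[of ?B] in \<open>auto simp: indicator_def\<close>)
      qed
      then have "(\<lambda>k. indicator ?B (x - ?h k *\<^sub>R v) :: real) \<longlonglongrightarrow> indicator ?B x"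
        by (rule tendsto_eventually)
      with elim(1) show ?case by (rule tendsto_mult)
    qed
    show "AE x in lborel. norm (dquot f w k x * indicator ?B (x - ?h k *\<^sub>R v))
        \<le> L * norm w * indicator (cball 0 (R + norm v)) x" for k
    proof (rule AE_I2)
      fix x
      have "norm x \<le> R + norm v" if "x - ?h k *\<^sub>R v \<in> ?B"
      proof -
        have "norm x \<le> norm (x - ?h k *\<^sub>R v) + norm (?h k *\<^sub>R v)"
          using norm_triangle_ineq[of "x - ?h k *\<^sub>R v" "?h k *\<^sub>R v"] by simp
        moreover have "norm (?h k *\<^sub>R v) \<le> norm v"
          using mult_right_mono[of "?h k" 1 "norm v"] by (simp add: inverse_le_1_iff del: of_nat_Suc)
        ultimately show ?thesis using R[OF that] by linarith
      qed
      then show "norm (dquot f w k x * indicator ?B (x - ?h k *\<^sub>R v))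
        \<le> L * norm w * indicator (cball 0 (R + norm v)) x"
        using dquot_bound[OF lip, of w k x] L by (auto simp: indicator_def)
    qed
  qed measurable
  have split: "(\<integral>x. dquot f (v + w) k x * indicator ?B x \<partial>lborel) =
     (\<integral>x. dquot f w k x * indicator ?B (x - ?h k *\<^sub>R v) \<partial>lborel) + (\<integral>x. dquot f v k x * indicator ?B x \<partial>lborel)" for k
  proof -
    have e: "dquot f (v + w) k x = dquot f w k (x + ?h k *\<^sub>R v) + dquot f v k x" for x
      by (simp add: dquot_def scaleR_add_right add.assoc add_divide_distrib[symmetric] del: of_nat_Suc)
    have "(\<integral>x. dquot f (v + w) k x * indicator ?B x \<partial>lborel) =
      (\<integral>x. dquot f w k (x + ?h k *\<^sub>R v) * indicator ?B x + dquot f v k x * indicator ?B x \<partial>lborel)"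
      by (simp add: e distrib_right)
    also have "\<dots> = (\<integral>x. dquot f w k (x + ?h k *\<^sub>R v) * indicator ?B x \<partial>lborel) + (\<integral>x. dquot f v k x * indicator ?B x \<partial>lborel)"
      by (intro Bochner_Integration.integral_add bounded_indicator_integrable[where C = "L * norm w"]
            bounded_indicator_integrable[where C = "L * norm v"] dquot_bound[OF lip]) auto
    also have "(\<integral>x. dquot f w k (x + ?h k *\<^sub>R v) * indicator ?B x \<partial>lborel) =
      (\<integral>x. dquot f w k x * indicator ?B (x - ?h k *\<^sub>R v) \<partial>lborel)"
      using integral_lborel_translate[of "\<lambda>x. dquot f w k x * indicator ?B (x - ?h k *\<^sub>R v)" "?h k *\<^sub>R v"]
      by simp
    finally show ?thesis .
  qed
  have "(\<lambda>k. \<integral>x. dquot f (v + w) k x * indicator ?B x \<partial>lborel) \<longlonglongrightarrow>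
     (\<integral>x. dir_deriv f w x * indicator ?B x \<partial>lborel) + (\<integral>x. dir_deriv f v x * indicator ?B x \<partial>lborel)"
    unfolding split by (intro tendsto_add lim lim2)
  from LIMSEQ_unique[OF this lim] show ?thesis by simp
qed

text \<open>
  For a large constant \<open>K\<close> the density \<open>1 + d / K\<close> is nonnegative and gives every box its volume; as boxes determine
  Lebesgue measure, the density is 1.
\<close>

lemma box_integrals_zero_imp_AE_zero:
  fixes d :: "'a::euclidean_space \<Rightarrow> real"
  assumes [measurable]: "d \<in> borel_measurable borel" and bd: "\<And>x. \<bar>d x\<bar> \<le> C" 
    and z: "\<And>l u. (\<integral>x. d x * indicator (box l u) x \<partial>lborel) = 0"
  shows "AE x in lborel. d x = 0"
proof -
  define K where "K = C + 1"
  have K: "0 < K" "\<And>x. \<bar>d x / K\<bar> \<le> 1"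
  proof -
    show "0 < K" using bd[of 0] by (simp add: K_def)
    then show "\<bar>d x / K\<bar> \<le> 1" for x using bd[of x] by (simp add: K_def abs_divide)
  qed
  have nn: "0 \<le> 1 + d x / K" for x using K(2)[of x] unfolding abs_le_iff by linarith
  let ?M = "density lborel (\<lambda>x. ennreal (1 + d x / K))"
  have "lborel = ?M"
  proof (rule lborel_eqI)
    fix l u :: 'a assume lu: "\<And>b. b \<in> Basis \<Longrightarrow> l \<bullet> b \<le> u \<bullet> b"
    have int: "integrable lborel (\<lambda>x. (1 + d x / K) * indicator (box l u) x)"
    proof (rule bounded_indicator_integrable[where C = 2])
      show "\<bar>1 + d x / K\<bar> \<le> 2" for x using K(2)[of x] by linarith
    qed auto
    have i2: "integrable lborel (\<lambda>x. d x / K * indicator (box l u) x)"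
      by (rule bounded_indicator_integrable[where C = 1]) (use K(2) in auto)
    have i1: "integrable lborel (\<lambda>x. 1 * indicator (box l u) x :: real)"
      by (rule bounded_indicator_integrable[where C = 1]) auto
    have "emeasure ?M (box l u) = (\<integral>\<^sup>+x. ennreal (1 + d x / K) * indicator (box l u) x \<partial>lborel)"
      by (rule emeasure_density) auto
    also have "\<dots> = (\<integral>\<^sup>+x. ennreal ((1 + d x / K) * indicator (box l u) x) \<partial>lborel)"
      by (intro nn_integral_cong) (auto simp: indicator_def)
    also have "\<dots> = ennreal (\<integral>x. (1 + d x / K) * indicator (box l u) x \<partial>lborel)"
      using nn by (intro nn_integral_eq_integral int) auto
    also have "(\<integral>x. (1 + d x / K) * indicator (box l u) x \<partial>lborel) =
       (\<integral>x. 1 * indicator (box l u) x \<partial>lborel) + (\<integral>x. d x / K * indicator (box l u) x \<partial>lborel)"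
      by (subst Bochner_Integration.integral_add[OF i1 i2, symmetric]) (simp add: distrib_right)
    also have "(\<integral>x. d x / K * indicator (box l u) x \<partial>lborel) = 0"
    proof -
      have "(\<lambda>x. d x / K * indicator (box l u) x) = (\<lambda>x. inverse K * (d x * indicator (box l u) x))"
        by (simp add: fun_eq_iff divide_inverse)
      then show ?thesis using z[of l u] by simp
    qed
    also have "(\<integral>x. 1 * indicator (box l u) x \<partial>lborel) = (\<Prod>b\<in>Basis. (u - l) \<bullet> b)"
      using lu by (simp add: measure_def emeasure_lborel_box_eq prod_nonneg inner_diff_left)
    finally show "emeasure ?M (box l u) = ennreal (\<Prod>b\<in>Basis. (u - l) \<bullet> b)" by simp
  qed simp
  then have "density lborel (\<lambda>x. ennreal (1 + d x / K)) = density lborel (\<lambda>_. 1)"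
    by (simp add: density_1)
  then have "AE x in lborel. ennreal (1 + d x / K) = 1"
    by (intro sigma_finite_measure.density_unique[OF sigma_finite_lborel]) auto
  then show ?thesis
  proof eventually_elim
    case (elim x)
    then show ?case using nn[of x] K(1) by (simp add: ennreal_eq_1)
  qed
qed

lemma dir_deriv_add_AE:
  fixes f :: "'a::euclidean_space \<Rightarrow> real"
  assumes lip: "L-lipschitz_on UNIV f"
  shows "AE x in lborel. dir_deriv f (v + w) x = dir_deriv f v x + dir_deriv f w x"
proof -
  note [measurable] = lipschitz_borel_measurable[OF lip]
  note b = dir_deriv_bound[OF lip]
  have "AE x in lborel. dir_deriv f (v + w) x - dir_deriv f v x - dir_deriv f w x = 0"
  proof (rule box_integrals_zero_imp_AE_zero[where C = "L * norm (v + w) + L * norm v + L * norm w"])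
    show "\<bar>dir_deriv f (v + w) x - dir_deriv f v x - dir_deriv f w x\<bar> \<le> L * norm (v + w) + L * norm v + L * norm w" for x
      using b[of "v + w" x] b[of v x] b[of w x] by linarith
    fix l u :: 'a
    have i: "integrable lborel (\<lambda>x. dir_deriv f z x * indicator (box l u) x)" for z
      by (rule bounded_indicator_integrable[OF _ _ bounded_box b]) auto
    show "(\<integral>x. (dir_deriv f (v + w) x - dir_deriv f v x - dir_deriv f w x) * indicator (box l u) x \<partial>lborel) = 0"
      using dir_deriv_box_integral_add[OF lip, of v w l u] i
      by (simp add: left_diff_distrib)
  qed measurable
  then show ?thesis by eventually_elim simp
qed

lemma dir_deriv_scale:
  fixes f :: "'a::real_normed_vector \<Rightarrow> real"
  assumes "((\<lambda>h. (f (x + h *\<^sub>R v) - f x) / h) \<longlongrightarrow> l) (at 0)"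
  shows "((\<lambda>h. (f (x + h *\<^sub>R (c *\<^sub>R v)) - f x) / h) \<longlongrightarrow> c * l) (at 0)"
proof (cases "c = 0")
  case False
  have "filterlim (\<lambda>h. h * c) (at 0) (at 0)"
    using False by (intro filterlim_atI) (auto intro!: tendsto_eq_intros simp: eventually_at_filter)
  from filterlim_compose[OF assms this]
  have "((\<lambda>h. c * ((f (x + (h * c) *\<^sub>R v) - f x) / (h * c))) \<longlongrightarrow> c * l) (at 0)"
    by (intro tendsto_intros)
  moreover have "(\<lambda>h. (f (x + h *\<^sub>R (c *\<^sub>R v)) - f x) / h) = (\<lambda>h. c * ((f (x + (h * c) *\<^sub>R v) - f x) / (h * c)))"
    using False by (auto simp: fun_eq_iff)
  ultimately show ?thesis by (rule back_subst[of "\<lambda>g. (g \<longlongrightarrow> c * l) (at 0)", OF _ sym])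
qed simp

lemma dir_deriv_linear_AE:
  fixes f :: "'a::euclidean_space \<Rightarrow> real"
  assumes lip: "L-lipschitz_on UNIV f"
  shows "AE x in lborel. dir_deriv f v x = (\<Sum>b\<in>Basis. dir_deriv f b x *\<^sub>R b) \<bullet> v"
proof -
  have "AE x in lborel. dir_deriv f (\<Sum>b\<in>S. (v \<bullet> b) *\<^sub>R b) x = (\<Sum>b\<in>S. (v \<bullet> b) * dir_deriv f b x)"
    if "finite S" for S :: "'a set"
    using that
  proof induction
    case empty
    have "dir_deriv f 0 x = 0" for x by (rule dir_deriv_eqI) (simp add: dquot_def)
    then show ?case by simp
  next
    case (insert b S)
    have "AE x in lborel. dir_deriv f ((v \<bullet> b) *\<^sub>R b) x = (v \<bullet> b) * dir_deriv f b x"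
      using AE_dir_deriv[OF lip, of b]
      by eventually_elim (intro dir_deriv_eqI dquot_tendsto dir_deriv_scale)
    with insert.IH dir_deriv_add_AE[OF lip, of "(v \<bullet> b) *\<^sub>R b" "\<Sum>b\<in>S. (v \<bullet> b) *\<^sub>R b"]
    show ?case
      by eventually_elim (use insert.hyps in simp)
  qed
  from this[OF finite_Basis] show ?thesis
    by (simp add: euclidean_representation inner_sum_right mult.commute inner_commute[of _ v])
qed

text \<open>
  The unit ball is covered by finitely many small balls around the given directions, and the Lipschitz
  bound makes the directional limits uniform over all directions.
\<close>

lemma differentiable_from_dense_directions:
  fixes f :: "'a::euclidean_space \<Rightarrow> real"
  assumes lip: "L-lipschitz_on UNIV f"
    and dense: "\<And>e. 0 < e \<Longrightarrow> cball 0 1 \<subseteq> (\<Union>v\<in>V. ball v e)"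
    and dir: "\<And>v. v \<in> V \<Longrightarrow> ((\<lambda>h. (f (x + h *\<^sub>R v) - f x) / h) \<longlongrightarrow> G \<bullet> v) (at 0)"
  shows "GDERIV f x :> G"
  unfolding gderiv_def has_derivative_at_alt
proof (intro conjI allI impI)
  show "bounded_linear (\<lambda>h. h \<bullet> G)" by (rule bounded_linear_inner_left)
  fix e :: real assume e: "0 < e"
  have L: "0 \<le> L" using lip lipschitz_on_nonneg by blast
  define e' where "e' = e / (L + 1 + norm G)"
  have e': "0 < e'" using e L by (simp add: e'_def add_nonneg_pos add_pos_nonneg)
  have ee: "(L + 1 + norm G) * e' = e" using L by (simp add: e'_def add_nonneg_eq_0_iff)
  obtain F where F: "F \<subseteq> V" "finite F" "cball 0 1 \<subseteq> (\<Union>v\<in>F. ball v e')"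
    by (rule compactE_image[OF compact_cball _ dense[OF e']]) auto
  have "\<forall>\<^sub>F h in at 0. \<forall>v\<in>F. \<bar>(f (x + h *\<^sub>R v) - f x) / h - G \<bullet> v\<bar> < e'"
  proof (intro eventually_ball_finite ballI)
    fix v assume "v \<in> F"
    then have "v \<in> V" using F(1) by blast
    from tendstoD[OF dir[OF this] e'] show "\<forall>\<^sub>F h in at 0. \<bar>(f (x + h *\<^sub>R v) - f x) / h - G \<bullet> v\<bar> < e'"
      by (simp add: dist_real_def)
  qed (rule F(2))
  then obtain d where d: "0 < d" "\<And>h v. h \<noteq> 0 \<Longrightarrow> \<bar>h\<bar> < d \<Longrightarrow> v \<in> F \<Longrightarrow> \<bar>(f (x + h *\<^sub>R v) - f x) / h - G \<bullet> v\<bar> < e'"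
    unfolding eventually_at by (auto simp: dist_real_def)
  show "\<exists>d>0. \<forall>y. norm (y - x) < d \<longrightarrow> norm (f y - f x - (y - x) \<bullet> G) \<le> e * norm (y - x)"
  proof (intro exI conjI allI impI, fact d(1))
    fix y assume y: "norm (y - x) < d"
    show "norm (f y - f x - (y - x) \<bullet> G) \<le> e * norm (y - x)"
    proof (cases "y = x")
      case False
      define h where "h = norm (y - x)"
      define w where "w = inverse h *\<^sub>R (y - x)"
      have h: "0 < h" "h < d" using False y by (auto simp: h_def)
      have w: "y = x + h *\<^sub>R w" "norm w = 1" using h by (auto simp: w_def h_def)
      obtain v where v: "v \<in> F" "norm (w - v) < e'"
        using F(3) w(2) by (force simp: dist_norm norm_minus_commute)
      have "\<bar>(f (x + h *\<^sub>R v) - f x) / h - G \<bullet> v\<bar> < e'" using d(2)[of h v] h v by auto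
      then have 1: "\<bar>f (x + h *\<^sub>R v) - f x - h * (G \<bullet> v)\<bar> \<le> e' * h"
        using h(1) by (simp add: abs_less_iff abs_le_iff field_simps)
      have 2: "\<bar>f (x + h *\<^sub>R w) - f (x + h *\<^sub>R v)\<bar> \<le> L * (h * e')"
      proof -
        have "\<bar>f (x + h *\<^sub>R w) - f (x + h *\<^sub>R v)\<bar> \<le> L * norm (h *\<^sub>R (w - v))"
          using lipschitz_onD[OF lip, of "x + h *\<^sub>R w" "x + h *\<^sub>R v"] by (simp add: dist_norm scaleR_diff_right)
        also have "\<dots> \<le> L * (h * e')"
          using h v L by (intro mult_left_mono) auto
        finally show ?thesis .
      qed
      have 3: "\<bar>h * (G \<bullet> (v - w))\<bar> \<le> h * (norm G * e')"
      proof -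
        have "\<bar>G \<bullet> (v - w)\<bar> \<le> norm G * norm (v - w)" by (rule Cauchy_Schwarz_ineq2)
        also have "\<dots> \<le> norm G * e'" using v by (intro mult_left_mono) (auto simp: norm_minus_commute)
        finally show ?thesis using h(1) by (simp add: abs_mult)
      qed
      have "f y - f x - (y - x) \<bullet> G = (f (x + h *\<^sub>R w) - f (x + h *\<^sub>R v)) + (f (x + h *\<^sub>R v) - f x - h * (G \<bullet> v)) + h * (G \<bullet> (v - w))"
        using w(1) by (simp add: inner_diff_right right_diff_distrib inner_commute)
      then have "\<bar>f y - f x - (y - x) \<bullet> G\<bar> \<le> L * (h * e') + e' * h + h * (norm G * e')"
        using 1 2 3 by linarith
      also have "\<dots> = ((L + 1 + norm G) * e') * h" by (simp add: algebra_simps)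
      finally show ?thesis by (simp add: ee h_def)
    qed simp
  qed
qed

lemma GDERIV_directional:
  assumes "GDERIV f x :> G"
  shows "((\<lambda>h. (f (x + h *\<^sub>R v) - f x) / h) \<longlongrightarrow> G \<bullet> v) (at 0)"
proof -
  have "((\<lambda>s. f (x + s *\<^sub>R v)) has_derivative (\<lambda>s. (s *\<^sub>R v) \<bullet> G)) (at 0)"
    by (rule has_derivative_compose[where f = "\<lambda>s. x + s *\<^sub>R v" and g = f, simplified])
       (use assms in \<open>auto intro!: derivative_eq_intros simp: gderiv_def\<close>)
  then have "((\<lambda>s. f (x + s *\<^sub>R v)) has_real_derivative (G \<bullet> v)) (at 0)"
    by (simp add: has_field_derivative_def inner_commute mult.commute[of _ "G \<bullet> v"] mult_commute_abs)
  then show ?thesis by (simp add: DERIV_def)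
qed

lemma GDERIV_unique:
  assumes "GDERIV f x :> D" "GDERIV f x :> E"
  shows "D = E"
proof -
  have "D \<bullet> v = E \<bullet> v" for v
    using tendsto_unique[OF _ GDERIV_directional[OF assms(1)] GDERIV_directional[OF assms(2)]] by simp
  then show ?thesis using vector_eq_rdot[of D E] by blast
qed

lemma gradient_eqI:
  assumes "GDERIV f x :> D"
  shows "gradient f x = D"
proof -
  have "(THE E. GDERIV f x :> E) = D"
    using assms GDERIV_unique[OF _ assms] by (intro the_equality)
  then show ?thesis using assms by (auto simp: gradient_def)
qed

text \<open>
  Almost everywhere all directional derivatives from a countable dense set exist and depend linearly
  on the direction.
\<close>

lemma rademacher:
  fixes f :: "'a::euclidean_space \<Rightarrow> real"
  assumes lip: "L-lipschitz_on UNIV f"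
  shows "AE x in lborel. GDERIV f x :> gradient f x \<and> gradient f x = (\<Sum>b\<in>Basis. dir_deriv f b x *\<^sub>R b)"
proof -
  obtain V :: "'a set" where V: "countable V" "\<And>X. open X \<Longrightarrow> X \<noteq> {} \<Longrightarrow> \<exists>d\<in>V. d \<in> X"
    using countable_dense_exists by (metis)
  have dense: "cball 0 1 \<subseteq> (\<Union>v\<in>V. ball v e)" if e: "0 < e" for e
  proof
    fix x :: 'a
    obtain v where "v \<in> V" "v \<in> ball x e" using V(2)[of "ball x e"] e by auto
    then show "x \<in> (\<Union>v\<in>V. ball v e)" by (auto simp: dist_commute)
  qed
  have "AE x in lborel. \<forall>v\<in>V. ((\<lambda>h. (f (x + h *\<^sub>R v) - f x) / h) \<longlongrightarrow> (\<Sum>b\<in>Basis. dir_deriv f b x *\<^sub>R b) \<bullet> v) (at 0)"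
    unfolding AE_ball_countable[OF V(1)]
  proof
    fix v
    show "AE x in lborel. ((\<lambda>h. (f (x + h *\<^sub>R v) - f x) / h) \<longlongrightarrow> (\<Sum>b\<in>Basis. dir_deriv f b x *\<^sub>R b) \<bullet> v) (at 0)"
      using AE_dir_deriv[OF lip, of v] dir_deriv_linear_AE[OF lip, of v]
      by eventually_elim simp
  qed
  then show ?thesis
  proof eventually_elim
    case (elim x)
    have "GDERIV f x :> (\<Sum>b\<in>Basis. dir_deriv f b x *\<^sub>R b)"
      by (rule differentiable_from_dense_directions[OF lip dense]) (use elim in auto)
    then show ?case using gradient_eqI by metis
  qed
qed

lemma norm_GDERIV_le:
  fixes f :: "'a::euclidean_space \<Rightarrow> real"
  assumes lip: "L-lipschitz_on UNIV f" and G: "GDERIV f x :> G"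
  shows "norm G \<le> L"
proof -
  have "\<bar>(f (x + h *\<^sub>R G) - f x) / h\<bar> \<le> L * norm G" for h
    using lipschitz_step[OF lip, of x "h *\<^sub>R G"] lipschitz_on_nonneg[OF lip]
    by (cases "h = 0") (auto simp: abs_divide divide_le_eq mult_ac)
  then have "G \<bullet> G \<le> L * norm G"
    by (intro tendsto_upperbound[OF GDERIV_directional[OF G, of G]] always_eventually) (auto intro: abs_le_D1)
  then show ?thesis using lipschitz_on_nonneg[OF lip]
    by (cases "G = 0") (auto simp: dot_square_norm power2_eq_square)
qed

lemma gradient_bound:
  fixes f :: "'a::euclidean_space \<Rightarrow> real"
  assumes lip: "L-lipschitz_on UNIV f"
  shows "norm (gradient f x) \<le> L"
proof (cases "\<exists>D. GDERIV f x :> D")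
  case True
  then show ?thesis using norm_GDERIV_le[OF lip] gradient_eqI by metis
qed (use lipschitz_on_nonneg[OF lip] in \<open>auto simp: gradient_def\<close>)

lemma gradient_measurable:
  fixes f :: "'a::euclidean_space \<Rightarrow> real"
  assumes lip: "L-lipschitz_on UNIV f"
  shows "gradient f \<in> borel_measurable lebesgue"
proof -
  note [measurable] = lipschitz_borel_measurable[OF lip]
  have g: "(\<lambda>x. \<Sum>b\<in>Basis. dir_deriv f b x *\<^sub>R b) \<in> borel_measurable lborel"
    by measurable
  have "AE x in lborel. (\<Sum>b\<in>Basis. dir_deriv f b x *\<^sub>R b) = gradient f x"
    using rademacher[OF lip] by eventually_elim simp
  then show ?thesis using borel_measurable_AE[OF measurable_completion[OF g] AE_completion] by simp
qed

section \<open>Integration by parts and the perimeter of superlevel sets\<close>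

lemma C1_compact_supportD:
  fixes \<phi> :: "'a::euclidean_space \<Rightarrow> 'a"
  assumes "C1_compact_support \<Omega> \<phi>"
  obtains K where "compact K" "K \<subseteq> \<Omega>" "\<And>x. x \<notin> K \<Longrightarrow> \<phi> x = 0"
    "\<And>x v. x \<notin> K \<Longrightarrow> frechet_derivative \<phi> (at x) v = 0"
    "\<And>x. (\<phi> has_derivative frechet_derivative \<phi> (at x)) (at x)"
    "\<And>v. continuous_on UNIV (\<lambda>x. frechet_derivative \<phi> (at x) v)"
    "continuous_on UNIV \<phi>" 
proof -
  obtain K where K: "compact K" "K \<subseteq> \<Omega>" "\<And>x. x \<notin> K \<Longrightarrow> \<phi> x = 0"
    using assms by (auto simp: C1_compact_support_def)
  have d: "(\<phi> has_derivative frechet_derivative \<phi> (at x)) (at x)" for x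
    using assms by (simp add: C1_compact_support_def frechet_derivative_works[symmetric])
  have z: "frechet_derivative \<phi> (at x) v = 0" if "x \<notin> K" for x v
  proof -
    have "open (- K)" using K(1) compact_imp_closed by auto
    then have "(\<phi> has_derivative (\<lambda>_. 0)) (at x)"
      using that K(3) by (intro has_derivative_transform_within_open[OF has_derivative_const[of 0]]) auto
    then have "frechet_derivative \<phi> (at x) = (\<lambda>_. 0)"
      using d has_derivative_unique by blast
    then show ?thesis by simp
  qed
  have c: "continuous_on UNIV \<phi>"
    using d by (intro has_derivative_continuous_on) auto
  show thesis
    by (rule that[OF K z d _ c]) (use assms in \<open>auto simp: C1_compact_support_def\<close>)
qed

lemma compact_support_bounded:
  fixes g :: "'a::euclidean_space \<Rightarrow> 'b::real_normed_vector"
  assumes "continuous_on UNIV g" "compact K" "\<And>x. x \<notin> K \<Longrightarrow> g x = 0"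
  obtains B where "\<And>x. norm (g x) \<le> B" "0 \<le> B"
proof -
  have "bounded (g ` K)"
    using assms by (intro compact_imp_bounded compact_continuous_image) (auto intro: continuous_on_subset)
  then obtain B where B: "\<And>x. x \<in> K \<Longrightarrow> norm (g x) \<le> B" by (auto simp: bounded_iff)
  have "norm (g x) \<le> max B 0" for x using B[of x] assms(3)[of x] by (cases "x \<in> K") auto
  then show thesis by (rule that) simp
qed

lemma compact_support_integrable:
  fixes g :: "'a::euclidean_space \<Rightarrow> real"
  assumes "continuous_on UNIV g" "compact K" "\<And>x. x \<notin> K \<Longrightarrow> g x = 0"
  shows "integrable lborel g"
proof -
  obtain B where B: "\<And>x. norm (g x) \<le> B" using compact_support_bounded[OF assms] by metis
  have "integrable lborel (\<lambda>x. g x * indicator K x)"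
    by (rule bounded_indicator_integrable[where C = B])
       (use assms B in \<open>auto intro: borel_measurable_continuous_onI borel_compact compact_imp_bounded\<close>)
  also have "(\<lambda>x. g x * indicator K x) = g"
    using assms(3) by (auto simp: fun_eq_iff indicator_def)
  finally show ?thesis .
qed

text \<open>
  A difference quotient can be moved from \<open>g\<close> to \<open>f\<close> by translation invariance, with the step reversed.
  Both sides then converge by dominated convergence.
\<close>

lemma integration_by_parts_direction:
  fixes f g g' :: "'a::euclidean_space \<Rightarrow> real"
  assumes lip: "L-lipschitz_on UNIV f"
    and g: "continuous_on UNIV g" and g': "continuous_on UNIV g'"
    and K: "compact K" and g0: "\<And>x. x \<notin> K \<Longrightarrow> g x = 0" and g'0: "\<And>x. x \<notin> K \<Longrightarrow> g' x = 0"
    and d: "\<And>x s. ((\<lambda>s. g (x + s *\<^sub>R b)) has_real_derivative g' (x + s *\<^sub>R b)) (at s)"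
  shows "(\<integral>x. f x * g' x \<partial>lborel) = - (\<integral>x. (gradient f x \<bullet> b) * g x \<partial>lebesgue)"
proof -
  let ?h = "\<lambda>k. inverse (real (Suc k))"
  note [measurable] = lipschitz_borel_measurable[OF lip] borel_measurable_continuous_onI[OF g] borel_measurable_continuous_onI[OF g']
  have contf: "continuous_on UNIV f" using lip by (rule lipschitz_on_continuous_on)
  obtain M where M: "\<And>x. norm (g' x) \<le> M" "0 \<le> M" using compact_support_bounded[OF g' K g'0] by blast
  obtain B where B: "\<And>x. norm (g x) \<le> B" "0 \<le> B" using compact_support_bounded[OF g K g0] by blast
  have step: "\<bar>dquot g b k x\<bar> \<le> M" for k x
  proof -
    have "\<exists>z>0. z < ?h k \<and> g (x + ?h k *\<^sub>R b) - g (x + 0 *\<^sub>R b) = (?h k - 0) * g' (x + z *\<^sub>R b)"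
      by (rule MVT2) (use d in auto)
    then obtain z where "g (x + ?h k *\<^sub>R b) - g x = ?h k * g' (x + z *\<^sub>R b)" by auto
    then have "dquot g b k x = g' (x + z *\<^sub>R b)" by (simp add: dquot_def del: of_nat_Suc)
    then show ?thesis using M by simp
  qed
  have lim_g: "(\<lambda>k. dquot g b k x) \<longlonglongrightarrow> g' x" for x
    by (rule dquot_tendsto) (use d[of x 0] in \<open>simp add: DERIV_def\<close>)
  obtain R where R: "\<And>x. x \<in> K \<Longrightarrow> norm x \<le> R" using compact_imp_bounded[OF K] by (auto simp: bounded_iff)
  let ?R = "cball 0 (R + norm b) :: 'a set"
  have hb: "norm (?h k *\<^sub>R b) \<le> norm b" for k
    using mult_right_mono[of "?h k" 1 "norm b"] by (simp add: inverse_le_1_iff del: of_nat_Suc)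
  have sup: "x \<in> ?R" if "dquot g b k x \<noteq> 0" for x k
  proof -
    have "x \<in> K \<or> x + ?h k *\<^sub>R b \<in> K"
    proof (rule ccontr)
      assume "\<not> ?thesis"
      then have "g x = 0" "g (x + ?h k *\<^sub>R b) = 0" using g0 by blast+
      then show False using that by (simp add: dquot_def)
    qed
    moreover have "norm x \<le> norm (x + ?h k *\<^sub>R b) + norm (?h k *\<^sub>R b)"
      using norm_triangle_ineq4[of "x + ?h k *\<^sub>R b" "?h k *\<^sub>R b"] by simp
    ultimately show ?thesis using R[of x] R[of "x + ?h k *\<^sub>R b"] hb[of k] norm_ge_zero[of b]
      by (auto simp del: norm_scaleR norm_ge_zero)
  qed
  have "bounded (f ` ?R)"
    by (intro compact_imp_bounded compact_continuous_image) (auto intro: continuous_on_subset[OF contf])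
  then obtain A where "\<forall>y\<in>f ` ?R. norm y \<le> A" unfolding bounded_iff by blast
  then have A: "\<And>x. x \<in> ?R \<Longrightarrow> \<bar>f x\<bar> \<le> A" by simp
  have lim1: "(\<lambda>k. \<integral>x. f x * dquot g b k x \<partial>lborel) \<longlonglongrightarrow> (\<integral>x. f x * g' x \<partial>lborel)"
  proof (rule integral_dominated_convergence[where w = "\<lambda>x. (A * M) * indicator ?R x"])
    show "integrable lborel (\<lambda>x. A * M * indicator ?R x)"
      by (rule bounded_indicator_integrable[where C = "\<bar>A * M\<bar>"]) auto
    show "AE x in lborel. norm (f x * dquot g b k x) \<le> A * M * indicator ?R x" for k
    proof (rule AE_I2)
      fix x show "norm (f x * dquot g b k x) \<le> A * M * indicator ?R x"
      proof (cases "x \<in> ?R")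
        case True
        then show ?thesis using mult_mono[OF A[OF True] step[of k x]] M(2) A[OF True] by (auto simp: abs_mult)
      next
        case False
        then have "dquot g b k x = 0" using sup by blast
        then show ?thesis using False by simp
      qed
    qed
    show "AE x in lborel. (\<lambda>k. f x * dquot g b k x) \<longlonglongrightarrow> f x * g' x"
      by (intro AE_I2 tendsto_intros lim_g)
  qed measurable
  have AEf: "AE x in lborel. (\<lambda>k. dquot f (- b) k x) \<longlonglongrightarrow> - (gradient f x \<bullet> b)"
    using rademacher[OF lip]
  proof eventually_elim
    case (elim x)
    then have "GDERIV f x :> gradient f x" by blast
    from dquot_tendsto[OF GDERIV_directional[OF this]] have "(\<lambda>k. dquot f (- b) k x) \<longlonglongrightarrow> gradient f x \<bullet> (- b)" .
    then show ?case by simp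
  qed
  have AEd: "AE x in lborel. dir_deriv f (- b) x = - (gradient f x \<bullet> b)"
    using AEf by eventually_elim (rule dir_deriv_eqI)
  have lim2: "(\<lambda>k. \<integral>x. dquot f (- b) k x * g x \<partial>lborel) \<longlonglongrightarrow> (\<integral>x. dir_deriv f (- b) x * g x \<partial>lborel)"
  proof (rule integral_dominated_convergence[where w = "\<lambda>x. (L * norm b * B) * indicator K x"])
    show "integrable lborel (\<lambda>x. L * norm b * B * indicator K x)"
      by (rule bounded_indicator_integrable[where C = "\<bar>L * norm b * B\<bar>"]) (use K in \<open>auto simp: borel_compact compact_imp_bounded\<close>)
    show "AE x in lborel. norm (dquot f (- b) k x * g x) \<le> L * norm b * B * indicator K x" for k
    proof (rule AE_I2)
      fix x show "norm (dquot f (- b) k x * g x) \<le> L * norm b * B * indicator K x"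
      proof (cases "x \<in> K")
        case True
        have "\<bar>dquot f (- b) k x\<bar> * \<bar>g x\<bar> \<le> (L * norm b) * B"
          using dquot_bound[OF lip, of "- b" k x] B(1)[of x] lipschitz_on_nonneg[OF lip] by (intro mult_mono) auto
        then show ?thesis using True by (simp add: abs_mult)
      qed (use g0 in simp)
    qed
    show "AE x in lborel. (\<lambda>k. dquot f (- b) k x * g x) \<longlonglongrightarrow> dir_deriv f (- b) x * g x"
      using AEf AEd
    proof eventually_elim
      case (elim x)
      from tendsto_mult[OF elim(1) tendsto_const[of "g x"]] show ?case by (simp only: elim(2))
    qed
  qed measurable
  have swap: "(\<integral>x. f x * dquot g b k x \<partial>lborel) = (\<integral>x. dquot f (- b) k x * g x \<partial>lborel)" for k
  proof -
    have i1: "integrable lborel (\<lambda>x. f (x - c) * g x)" for c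
      by (rule compact_support_integrable[OF _ K])
         (use g0 in \<open>auto intro!: continuous_intros g continuous_on_compose2[OF contf]\<close>)
    have i2: "integrable lborel (\<lambda>x. f x * g (x + c))" for c
    proof (rule compact_support_integrable[where K = "(\<lambda>y. y - c) ` K"])
      show "compact ((\<lambda>y. y - c) ` K)" using K by (intro compact_continuous_image continuous_intros)
      show "f x * g (x + c) = 0" if "x \<notin> (\<lambda>y. y - c) ` K" for x
      proof -
        have "x + c \<notin> K"
        proof
          assume "x + c \<in> K"
          then have "(x + c) - c \<in> (\<lambda>y. y - c) ` K" by (rule imageI)
          then show False using \<open>x \<notin> (\<lambda>y. y - c) ` K\<close> by simp
        qed
        then show ?thesis using g0 by simp
      qed
    qed (auto intro!: continuous_intros contf continuous_on_compose2[OF g])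
    have tr: "(\<integral>x. f x * g (x + ?h k *\<^sub>R b) \<partial>lborel) = (\<integral>x. f (x - ?h k *\<^sub>R b) * g x \<partial>lborel)"
      using integral_lborel_translate[of "\<lambda>x. f (x - ?h k *\<^sub>R b) * g x" "?h k *\<^sub>R b"] by simp
    have "(\<integral>x. f x * dquot g b k x \<partial>lborel) = (\<integral>x. (f x * g (x + ?h k *\<^sub>R b) - f x * g x) / ?h k \<partial>lborel)"
      by (simp add: dquot_def right_diff_distrib del: of_nat_Suc)
    also have "\<dots> = ((\<integral>x. f x * g (x + ?h k *\<^sub>R b) \<partial>lborel) - (\<integral>x. f x * g x \<partial>lborel)) / ?h k"
      using i2[of "?h k *\<^sub>R b"] i2[of 0] by simp
    also have "\<dots> = ((\<integral>x. f (x - ?h k *\<^sub>R b) * g x \<partial>lborel) - (\<integral>x. f x * g x \<partial>lborel)) / ?h k"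
      by (simp only: tr)
    also have "\<dots> = (\<integral>x. (f (x - ?h k *\<^sub>R b) * g x - f x * g x) / ?h k \<partial>lborel)"
      using i1[of "?h k *\<^sub>R b"] i1[of 0] by simp
    also have "\<dots> = (\<integral>x. dquot f (- b) k x * g x \<partial>lborel)"
      by (simp add: dquot_def left_diff_distrib del: of_nat_Suc)
    finally show ?thesis .
  qed
  have "(\<integral>x. f x * g' x \<partial>lborel) = (\<integral>x. dir_deriv f (- b) x * g x \<partial>lborel)"
    using LIMSEQ_unique[OF lim1] lim2 unfolding swap by blast
  also have "\<dots> = (\<integral>x. dir_deriv f (- b) x * g x \<partial>lebesgue)"
    by (rule integral_completion[symmetric]) measurable
  also have "\<dots> = (\<integral>x. - ((gradient f x \<bullet> b) * g x) \<partial>lebesgue)"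
  proof (rule integral_cong_AE)
    show "(\<lambda>x. dir_deriv f (- b) x * g x) \<in> borel_measurable lebesgue"
      by (rule measurable_completion) measurable
    have "g \<in> borel_measurable lebesgue" by (rule measurable_completion) measurable
    then show "(\<lambda>x. - ((gradient f x \<bullet> b) * g x)) \<in> borel_measurable lebesgue"
      by (intro borel_measurable_uminus borel_measurable_times borel_measurable_inner gradient_measurable[OF lip]) auto
    show "AE x in lebesgue. dir_deriv f (- b) x * g x = - ((gradient f x \<bullet> b) * g x)"
      using AE_completion[OF AEd] by eventually_elim simp
  qed
  finally show ?thesis by simp
qed

lemma gradient_inner_integrable:
  fixes f g :: "'a::euclidean_space \<Rightarrow> real"
  assumes lip: "L-lipschitz_on UNIV f" and g: "continuous_on UNIV g" and K: "compact K" and g0: "\<And>x. x \<notin> K \<Longrightarrow> g x = 0"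
  shows "integrable lebesgue (\<lambda>x. (gradient f x \<bullet> b) * g x)"
proof (rule Bochner_Integration.integrable_bound)
  show "integrable lebesgue (\<lambda>x. (L * norm b) * g x)"
    using compact_support_integrable[OF g K g0] integrable_completion[of g lborel] borel_measurable_continuous_onI[OF g]
    by simp
  show "(\<lambda>x. (gradient f x \<bullet> b) * g x) \<in> borel_measurable lebesgue"
    by (intro borel_measurable_times borel_measurable_inner gradient_measurable[OF lip] measurable_completion)
       (auto intro: borel_measurable_continuous_onI g)
  have "\<bar>gradient f x \<bullet> b\<bar> \<le> L * norm b" for x
    using Cauchy_Schwarz_ineq2[of "gradient f x" b] mult_right_mono[OF gradient_bound[OF lip, of x], of "norm b"] by simp
  then show "AE x in lebesgue. norm ((gradient f x \<bullet> b) * g x) \<le> norm ((L * norm b) * g x)"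
    using lipschitz_on_nonneg[OF lip] by (auto simp: abs_mult intro!: mult_right_mono AE_I2)
qed

lemma divergence_continuous:
  assumes "C1_compact_support \<Omega> \<phi>"
  shows "continuous_on UNIV (divergence \<phi>)"
  using assms unfolding divergence_def[abs_def] C1_compact_support_def by (auto intro!: continuous_intros)

lemma lipschitz_integration_by_parts:
  fixes f :: "'a::euclidean_space \<Rightarrow> real"
  assumes lip: "L-lipschitz_on UNIV f" and \<phi>: "C1_compact_support \<Omega> \<phi>"
  shows "(\<integral>x. f x * divergence \<phi> x \<partial>lebesgue) = - (\<integral>x. gradient f x \<bullet> \<phi> x \<partial>lebesgue)"
proof -
  obtain K where K: "compact K" "K \<subseteq> \<Omega>" "\<And>x. x \<notin> K \<Longrightarrow> \<phi> x = 0"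
    "\<And>x v. x \<notin> K \<Longrightarrow> frechet_derivative \<phi> (at x) v = 0"
    "\<And>x. (\<phi> has_derivative frechet_derivative \<phi> (at x)) (at x)"
    "\<And>v. continuous_on UNIV (\<lambda>x. frechet_derivative \<phi> (at x) v)"
    "continuous_on UNIV \<phi>" by (rule C1_compact_supportD[OF \<phi>]) blast
  have contf: "continuous_on UNIV f" using lip by (rule lipschitz_on_continuous_on)
  let ?g' = "\<lambda>b x. frechet_derivative \<phi> (at x) b \<bullet> b"
  have cg': "continuous_on UNIV (?g' b)" for b by (intro continuous_intros K(6))
  have cg: "continuous_on UNIV (\<lambda>x. \<phi> x \<bullet> b)" for b by (intro continuous_intros K(7))
  have d: "((\<lambda>s. \<phi> (x + s *\<^sub>R b) \<bullet> b) has_real_derivative ?g' b (x + s *\<^sub>R b)) (at s)" for b x s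
  proof -
    have "((\<lambda>s. \<phi> (x + s *\<^sub>R b)) has_derivative (\<lambda>t. frechet_derivative \<phi> (at (x + s *\<^sub>R b)) (t *\<^sub>R b))) (at s)"
      by (rule has_derivative_compose[where f = "\<lambda>s. x + s *\<^sub>R b"]) (auto intro!: derivative_eq_intros K(5))
    then have "((\<lambda>s. \<phi> (x + s *\<^sub>R b) \<bullet> b) has_derivative (\<lambda>t. frechet_derivative \<phi> (at (x + s *\<^sub>R b)) (t *\<^sub>R b) \<bullet> b)) (at s)"
      by (rule has_derivative_inner_left)
    moreover have "frechet_derivative \<phi> (at (x + s *\<^sub>R b)) (t *\<^sub>R b) = t *\<^sub>R frechet_derivative \<phi> (at (x + s *\<^sub>R b)) b" for t
      using has_derivative_linear[OF K(5)] by (rule linear_cmul)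
    ultimately show ?thesis
      by (simp add: has_field_derivative_def mult_commute_abs)
  qed
  have parts: "(\<integral>x. f x * ?g' b x \<partial>lborel) = - (\<integral>x. (gradient f x \<bullet> b) * (\<phi> x \<bullet> b) \<partial>lebesgue)" for b
    by (rule integration_by_parts_direction[OF lip cg cg' K(1) _ _ d]) (use K in auto)
  have i: "integrable lborel (\<lambda>x. f x * ?g' b x)" for b
    by (rule compact_support_integrable[OF _ K(1)]) (use K(4) in \<open>auto intro!: continuous_intros contf cg'\<close>)
  have "(\<integral>x. f x * divergence \<phi> x \<partial>lebesgue) = (\<integral>x. f x * divergence \<phi> x \<partial>lborel)"
    by (rule integral_completion)
       (simp add: borel_measurable_continuous_onI continuous_on_mult contf divergence_continuous[OF \<phi>])
  also have "\<dots> = (\<integral>x. (\<Sum>b\<in>Basis. f x * ?g' b x) \<partial>lborel)"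
    by (simp add: divergence_def sum_distrib_left)
  also have "\<dots> = (\<Sum>b\<in>Basis. (\<integral>x. f x * ?g' b x \<partial>lborel))"
    by (rule Bochner_Integration.integral_sum) (rule i)
  also have "\<dots> = - (\<Sum>b\<in>Basis. (\<integral>x. (gradient f x \<bullet> b) * (\<phi> x \<bullet> b) \<partial>lebesgue))"
    by (simp add: parts sum_negf)
  also have "(\<Sum>b\<in>Basis. (\<integral>x. (gradient f x \<bullet> b) * (\<phi> x \<bullet> b) \<partial>lebesgue)) = (\<integral>x. (\<Sum>b\<in>Basis. (gradient f x \<bullet> b) * (\<phi> x \<bullet> b)) \<partial>lebesgue)"
    by (rule Bochner_Integration.integral_sum[symmetric], rule gradient_inner_integrable[OF lip cg K(1)]) (use K(3) in auto)
  also have "\<dots> = (\<integral>x. gradient f x \<bullet> \<phi> x \<partial>lebesgue)"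
    by (simp add: euclidean_inner[symmetric])
  finally show ?thesis .
qed

lemma divergence_integral_zero:
  fixes \<phi> :: "'a::euclidean_space \<Rightarrow> 'a"
  assumes \<phi>: "C1_compact_support \<Omega> \<phi>"
  shows "(\<integral>x. divergence \<phi> x \<partial>lebesgue) = 0"
proof -
  have "gradient (\<lambda>_. 1) x = 0" for x :: 'a
    by (rule gradient_eqI) (rule GDERIV_const)
  then show ?thesis
    using lipschitz_integration_by_parts[OF lipschitz_on_constant[of UNIV 1] \<phi>] by simp
qed

lemma divergence_integrable:
  fixes \<phi> :: "'a::euclidean_space \<Rightarrow> 'a"
  assumes \<phi>: "C1_compact_support \<Omega> \<phi>"
  shows "integrable lebesgue (divergence \<phi>)" "\<And>x. x \<notin> \<Omega> \<Longrightarrow> divergence \<phi> x = 0"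
proof -
  obtain K where K: "compact K" "K \<subseteq> \<Omega>" "\<And>x. x \<notin> K \<Longrightarrow> \<phi> x = 0"
    "\<And>x v. x \<notin> K \<Longrightarrow> frechet_derivative \<phi> (at x) v = 0" by (rule C1_compact_supportD[OF \<phi>]) blast
  have z: "divergence \<phi> x = 0" if "x \<notin> K" for x using K(4)[OF that] by (simp add: divergence_def)
  then show "\<And>x. x \<notin> \<Omega> \<Longrightarrow> divergence \<phi> x = 0" using K(2) by blast
  have "integrable lborel (divergence \<phi>)"
    by (rule compact_support_integrable[OF divergence_continuous[OF \<phi>] K(1) z])
  then show "integrable lebesgue (divergence \<phi>)"
    using integrable_completion[of "divergence \<phi>" lborel] borel_measurable_continuous_onI[OF divergence_continuous[OF \<phi>]] by simp
qed

lemma C1_compact_support_uminus: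
  assumes \<phi>: "C1_compact_support \<Omega> \<phi>"
  shows "C1_compact_support \<Omega> (\<lambda>x. - \<phi> x)" "divergence (\<lambda>x. - \<phi> x) x = - divergence \<phi> x"
proof -
  have d: "\<phi> differentiable (at x)" for x using \<phi> by (simp add: C1_compact_support_def)
  have f: "frechet_derivative (\<lambda>x. - \<phi> x) (at x) = (\<lambda>v. - frechet_derivative \<phi> (at x) v)" for x
    using has_derivative_minus[OF d[of x, unfolded frechet_derivative_works]] frechet_derivative_at by metis
  show "divergence (\<lambda>x. - \<phi> x) x = - divergence \<phi> x"
    by (simp add: divergence_def f sum_negf)
  show "C1_compact_support \<Omega> (\<lambda>x. - \<phi> x)"
    using \<phi> unfolding C1_compact_support_def f by (auto intro!: continuous_intros differentiable_minus)
qed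

text \<open>
  The divergence of a test field has integral zero, so passing to the complement amounts to reversing
  the field.
\<close>

lemma perimeter_complement_le:
  fixes E :: "'a::euclidean_space set"
  assumes E: "E \<in> sets lebesgue" "E \<subseteq> \<Omega>" and \<Omega>: "\<Omega> \<in> sets lebesgue"
  shows "perimeter \<Omega> (\<Omega> - E) \<le> perimeter \<Omega> E"
  unfolding perimeter_def
proof (rule SUP_least, clarify)
  fix \<phi> :: "'a \<Rightarrow> 'a" assume \<phi>: "C1_compact_support \<Omega> \<phi>" "\<forall>x. norm (\<phi> x) \<le> 1"
  note int = divergence_integrable(1)[OF \<phi>(1)]
  have "(LINT x:\<Omega> - E|lebesgue. divergence \<phi> x) = (LINT x|lebesgue. divergence \<phi> x - indicator E x *\<^sub>R divergence \<phi> x)"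
    unfolding set_lebesgue_integral_def
    using divergence_integrable(2)[OF \<phi>(1)] E(2) by (intro Bochner_Integration.integral_cong) (auto simp: indicator_def)
  also have "\<dots> = (LINT x|lebesgue. divergence \<phi> x) - (LINT x:E|lebesgue. divergence \<phi> x)"
    unfolding set_lebesgue_integral_def
    using int E by (intro Bochner_Integration.integral_diff integrable_mult_indicator) auto
  also have "\<dots> = (LINT x:E|lebesgue. divergence (\<lambda>x. - \<phi> x) x)"
    by (simp add: divergence_integral_zero[OF \<phi>(1)] C1_compact_support_uminus(2)[OF \<phi>(1)] set_lebesgue_integral_def)
  finally show "ennreal (LINT x:\<Omega> - E|lebesgue. divergence \<phi> x)
       \<le> (SUP \<phi>\<in>{\<phi>. C1_compact_support \<Omega> \<phi> \<and> (\<forall>x. norm (\<phi> x) \<le> 1)}. ennreal (LINT x:E|lebesgue. divergence \<phi> x))"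
    using C1_compact_support_uminus(1)[OF \<phi>(1)] \<phi>(2) by (intro SUP_upper2[of "\<lambda>x. - \<phi> x"]) auto
qed

lemma perimeter_complement:
  fixes E :: "'a::euclidean_space set"
  assumes E: "E \<in> sets lebesgue" "E \<subseteq> \<Omega>" and \<Omega>: "\<Omega> \<in> sets lebesgue"
  shows "perimeter \<Omega> (\<Omega> - E) = perimeter \<Omega> E"
proof (rule antisym)
  show "perimeter \<Omega> (\<Omega> - E) \<le> perimeter \<Omega> E" by (rule perimeter_complement_le[OF assms])
  have "perimeter \<Omega> (\<Omega> - (\<Omega> - E)) \<le> perimeter \<Omega> (\<Omega> - E)"
    using assms by (intro perimeter_complement_le) auto
  then show "perimeter \<Omega> E \<le> perimeter \<Omega> (\<Omega> - E)" using E(2) by (simp add: double_diff)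
qed

lemma gradient_cong_open:
  fixes f g :: "'a::euclidean_space \<Rightarrow> real"
  assumes "open S" "x \<in> S" "\<And>y. y \<in> S \<Longrightarrow> f y = g y"
  shows "gradient f x = gradient g x"
proof -
  have "GDERIV f x :> D \<longleftrightarrow> GDERIV g x :> D" for D
    unfolding gderiv_def
    using has_derivative_transform_within_open[of f _ x UNIV S g] has_derivative_transform_within_open[of g _ x UNIV S f] assms
    by auto
  then have "gderiv f x = gderiv g x" by (rule ext)
  then show ?thesis by (simp add: gradient_def)
qed

lemma gradient_zero_at_extremum:
  fixes f :: "'a::euclidean_space \<Rightarrow> real"
  assumes "(\<forall>y. f y \<le> f x) \<or> (\<forall>y. f x \<le> f y)"
  shows "gradient f x = 0"
proof (cases "\<exists>D. GDERIV f x :> D")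
  case True
  then obtain D where D: "GDERIV f x :> D" by blast
  then have "(\<lambda>h. h \<bullet> D) = (\<lambda>_. 0)"
    using differential_zero_maxmin[of x UNIV f "\<lambda>h. h \<bullet> D"] assms by (auto simp: gderiv_def)
  then have "D \<bullet> D = 0" by meson
  then show ?thesis using gradient_eqI[OF D] by simp
qed (simp add: gradient_def)

definition clamp_between :: "real \<Rightarrow> real \<Rightarrow> ('a \<Rightarrow> real) \<Rightarrow> 'a \<Rightarrow> real" where
  "clamp_between a b u x = min b (max a (u x))"

lemma clamp_between_lipschitz:
  assumes "L-lipschitz_on S u"
  shows "L-lipschitz_on S (clamp_between a b u)"
proof (rule lipschitz_onI)
  fix x y assume "x \<in> S" "y \<in> S"
  have "dist (clamp_between a b u x) (clamp_between a b u y) \<le> dist (u x) (u y)"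
    by (auto simp: clamp_between_def dist_real_def min_def max_def abs_if)
  also have "\<dots> \<le> L * dist x y" using lipschitz_onD[OF assms \<open>x \<in> S\<close> \<open>y \<in> S\<close>] .
  finally show "dist (clamp_between a b u x) (clamp_between a b u y) \<le> L * dist x y" .
qed (rule lipschitz_on_nonneg[OF assms])

text \<open>
  At the levels \<open>a\<close> and \<open>b\<close>, whose level sets need not be null, the clamped function attains its minimum
  or maximum, so its gradient vanishes there as well.
\<close>

lemma gradient_clamp_le:
  fixes u :: "'a::euclidean_space \<Rightarrow> real"
  assumes lip: "L-lipschitz_on UNIV u" and ab: "a < b"
  shows "norm (gradient (clamp_between a b u) x) \<le> indicator {x. a \<le> u x \<and> u x < b} x * norm (gradient u x)"
proof -
  have cont: "continuous_on UNIV u" using lip by (rule lipschitz_on_continuous_on)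
  consider "u x \<le> a" | "b \<le> u x" | "a < u x" "u x < b" by linarith
  then show ?thesis
  proof cases
    case 1
    then have "\<forall>y. clamp_between a b u x \<le> clamp_between a b u y" using ab by (auto simp: clamp_between_def)
    then show ?thesis using gradient_zero_at_extremum[of "clamp_between a b u" x] by simp
  next
    case 2
    then have "\<forall>y. clamp_between a b u y \<le> clamp_between a b u x" using ab by (auto simp: clamp_between_def)
    then show ?thesis using gradient_zero_at_extremum[of "clamp_between a b u" x] by simp
  next
    case 3
    have "open {x. a < u x \<and> u x < b}"
      unfolding Collect_conj_eq by (intro open_Int open_Collect_less cont continuous_intros)
    then have "gradient (clamp_between a b u) x = gradient u x"
      by (rule gradient_cong_open) (use 3 in \<open>auto simp: clamp_between_def\<close>)
    then show ?thesis using 3 by simp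
  qed
qed

text \<open>
  The functions \<open>(clamp_between (t - h) t u - (t - h)) / h\<close> tend to the indicator of the superlevel set as
  \<open>h \<rightarrow> 0\<close>, and the integrals of their gradients are the right-hand sides divided by \<open>h\<close>.  This is the
  half of the coarea formula that bounds the perimeter from above.
\<close>

lemma perimeter_superlevel_lower_bound:
  fixes u :: "'a::euclidean_space \<Rightarrow> real"
  assumes lip: "L-lipschitz_on UNIV u" and \<Omega>: "open \<Omega>" "bounded \<Omega>"
    and c: "ennreal c < perimeter \<Omega> {x\<in>\<Omega>. t \<le> u x}"
  shows "\<exists>d>0. \<forall>h. 0 < h \<and> h < d \<longrightarrow> c * h \<le> (LINT x:{x\<in>\<Omega>. t - h \<le> u x \<and> u x < t}|lebesgue. norm (gradient u x))"
proof (rule ccontr)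
  let ?E = "{x\<in>\<Omega>. t \<le> u x}"
  let ?I = "\<lambda>h. (LINT x:{x\<in>\<Omega>. t - h \<le> u x \<and> u x < t}|lebesgue. norm (gradient u x))"
  assume "\<not> ?thesis"
  then have neg: "\<forall>d>0. \<exists>h. 0 < h \<and> h < d \<and> ?I h < c * h" by (auto simp: not_le)
  have "\<forall>k. \<exists>h. 0 < h \<and> h < inverse (real (Suc k)) \<and> ?I h < c * h"
  proof
    fix k
    have "0 < inverse (real (Suc k))" by simp
    with neg show "\<exists>h. 0 < h \<and> h < inverse (real (Suc k)) \<and> ?I h < c * h" by blast
  qed
  from choice[OF this] obtain h where
    h': "\<forall>k. 0 < h k \<and> h k < inverse (real (Suc k)) \<and> ?I (h k) < c * h k" ..
  have h: "0 < h k" "h k < inverse (real (Suc k))" "?I (h k) < c * h k" for k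
    using h'[rule_format, of k] by auto
  have h0: "h \<longlonglongrightarrow> 0"
    by (rule tendsto_sandwich[OF _ _ tendsto_const LIMSEQ_inverse_real_of_nat])
       (use h in \<open>auto intro!: always_eventually less_imp_le\<close>)
  obtain \<phi> where \<phi>: "C1_compact_support \<Omega> \<phi>" "\<forall>x. norm (\<phi> x) \<le> 1"
    "ennreal c < ennreal (LINT x:?E|lebesgue. divergence \<phi> x)"
    using c unfolding perimeter_def less_SUP_iff by auto
  define J where "J = (LINT x:?E|lebesgue. divergence \<phi> x)"
  have cJ: "c < J" using \<phi>(3) unfolding J_def[symmetric] by (metis ennreal_leI not_le)
  note int = divergence_integrable(1)[OF \<phi>(1)] and out = divergence_integrable(2)[OF \<phi>(1)]
  note [measurable] = lipschitz_borel_measurable[OF lip]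
  let ?f = "\<lambda>k. clamp_between (t - h k) t u"
  have lipf: "L-lipschitz_on UNIV (?f k)" for k by (rule clamp_between_lipschitz[OF lip])
  have um: "u \<in> borel_measurable lebesgue" by (rule measurable_completion) measurable
  have fm: "?f k \<in> borel_measurable lebesgue" for k unfolding clamp_between_def by (intro borel_measurable_min borel_measurable_max um) auto
  have \<Omega>m: "\<Omega> \<in> sets lebesgue" using \<Omega>(1) by auto
  have setm: "{x\<in>\<Omega>. t - h k \<le> u x \<and> u x < t} \<in> sets lebesgue" for k
  proof -
    have "{x\<in>\<Omega>. t - h k \<le> u x \<and> u x < t} = \<Omega> \<inter> {x\<in>space lebesgue. t - h k \<le> u x} \<inter> {x\<in>space lebesgue. u x < t}" by auto
    also have "\<dots> \<in> sets lebesgue" using um \<Omega>m by (intro sets.Int borel_measurable_le borel_measurable_less) auto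
    finally show ?thesis .
  qed
  have fint: "integrable lebesgue (\<lambda>x. ?f k x * divergence \<phi> x)" for k
  proof (rule Bochner_Integration.integrable_bound)
    show "integrable lebesgue (\<lambda>x. (\<bar>t\<bar> + \<bar>t - h k\<bar>) * divergence \<phi> x)" using int by simp
    show "AE x in lebesgue. norm (?f k x * divergence \<phi> x) \<le> norm ((\<bar>t\<bar> + \<bar>t - h k\<bar>) * divergence \<phi> x)"
      by (rule AE_I2) (auto simp: abs_mult clamp_between_def min_def max_def intro!: mult_right_mono)
  qed (use fm int in \<open>auto intro!: borel_measurable_times\<close>)
  have lim: "(\<lambda>k. \<integral>x. ((?f k x - (t - h k)) / h k) * divergence \<phi> x \<partial>lebesgue) \<longlonglongrightarrow> (\<integral>x. indicator ?E x *\<^sub>R divergence \<phi> x \<partial>lebesgue)"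
  proof (rule integral_dominated_convergence[where w = "\<lambda>x. \<bar>divergence \<phi> x\<bar>"])
    have "?E = \<Omega> \<inter> {x\<in>space lebesgue. t \<le> u x}" by auto
    also have "\<dots> \<in> sets lebesgue" using um \<Omega>m by (intro sets.Int borel_measurable_le) auto
    finally have "?E \<in> sets lebesgue" .
    then show "(\<lambda>x. indicator ?E x *\<^sub>R divergence \<phi> x) \<in> borel_measurable lebesgue"
      using int by (intro borel_measurable_scaleR borel_measurable_indicator) auto
    show "(\<lambda>x. ((?f k x - (t - h k)) / h k) * divergence \<phi> x) \<in> borel_measurable lebesgue" for k
      using fm int by (intro borel_measurable_times borel_measurable_divide borel_measurable_diff) auto
    show "integrable lebesgue (\<lambda>x. \<bar>divergence \<phi> x\<bar>)" using int by simp
    show "AE x in lebesgue. norm (((?f k x - (t - h k)) / h k) * divergence \<phi> x) \<le> \<bar>divergence \<phi> x\<bar>" for k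
    proof (rule AE_I2)
      fix x
      have "\<bar>(?f k x - (t - h k)) / h k\<bar> \<le> 1"
        using h(1)[of k] by (auto simp: clamp_between_def min_def max_def abs_le_iff field_simps)
      from mult_right_mono[OF this, of "\<bar>divergence \<phi> x\<bar>"]
      show "norm (((?f k x - (t - h k)) / h k) * divergence \<phi> x) \<le> \<bar>divergence \<phi> x\<bar>" by (simp add: abs_mult)
    qed
    show "AE x in lebesgue. (\<lambda>k. ((?f k x - (t - h k)) / h k) * divergence \<phi> x) \<longlonglongrightarrow> indicator ?E x *\<^sub>R divergence \<phi> x"
    proof (rule AE_I2)
      fix x
      show "(\<lambda>k. ((?f k x - (t - h k)) / h k) * divergence \<phi> x) \<longlonglongrightarrow> indicator ?E x *\<^sub>R divergence \<phi> x"
      proof (cases "x \<in> \<Omega>")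
        case True
        have "\<forall>\<^sub>F k in sequentially. ((?f k x - (t - h k)) / h k) = indicator ?E x"
        proof (cases "t \<le> u x")
          case tu: True
          have "(?f k x - (t - h k)) / h k = 1" for k
            using tu h(1)[of k] by (simp add: clamp_between_def)
          then show ?thesis using tu True by simp
        next
          case False
          have "\<forall>\<^sub>F k in sequentially. h k < t - u x"
            using order_tendstoD(2)[OF h0, of "t - u x"] False by simp
          then show ?thesis
          proof eventually_elim
            case (elim k)
            then show ?case using False h(1)[of k] by (simp add: clamp_between_def)
          qed
        qed
        then have "(\<lambda>k. (?f k x - (t - h k)) / h k) \<longlonglongrightarrow> indicator ?E x" by (rule tendsto_eventually)
        then show ?thesis using tendsto_mult[OF _ tendsto_const[of "divergence \<phi> x"]] by (simp only: real_scaleR_def)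
      qed (use out in simp)
    qed
  qed
  have up: "(\<integral>x. ((?f k x - (t - h k)) / h k) * divergence \<phi> x \<partial>lebesgue) \<le> c" for k
  proof -
    have "(\<integral>x. ((?f k x - (t - h k)) / h k) * divergence \<phi> x \<partial>lebesgue) =
       (\<integral>x. (?f k x * divergence \<phi> x - (t - h k) * divergence \<phi> x) / h k \<partial>lebesgue)"
      by (simp add: left_diff_distrib)
    also have "\<dots> = ((\<integral>x. ?f k x * divergence \<phi> x \<partial>lebesgue) - (t - h k) * (\<integral>x. divergence \<phi> x \<partial>lebesgue)) / h k"
      using fint[of k] int by simp
    also have "\<dots> = (- (\<integral>x. gradient (?f k) x \<bullet> \<phi> x \<partial>lebesgue)) / h k"
      by (simp add: divergence_integral_zero[OF \<phi>(1)] lipschitz_integration_by_parts[OF lipf \<phi>(1)])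
    also have "\<dots> \<le> ?I (h k) / h k"
    proof (rule divide_right_mono)
      have "norm (\<integral>x. gradient (?f k) x \<bullet> \<phi> x \<partial>lebesgue) \<le> ?I (h k)"
        unfolding set_lebesgue_integral_def
      proof (rule Bochner_Integration.integral_norm_bound_integral)
        have gm: "(\<lambda>x. norm (gradient u x)) \<in> borel_measurable lebesgue"
          using gradient_measurable[OF lip] by measurable
        show i: "integrable lebesgue (\<lambda>x. indicator {x\<in>\<Omega>. t - h k \<le> u x \<and> u x < t} x *\<^sub>R norm (gradient u x))"
        proof (rule integrableI_bounded_set[of \<Omega> _ _ L])
          show "\<Omega> \<in> sets lebesgue" by (rule \<Omega>m)
          show "emeasure lebesgue \<Omega> < \<infinity>" using emeasure_bounded_finite[OF \<Omega>(2)] \<Omega>(1) by simp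
          show "(\<lambda>x. indicator {x\<in>\<Omega>. t - h k \<le> u x \<and> u x < t} x *\<^sub>R norm (gradient u x)) \<in> borel_measurable lebesgue"
            using setm gm by (intro borel_measurable_scaleR borel_measurable_indicator) auto
        qed (use gradient_bound[OF lip] lipschitz_on_nonneg[OF lip] in \<open>auto simp: indicator_def\<close>)
        have p: "norm (gradient (?f k) x \<bullet> \<phi> x) \<le> indicator {x\<in>\<Omega>. t - h k \<le> u x \<and> u x < t} x *\<^sub>R norm (gradient u x)" for x
        proof (cases "x \<in> \<Omega>")
          case True
          have "norm (gradient (?f k) x \<bullet> \<phi> x) \<le> norm (gradient (?f k) x) * norm (\<phi> x)"
            using Cauchy_Schwarz_ineq2 by simp
          also have "\<dots> \<le> norm (gradient (?f k) x) * 1" using \<phi>(2) by (intro mult_left_mono) auto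
          also have "\<dots> \<le> indicator {x. t - h k \<le> u x \<and> u x < t} x * norm (gradient u x)"
            using gradient_clamp_le[OF lip, of "t - h k" t x] h(1)[of k] by simp
          finally show ?thesis using True by (simp add: indicator_def)
        next
          case False
          have "\<phi> x = 0" using \<phi>(1) False unfolding C1_compact_support_def by blast
          then show ?thesis by simp
        qed
        show "integrable lebesgue (\<lambda>x. gradient (?f k) x \<bullet> \<phi> x)"
        proof (rule Bochner_Integration.integrable_bound[OF i])
          have "\<phi> \<in> borel_measurable lebesgue"
            using \<phi>(1) by (intro measurable_completion)
              (auto intro!: borel_measurable_continuous_onI differentiable_imp_continuous_on simp: C1_compact_support_def differentiable_on_def)
          then show "(\<lambda>x. gradient (?f k) x \<bullet> \<phi> x) \<in> borel_measurable lebesgue"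
            by (intro borel_measurable_inner gradient_measurable[OF lipf])
        qed (use p in \<open>auto intro!: AE_I2 order_trans[OF p]\<close>)
        show "\<And>x. x \<in> space lebesgue \<Longrightarrow> norm (gradient (?f k) x \<bullet> \<phi> x)
           \<le> indicator {x\<in>\<Omega>. t - h k \<le> u x \<and> u x < t} x *\<^sub>R norm (gradient u x)" by (rule p)
      qed
      then show "- (\<integral>x. gradient (?f k) x \<bullet> \<phi> x \<partial>lebesgue) \<le> ?I (h k)" by simp
    qed (use h(1)[of k] in simp)
    also have "\<dots> \<le> c" using h(1,3)[of k] by (simp add: divide_le_eq)
    finally show ?thesis .
  qed
  have "J \<le> c"
    unfolding J_def set_lebesgue_integral_def by (rule LIMSEQ_le_const2[OF lim]) (use up in auto)
  then show False using cJ by simp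
qed

section \<open>Boundary points of Lipschitz domains and Hausdorff measure\<close>

lemma upper_density_pos:
  fixes E :: "'a::euclidean_space set"
  assumes E: "E \<in> sets lebesgue" and c: "0 < c" and r0: "0 < r0"
    and balls: "\<And>r. 0 < r \<Longrightarrow> r < r0 \<Longrightarrow> \<exists>z. ball z (c * r) \<subseteq> E \<inter> ball x r"
  shows "0 < upper_density E x"
proof -
  let ?n = "DIM('a)"
  let ?q = "\<lambda>r. ereal (measure lebesgue (E \<inter> ball x r) / measure lebesgue (ball x r))"
  have "ereal (c ^ ?n) \<le> Liminf (at_right 0) ?q"
  proof (rule Liminf_bounded)
    show "\<forall>\<^sub>F r in at_right 0. ereal (c ^ ?n) \<le> ?q r"
      unfolding eventually_at_right_field
    proof (intro exI[of _ r0] conjI allI impI r0)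
      fix r :: real assume r: "0 < r" "r < r0"
      obtain z where z: "ball z (c * r) \<subseteq> E \<inter> ball x r" using balls[OF r] by blast
      have "measure lebesgue (ball z (c * r)) \<le> measure lebesgue (E \<inter> ball x r)"
        using z E by (intro measure_mono_fmeasurable) (auto intro!: fmeasurable_Int_fmeasurable[of "ball x r" lebesgue E, unfolded Int_commute[of "ball x r"]])
      then have "unit_ball_vol ?n * (c * r) ^ ?n \<le> measure lebesgue (E \<inter> ball x r)"
        using r c by (simp add: content_ball)
      then show "ereal (c ^ ?n) \<le> ?q r"
        using r by (simp add: content_ball pos_le_divide_eq power_mult_distrib mult_ac)
    qed
  qed
  also have "\<dots> \<le> upper_density E x"
    unfolding upper_density_def by (rule Liminf_le_Limsup) simp
  finally show ?thesis using c by (metis ereal_less(2) less_le_trans zero_less_power)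
qed

text \<open>
  Such a point lies on the graph, so the cone below it with the slope of the Lipschitz bound is inside
  the domain and the cone above it is outside.  Both cones contain a ball of size proportional to the
  distance from the vertex.
\<close>

lemma lipschitz_domain_interior_exterior_balls:
  fixes \<Omega> :: "'a::euclidean_space set"
  assumes \<Omega>: "bounded_lipschitz_domain \<Omega>" and x0: "x0 \<in> frontier \<Omega>"
  obtains c r0 where "0 < c" "0 < r0"
    "\<And>r. 0 < r \<Longrightarrow> r < r0 \<Longrightarrow> \<exists>z. ball z (c * r) \<subseteq> \<Omega> \<inter> ball x0 r"
    "\<And>r. 0 < r \<Longrightarrow> r < r0 \<Longrightarrow> \<exists>z. ball z (c * r) \<subseteq> - \<Omega> \<inter> ball x0 r"
proof -
  obtain r0 \<nu> L and g :: "'a \<Rightarrow> real" where r0: "0 < r0" and \<nu>: "norm \<nu> = 1"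
    and g: "L-lipschitz_on {y. y \<bullet> \<nu> = 0} g"
    and eq: "\<Omega> \<inter> ball x0 r0 = {x \<in> ball x0 r0. x \<bullet> \<nu> < g (x - (x \<bullet> \<nu>) *\<^sub>R \<nu>)}"
    using \<Omega> x0 unfolding bounded_lipschitz_domain_def by blast
  have op: "open \<Omega>" using \<Omega> by (simp add: bounded_lipschitz_domain_def)
  define H where "H x = x - (x \<bullet> \<nu>) *\<^sub>R \<nu>" for x
  have \<nu>\<nu>: "\<nu> \<bullet> \<nu> = 1" using \<nu> by (simp add: dot_square_norm)
  have H0: "H x \<in> {y. y \<bullet> \<nu> = 0}" for x by (simp add: H_def inner_diff_left \<nu>\<nu>)
  have Hd: "norm (H x - H y) \<le> norm (x - y)" for x y
  proof -
    define d where "d = x - y"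
    have "orthogonal (d - (d \<bullet> \<nu>) *\<^sub>R \<nu>) ((d \<bullet> \<nu>) *\<^sub>R \<nu>)"
      unfolding orthogonal_def inner_scaleR_right inner_diff_left inner_scaleR_left \<nu>\<nu> by (simp only: mult_1_right diff_self mult_zero_right)
    from norm_add_Pythagorean[OF this]
    have pyth: "(norm (d - (d \<bullet> \<nu>) *\<^sub>R \<nu>))\<^sup>2 \<le> (norm d)\<^sup>2"
      unfolding diff_add_cancel using zero_le_power2[of "norm ((d \<bullet> \<nu>) *\<^sub>R \<nu>)"] by linarith
    have "H x - H y = d - (d \<bullet> \<nu>) *\<^sub>R \<nu>" unfolding H_def d_def inner_diff_left scaleR_diff_left by simp
    then have "(norm (H x - H y))\<^sup>2 \<le> (norm (x - y))\<^sup>2" using pyth by (simp only: d_def)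
    then show ?thesis by (rule power2_le_imp_le) simp
  qed
  have L: "0 \<le> L" using g lipschitz_on_nonneg by blast
  have gH: "\<bar>g (H x) - g (H y)\<bar> \<le> L * norm (x - y)" for x y
  proof -
    have "\<bar>g (H x) - g (H y)\<bar> \<le> L * norm (H x - H y)"
      using lipschitz_onD[OF g H0 H0] by (simp add: dist_norm)
    also have "\<dots> \<le> L * norm (x - y)" using Hd L by (intro mult_left_mono)
    finally show ?thesis .
  qed
  have cont: "continuous_on UNIV (\<lambda>x. g (H x))"
    by (rule lipschitz_on_continuous_on[of L]) (use gH L in \<open>auto intro!: lipschitz_onI simp: dist_norm\<close>)
  have top: "x0 \<bullet> \<nu> = g (H x0)"
  proof (rule antisym)
    have "x0 \<notin> \<Omega>" using x0 op by (simp add: frontier_def interior_open)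
    then have "x0 \<notin> \<Omega> \<inter> ball x0 r0" by blast
    then show "g (H x0) \<le> x0 \<bullet> \<nu>" using r0 unfolding eq by (simp add: H_def)
    show "x0 \<bullet> \<nu> \<le> g (H x0)"
    proof (rule ccontr)
      assume "\<not> ?thesis"
      moreover have o: "open ({x. g (H x) < x \<bullet> \<nu>} \<inter> ball x0 r0)"
        by (intro open_Int open_Collect_less cont continuous_intros) auto
      moreover have "x0 \<in> closure \<Omega>" using x0 by (simp add: frontier_def)
      ultimately obtain x where "x \<in> \<Omega>" "g (H x) < x \<bullet> \<nu>" "x \<in> ball x0 r0"
      proof -
        have "x0 \<in> {x. g (H x) < x \<bullet> \<nu>} \<inter> ball x0 r0" using \<open>\<not> x0 \<bullet> \<nu> \<le> g (H x0)\<close> r0 by simp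
        then have "({x. g (H x) < x \<bullet> \<nu>} \<inter> ball x0 r0) \<inter> \<Omega> \<noteq> {}"
          using open_Int_closure_eq_empty[OF o, of \<Omega>] \<open>x0 \<in> closure \<Omega>\<close> by blast
        then show ?thesis using that by blast
      qed
      then have "x \<in> {x \<in> ball x0 r0. x \<bullet> \<nu> < g (x - (x \<bullet> \<nu>) *\<^sub>R \<nu>)}" using eq by blast
      then show False using \<open>g (H x) < x \<bullet> \<nu>\<close> by (simp add: H_def)
    qed
  qed
  define c where "c = 1 / (4 * (1 + L))"
  have c: "0 < c" "c \<le> 1/4" "c * (1 + L) = 1/4" using L by (auto simp: c_def field_simps)
  have key: "y \<in> ball x0 r0 \<and> y \<in> ball x0 r \<and> (s = 1 \<longrightarrow> g (H y) < y \<bullet> \<nu>) \<and> (s = - 1 \<longrightarrow> y \<bullet> \<nu> < g (H y))"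
    if r: "0 < r" "r < r0" and s: "s = 1 \<or> s = - 1" and y: "y \<in> ball (x0 + (s * r / 2) *\<^sub>R \<nu>) (c * r)" for r s y
  proof -
    let ?z = "x0 + (s * r / 2) *\<^sub>R \<nu>"
    have yz: "norm (y - ?z) < c * r" using y by (simp add: dist_norm norm_minus_commute)
    have cr: "c * r \<le> r / 4" using mult_right_mono[OF c(2), of r] r by simp
    have nz: "norm (?z - x0) = r / 2" using s r \<nu> by auto
    have "norm (y - x0) \<le> norm (y - ?z) + norm (?z - x0)" using norm_triangle_ineq[of "y - ?z" "?z - x0"] by simp
    then have d: "norm (y - x0) < r" using yz nz cr r by linarith
    have HZ: "H ?z = H x0" by (simp add: H_def inner_add_left \<nu>\<nu> scaleR_add_left)
    have "\<bar>g (H y) - g (H x0)\<bar> \<le> L * norm (y - ?z)" using gH[of y ?z] HZ by simp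
    also have "\<dots> \<le> L * (c * r)" using yz L by (intro mult_left_mono) auto
    finally have g1: "\<bar>g (H y) - g (H x0)\<bar> \<le> L * (c * r)" .
    have "\<bar>(y - ?z) \<bullet> \<nu>\<bar> \<le> c * r" using Cauchy_Schwarz_ineq2[of "y - ?z" \<nu>] \<nu> yz by simp
    then have g2: "\<bar>y \<bullet> \<nu> - (x0 \<bullet> \<nu> + s * r / 2)\<bar> \<le> c * r" by (simp add: inner_diff_left inner_add_left \<nu>\<nu>)
    have g3: "L * (c * r) + c * r = r / 4"
    proof -
      have "L * (c * r) + c * r = (c * (1 + L)) * r" by (simp add: algebra_simps)
      then show ?thesis using c(3) by simp
    qed
    show ?thesis
      using d r g1 g2 g3 top by (auto simp: dist_norm norm_minus_commute abs_le_iff)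
  qed
  show thesis
  proof (rule that[OF c(1) r0])
    fix r assume r: "0 < r" "r < r0"
    have "ball (x0 + (- 1 * r / 2) *\<^sub>R \<nu>) (c * r) \<subseteq> \<Omega> \<inter> ball x0 r"
    proof
      fix y assume "y \<in> ball (x0 + (- 1 * r / 2) *\<^sub>R \<nu>) (c * r)"
      from key[OF r _ this] have k: "y \<in> ball x0 r0" "y \<in> ball x0 r" "y \<bullet> \<nu> < g (H y)" by auto
      then have "y \<in> \<Omega> \<inter> ball x0 r0" unfolding eq H_def by simp
      then show "y \<in> \<Omega> \<inter> ball x0 r" using k by blast
    qed
    then show "\<exists>z. ball z (c * r) \<subseteq> \<Omega> \<inter> ball x0 r" by blast
    have "ball (x0 + (1 * r / 2) *\<^sub>R \<nu>) (c * r) \<subseteq> - \<Omega> \<inter> ball x0 r"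
    proof
      fix y assume "y \<in> ball (x0 + (1 * r / 2) *\<^sub>R \<nu>) (c * r)"
      from key[OF r _ this] have k: "y \<in> ball x0 r0" "y \<in> ball x0 r" "g (H y) < y \<bullet> \<nu>" by auto
      then have "y \<notin> \<Omega> \<inter> ball x0 r0" unfolding eq H_def by simp
      then show "y \<in> - \<Omega> \<inter> ball x0 r" using k by blast
    qed
    then show "\<exists>z. ball z (c * r) \<subseteq> - \<Omega> \<inter> ball x0 r" by blast
  qed
qed

lemma frontier_subset_essential_boundary:
  fixes \<Omega> :: "'a::euclidean_space set"
  assumes \<Omega>: "bounded_lipschitz_domain \<Omega>" and x0: "x0 \<in> frontier \<Omega>"
    and W: "W \<in> sets lebesgue" "W \<subseteq> \<Omega>" and s: "0 < s" "\<Omega> \<inter> ball x0 s \<subseteq> W"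
  shows "x0 \<in> essential_boundary W"
proof -
  obtain c r0 where c: "0 < c" "0 < r0"
    "\<And>r. 0 < r \<Longrightarrow> r < r0 \<Longrightarrow> \<exists>z. ball z (c * r) \<subseteq> \<Omega> \<inter> ball x0 r"
    "\<And>r. 0 < r \<Longrightarrow> r < r0 \<Longrightarrow> \<exists>z. ball z (c * r) \<subseteq> - \<Omega> \<inter> ball x0 r"
    using lipschitz_domain_interior_exterior_balls[OF \<Omega> x0] by blast
  have "0 < upper_density W x0"
  proof (rule upper_density_pos[OF W(1) c(1), of "min r0 s"])
    fix r assume r: "0 < r" "r < min r0 s"
    then obtain z where "ball z (c * r) \<subseteq> \<Omega> \<inter> ball x0 r" using c(3)[of r] by auto
    moreover have "\<Omega> \<inter> ball x0 r \<subseteq> W" using s(2) r by (auto simp: subset_iff)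
    ultimately show "\<exists>z. ball z (c * r) \<subseteq> W \<inter> ball x0 r" by blast
  qed (use c s in auto)
  moreover have "0 < upper_density (- W) x0"
  proof (rule upper_density_pos[OF _ c(1,2)])
    show "- W \<in> sets lebesgue" using W(1) by (simp add: Compl_in_sets_lebesgue)
    fix r assume r: "0 < r" "r < r0"
    then obtain z where "ball z (c * r) \<subseteq> - \<Omega> \<inter> ball x0 r" using c(4)[of r] by auto
    then show "\<exists>z. ball z (c * r) \<subseteq> - W \<inter> ball x0 r" using W(2) by blast
  qed
  ultimately show ?thesis by (simp add: essential_boundary_def)
qed

definition hausdorff_term :: "nat \<Rightarrow> 'a::euclidean_space set \<Rightarrow> ennreal" where
  "hausdorff_term k C = (if C = {} then 0 else ennreal (unit_ball_vol (real k) * (diameter C / 2) ^ k))"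

definition hausdorff_covers :: "real \<Rightarrow> 'a::euclidean_space set \<Rightarrow> (nat \<Rightarrow> 'a set) set" where
  "hausdorff_covers \<delta> E = {C. E \<subseteq> (\<Union>i. C i) \<and> (\<forall>i. bounded (C i) \<and> diameter (C i) \<le> \<delta>)}"

lemma hausdorff_measure_alt:
  "hausdorff_measure k E = (SUP \<delta>\<in>{0<..}. INF C\<in>hausdorff_covers \<delta> E. \<Sum>i. hausdorff_term k (C i))"
  by (simp add: hausdorff_measure_def hausdorff_term_def hausdorff_covers_def)

lemma hausdorff_measure_mono:
  assumes "A \<subseteq> B"
  shows "hausdorff_measure k A \<le> hausdorff_measure k B"
  unfolding hausdorff_measure_alt
  by (intro SUP_mono' INF_superset_mono) (use assms in \<open>auto simp: hausdorff_covers_def\<close>)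

lemma suminf_interleave_ennreal:
  fixes f g :: "nat \<Rightarrow> ennreal"
  shows "(\<Sum>i. if even i then f (i div 2) else g (i div 2)) \<le> (\<Sum>i. f i) + (\<Sum>i. g i)"
proof (rule suminf_le_const)
  fix n
  let ?h = "\<lambda>i. if even i then f (i div 2) else g (i div 2)"
  have "sum ?h {..<2 * m} = sum f {..<m} + sum g {..<m}" for m
    by (induction m) (auto simp: algebra_simps)
  moreover have "sum ?h {..<n} \<le> sum ?h {..<2 * n}" by (rule sum_mono2) auto
  moreover have "sum f {..<n} + sum g {..<n} \<le> (\<Sum>i. f i) + (\<Sum>i. g i)"
    by (intro add_mono sum_le_suminf) auto
  ultimately show "sum ?h {..<n} \<le> (\<Sum>i. f i) + (\<Sum>i. g i)" by simp
qed simp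

lemma hausdorff_measure_Un_le:
  fixes A B :: "'a::euclidean_space set"
  shows "hausdorff_measure k (A \<union> B) \<le> hausdorff_measure k A + hausdorff_measure k B"
proof -
  let ?S = "\<lambda>C. \<Sum>i. hausdorff_term k (C i :: 'a set)"
  have "(INF C\<in>hausdorff_covers \<delta> (A \<union> B). ?S C) \<le> hausdorff_measure k A + hausdorff_measure k B"
    if \<delta>: "0 < \<delta>" for \<delta>
  proof (rule ennreal_le_epsilon)
    fix e :: real assume fin: "hausdorff_measure k A + hausdorff_measure k B < top" and e: "0 < e"
    have cov: "\<exists>C\<in>hausdorff_covers \<delta> E. ?S C \<le> hausdorff_measure k E + ennreal (e / 2)"
      if "hausdorff_measure k E < top" for E :: "'a set"
    proof -
      have "(INF C\<in>hausdorff_covers \<delta> E. ?S C) \<le> hausdorff_measure k E"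
        unfolding hausdorff_measure_alt using \<delta> by (intro SUP_upper) auto
      also have "\<dots> < hausdorff_measure k E + ennreal (e / 2)"
        using that e by (cases "hausdorff_measure k E") (auto simp: ennreal_plus[symmetric] ennreal_less_iff simp del: ennreal_plus)
      finally show ?thesis unfolding INF_less_iff by (auto intro: less_imp_le)
    qed
    have fin': "hausdorff_measure k A < top" "hausdorff_measure k B < top" using fin by auto
    obtain C where C: "C \<in> hausdorff_covers \<delta> A" "?S C \<le> hausdorff_measure k A + ennreal (e / 2)"
      using cov[OF fin'(1)] by blast
    obtain D where D: "D \<in> hausdorff_covers \<delta> B" "?S D \<le> hausdorff_measure k B + ennreal (e / 2)"
      using cov[OF fin'(2)] by blast
    define F where "F i = (if even i then C (i div 2) else D (i div 2))" for i
    have F: "C i = F (2 * i)" "D i = F (Suc (2 * i))" for i by (simp_all add: F_def)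
    have FU: "F i \<subseteq> (\<Union>i. F i)" for i by (rule UN_upper) simp
    have "F \<in> hausdorff_covers \<delta> (A \<union> B)"
      unfolding hausdorff_covers_def
    proof (intro CollectI conjI allI)
      have "A \<subseteq> (\<Union>i. C i)" "B \<subseteq> (\<Union>i. D i)" using C(1) D(1) by (simp_all add: hausdorff_covers_def)
      moreover have "C i \<subseteq> (\<Union>i. F i)" "D i \<subseteq> (\<Union>i. F i)" for i
        unfolding F[of i] by (rule FU)+
      ultimately show "A \<union> B \<subseteq> (\<Union>i. F i)" by (meson UN_least Un_least order_trans)
      fix i
      have "F i = C (i div 2) \<or> F i = D (i div 2)" by (simp add: F_def)
      then show "bounded (F i)" "diameter (F i) \<le> \<delta>"
        using C(1) D(1) unfolding hausdorff_covers_def by (elim disjE; simp)+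
    qed
    then have "(INF C\<in>hausdorff_covers \<delta> (A \<union> B). ?S C) \<le> ?S F" by (rule INF_lower)
    also have "?S F = (\<Sum>i. if even i then hausdorff_term k (C (i div 2)) else hausdorff_term k (D (i div 2)))"
      by (intro suminf_cong) (simp add: F_def)
    also have "\<dots> \<le> ?S C + ?S D" by (rule suminf_interleave_ennreal)
    also have "\<dots> \<le> (hausdorff_measure k A + ennreal (e / 2)) + (hausdorff_measure k B + ennreal (e / 2))"
      by (intro add_mono C D)
    also have "\<dots> = hausdorff_measure k A + hausdorff_measure k B + (ennreal (e / 2) + ennreal (e / 2))"
      by (simp add: add_ac)
    also have "ennreal (e / 2) + ennreal (e / 2) = ennreal e" using e by (simp add: ennreal_plus[symmetric] del: ennreal_plus)
    finally show "(INF C\<in>hausdorff_covers \<delta> (A \<union> B). ?S C) \<le> hausdorff_measure k A + hausdorff_measure k B + ennreal e" .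
  qed
  then show ?thesis unfolding hausdorff_measure_alt[of k "A \<union> B"] by (intro SUP_least) auto
qed

lemma nonexpansive_image_diameter:
  fixes p :: "'a::euclidean_space \<Rightarrow> 'b::euclidean_space"
  assumes p: "\<And>x y. dist (p x) (p y) \<le> dist x y" and S: "bounded S"
  shows "bounded (p ` S)" "diameter (p ` S) \<le> diameter S"
proof -
  show b: "diameter (p ` S) \<le> diameter S"
  proof (rule diameter_le)
    show "p ` S \<noteq> {} \<or> 0 \<le> diameter S" using diameter_ge_0[OF S] by simp
    fix x y assume "x \<in> p ` S" "y \<in> p ` S"
    then obtain x' y' where xy: "x' \<in> S" "y' \<in> S" "x = p x'" "y = p y'" by blast
    then show "norm (x - y) \<le> diameter S"
      using p[of x' y'] diameter_bounded_bound[OF S xy(1,2)] by (simp add: dist_norm)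
  qed
  show "bounded (p ` S)"
  proof (cases "S = {}")
    case False
    then obtain x where x: "x \<in> S" by blast
    have "dist (p x) y \<le> diameter S" if "y \<in> p ` S" for y
    proof -
      obtain y' where y: "y' \<in> S" "y = p y'" using \<open>y \<in> p ` S\<close> by blast
      then show ?thesis using order_trans[OF p diameter_bounded_bound[OF S x y(1)]] by simp
    qed
    then show ?thesis unfolding bounded_def by blast
  qed simp
qed

text \<open>
  Images of the covering sets have no larger diameter.  The fixed scale \<open>\<delta>\<close> matters for the averaging
  argument below, which covers a translate of the set at one scale only.
\<close>

lemma hausdorff_premeasure_nonexpansive_image:
  fixes p :: "'a::euclidean_space \<Rightarrow> 'a"
  assumes p: "\<And>x y. dist (p x) (p y) \<le> dist x y"
  shows "(INF C\<in>hausdorff_covers \<delta> (p ` E). \<Sum>i. hausdorff_term k (C i)) \<le>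
    (INF C\<in>hausdorff_covers \<delta> E. \<Sum>i. hausdorff_term k (C i))"
proof (rule INF_greatest)
  fix C assume C: "C \<in> hausdorff_covers \<delta> E"
  have b: "bounded (C i)" "diameter (C i) \<le> \<delta>" for i using C by (auto simp: hausdorff_covers_def)
  have "(\<lambda>i. p ` C i) \<in> hausdorff_covers \<delta> (p ` E)"
    unfolding hausdorff_covers_def
  proof (intro CollectI conjI allI)
    have "E \<subseteq> (\<Union>i. C i)" using C by (simp add: hausdorff_covers_def)
    then show "p ` E \<subseteq> (\<Union>i. p ` C i)" by blast
    show "bounded (p ` C i)" "diameter (p ` C i) \<le> \<delta>" for i
      using nonexpansive_image_diameter[OF p b(1)[of i]] b(2)[of i] by auto
  qed
  then have "(INF C\<in>hausdorff_covers \<delta> (p ` E). \<Sum>i. hausdorff_term k (C i)) \<le> (\<Sum>i. hausdorff_term k (p ` C i))"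
    by (rule INF_lower)
  also have "\<dots> \<le> (\<Sum>i. hausdorff_term k (C i))"
  proof (rule suminf_le)
    fix i
    show "hausdorff_term k (p ` C i) \<le> hausdorff_term k (C i)"
    proof (cases "C i = {}")
      case False
      have "(diameter (p ` C i) / 2) ^ k \<le> (diameter (C i) / 2) ^ k"
        using nonexpansive_image_diameter[OF p b(1)[of i]] diameter_ge_0[of "p ` C i"] by (intro power_mono) auto
      then show ?thesis using False by (simp add: hausdorff_term_def ennreal_leI mult_left_mono)
    qed (simp add: hausdorff_term_def)
  qed auto
  finally show "(INF C\<in>hausdorff_covers \<delta> (p ` E). \<Sum>i. hausdorff_term k (C i)) \<le> (\<Sum>i. hausdorff_term k (C i))" .
qed

lemma hausdorff_measure_nonexpansive_image:
  fixes p :: "'a::euclidean_space \<Rightarrow> 'a"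
  assumes p: "\<And>x y. dist (p x) (p y) \<le> dist x y"
  shows "hausdorff_measure k (p ` E) \<le> hausdorff_measure k E"
  unfolding hausdorff_measure_alt
  by (intro SUP_mono' hausdorff_premeasure_nonexpansive_image p)

text \<open>
  Cubes with disjoint interiors allow the sum of the volumes to be compared with an open set, while the
  diameters remain controlled by the volumes.
\<close>

lemma small_cube_cover:
  fixes Z U :: "'a::euclidean_space set"
  assumes Z: "bounded Z" "Z \<subseteq> U" "open U" and \<delta>: "0 < \<delta>"
  obtains K :: "nat \<Rightarrow> 'a set" where
    "Z \<subseteq> (\<Union>i. K i)" "(\<Sum>i. emeasure lborel (K i)) \<le> emeasure lborel U"
    "\<And>i. bounded (K i)" "\<And>i. diameter (K i) \<le> \<delta>"
    "\<And>i. K i \<noteq> {} \<Longrightarrow> ennreal (diameter (K i) ^ DIM('a)) \<le> ennreal (real DIM('a) ^ DIM('a)) * emeasure lborel (K i)"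
proof -
  obtain R where R: "0 < R" "\<And>x. x \<in> Z \<Longrightarrow> norm x \<le> R"
    using Z(1) by (auto simp: bounded_pos)
  let ?a = "- R *\<^sub>R One :: 'a" and ?b = "R *\<^sub>R One :: 'a"
  have sub: "Z \<subseteq> cbox ?a ?b"
  proof
    fix x assume "x \<in> Z"
    then have "\<bar>x \<bullet> i\<bar> \<le> R" if "i \<in> Basis" for i using R(2) Basis_le_norm[OF that, of x] by fastforce
    then show "x \<in> cbox ?a ?b" by (auto simp: mem_box abs_le_iff minus_le_iff)
  qed
  have ne: "box ?a ?b \<noteq> {}" using R(1) by (simp add: box_ne_empty)
  define g where "g x = (if x \<in> U then U \<inter> ball x (\<delta> / 2) else ball x 1)" for x
  have gauge: "gauge g" using Z(3) \<delta> by (auto simp: g_def gauge_def)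
  obtain \<D> where D: "countable \<D>" "\<Union>\<D> \<subseteq> cbox ?a ?b"
    "\<And>K. K \<in> \<D> \<Longrightarrow> interior K \<noteq> {} \<and> (\<exists>c d. K = cbox c d)"
    "pairwise (\<lambda>A B. interior A \<inter> interior B = {}) \<D>"
    "\<And>K. K \<in> \<D> \<Longrightarrow> \<exists>x \<in> Z \<inter> K. K \<subseteq> g x"
    "\<And>u v. cbox u v \<in> \<D> \<Longrightarrow> \<exists>n. \<forall>i \<in> Basis. v \<bullet> i - u \<bullet> i = (?b \<bullet> i - ?a \<bullet> i) / 2^n"
    "Z \<subseteq> \<Union>\<D>"
    using covering_lemma[OF sub ne gauge] by metis
  define K where "K i = (if i \<in> to_nat_on \<D> ` \<D> then from_nat_into \<D> i else {})" for i
  have K1: "K i \<in> \<D>" if "K i \<noteq> {}" for i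
  proof -
    obtain A where "A \<in> \<D>" "i = to_nat_on \<D> A" using \<open>K i \<noteq> {}\<close> by (auto simp: K_def split: if_splits)
    then show ?thesis using D(1) by (simp add: K_def)
  qed
  have K2: "K (to_nat_on \<D> A) = A" if "A \<in> \<D>" for A
    using that D(1) by (simp add: K_def)
  have K3: "interior (K i) \<inter> interior (K j) = {}" if "i \<noteq> j" for i j
  proof (cases "K i = {} \<or> K j = {}")
    case False
    then obtain A B where AB: "A \<in> \<D>" "i = to_nat_on \<D> A" "B \<in> \<D>" "j = to_nat_on \<D> B"
      unfolding K_def by (auto split: if_splits)
    have "A \<noteq> B" using AB(2,4) \<open>i \<noteq> j\<close> by blast
    then have "interior A \<inter> interior B = {}" using pairwiseD[OF D(4) AB(1,3)] by blast
    then show ?thesis using AB K2 by simp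
  qed auto
  have KU: "K i \<subseteq> U" and Kd: "bounded (K i)" "diameter (K i) \<le> \<delta>" for i
  proof -
    consider "K i = {}" | x where "x \<in> Z" "K i \<subseteq> g x" using K1 D(5) by blast
    then have "K i \<subseteq> U \<and> bounded (K i) \<and> diameter (K i) \<le> \<delta>"
    proof cases
      case 1 then show ?thesis using \<delta> by simp
    next
      case 2
      then have s: "K i \<subseteq> U" "K i \<subseteq> ball x (\<delta> / 2)" using Z(2) by (auto simp: g_def split: if_splits)
      have "diameter (K i) \<le> diameter (ball x (\<delta> / 2))" using s(2) by (intro diameter_subset) auto
      also have "\<dots> \<le> \<delta>" using \<delta> by simp
      finally show ?thesis using s bounded_subset[OF bounded_ball s(2)] by blast
    qed
    then show "K i \<subseteq> U" "bounded (K i)" "diameter (K i) \<le> \<delta>" by auto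
  qed
  have em: "emeasure lborel (K i) = emeasure lborel (interior (K i))" for i
  proof (cases "K i = {}")
    case False
    then obtain c d where "K i = cbox c d" using K1 D(3) by blast
    then show ?thesis by (simp add: interior_cbox emeasure_lborel_cbox_eq emeasure_lborel_box_eq)
  qed simp
  show thesis
  proof (rule that)
    show "Z \<subseteq> (\<Union>i. K i)" using D(7) K2 by blast
    have "(\<Sum>i. emeasure lborel (K i)) = (\<Sum>i. emeasure lborel (interior (K i)))" by (simp add: em)
    also have "\<dots> = emeasure lborel (\<Union>i. interior (K i))"
      using K3 by (intro suminf_emeasure) (auto simp: disjoint_family_on_def)
    also have "\<dots> \<le> emeasure lborel U"
      using KU interior_subset Z(3) by (intro emeasure_mono) fastforce+
    finally show "(\<Sum>i. emeasure lborel (K i)) \<le> emeasure lborel U" .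
    fix i
    show "bounded (K i)" "diameter (K i) \<le> \<delta>" by (rule Kd)+
    assume ne: "K i \<noteq> {}"
    then obtain u v where uv: "K i = cbox u v" using K1 D(3) by blast
    then obtain m where m: "\<forall>j\<in>Basis. v \<bullet> j - u \<bullet> j = (?b \<bullet> j - ?a \<bullet> j) / 2 ^ m" using D(6) K1[OF ne] by metis
    define s where "s = 2 * R / 2 ^ m"
    have s: "0 < s" "\<And>j. j \<in> Basis \<Longrightarrow> v \<bullet> j - u \<bullet> j = s" using R(1) m by (auto simp: s_def)
    have "diameter (K i) \<le> real DIM('a) * s"
    proof (rule diameter_le)
      show "K i \<noteq> {} \<or> 0 \<le> real DIM('a) * s" using ne by simp
      fix x y assume xy: "x \<in> K i" "y \<in> K i"
      have "norm (x - y) \<le> (\<Sum>j\<in>Basis. \<bar>(x - y) \<bullet> j\<bar>)" by (rule norm_le_l1)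
      also have "\<dots> \<le> (\<Sum>j\<in>(Basis::'a set). s)"
      proof (rule sum_mono)
        fix j :: 'a assume "j \<in> Basis"
        then have "u \<bullet> j \<le> x \<bullet> j" "x \<bullet> j \<le> v \<bullet> j" "u \<bullet> j \<le> y \<bullet> j" "y \<bullet> j \<le> v \<bullet> j" "v \<bullet> j - u \<bullet> j = s"
          using xy s(2) by (auto simp: uv mem_box)
        then show "\<bar>(x - y) \<bullet> j\<bar> \<le> s" by (simp add: inner_diff_left)
      qed
      finally show "norm (x - y) \<le> real DIM('a) * s" by simp
    qed
    then have "diameter (K i) ^ DIM('a) \<le> (real DIM('a) * s) ^ DIM('a)"
      using Kd(1) by (intro power_mono diameter_ge_0)
    moreover have "emeasure lborel (K i) = ennreal (s ^ DIM('a))"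
    proof -
      have "u \<bullet> j \<le> v \<bullet> j" if "j \<in> Basis" for j using s that by (metis diff_ge_0_iff_ge less_imp_le)
      then have "emeasure lborel (K i) = ennreal (\<Prod>j\<in>Basis. (v - u) \<bullet> j)" by (simp add: uv emeasure_lborel_cbox_eq)
      also have "(\<Prod>j\<in>Basis. (v - u) \<bullet> j) = (\<Prod>j\<in>(Basis::'a set). s)" using s(2) by (intro prod.cong) (auto simp: inner_diff_left)
      finally show ?thesis by simp
    qed
    ultimately show "ennreal (diameter (K i) ^ DIM('a)) \<le> ennreal (real DIM('a) ^ DIM('a)) * emeasure lborel (K i)"
      using s(1) by (simp add: ennreal_mult'[symmetric] power_mult_distrib ennreal_leI)
  qed
qed

definition slab_const :: "nat \<Rightarrow> real" where
  "slab_const n = unit_ball_vol (real (n - 1)) * 2 * real n ^ n"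

lemma slab_const_pos: "0 < n \<Longrightarrow> 0 < slab_const n"
  by (simp add: slab_const_def)

text \<open>
  Cover the slab over \<open>S\<close> by small cubes of total volume little above that of \<open>T\<close>.  The cubes that meet
  one horizontal slice cover a translate of \<open>S\<close>, and averaging over the heights \<open>[0, 1]\<close> shows that the sum
  of the \<open>(n - 1)\<close>-st powers of their diameters is, for some slice, at most a constant times that volume.
\<close>

lemma hausdorff_measure_le_slab:
  fixes S T :: "'a::euclidean_space set"
  assumes e: "norm e = 1" and S: "bounded S" "\<And>y. y \<in> S \<Longrightarrow> y \<bullet> e = \<beta>" and T: "T \<in> sets borel"
    and ST: "\<And>y s. y \<in> S \<Longrightarrow> 0 \<le> s \<Longrightarrow> s \<le> 1 \<Longrightarrow> y + s *\<^sub>R e \<in> T" and n: "2 \<le> DIM('a)"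
  shows "hausdorff_measure (DIM('a) - 1) S \<le> ennreal (slab_const DIM('a)) * emeasure lborel T"
proof -
  let ?n = "DIM('a)"
  let ?k = "?n - 1"
  let ?\<kappa> = "slab_const ?n"
  have \<kappa>: "0 < ?\<kappa>" using n by (intro slab_const_pos) auto
  define Z where "Z = (\<lambda>(y, s). y + s *\<^sub>R e) ` (S \<times> {0..1})"
  have Zb: "bounded Z"
  proof -
    obtain R where R: "\<And>y. y \<in> S \<Longrightarrow> norm y \<le> R" using S(1) by (auto simp: bounded_iff)
    have "norm (y + s *\<^sub>R e) \<le> R + 1" if "y \<in> S" "0 \<le> s" "s \<le> 1" for y s
      using norm_triangle_ineq[of y "s *\<^sub>R e"] R[OF that(1)] that e by simp
    then show ?thesis unfolding bounded_iff Z_def by (intro exI[of _ "R + 1"]) auto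
  qed
  have ZT: "Z \<subseteq> T" using ST by (auto simp: Z_def)
  have "(INF C\<in>hausdorff_covers \<delta> S. \<Sum>i. hausdorff_term ?k (C i)) \<le> ennreal ?\<kappa> * emeasure lborel T"
    if \<delta>: "0 < \<delta>" for \<delta>
  proof (rule ennreal_le_epsilon)
    fix \<eta> :: real assume fin: "ennreal ?\<kappa> * emeasure lborel T < top" and \<eta>: "0 < \<eta>"
    define \<eta>' where "\<eta>' = \<eta> / (2 * ?\<kappa>)"
    have \<eta>': "0 < \<eta>'" using \<eta> \<kappa> by (simp add: \<eta>'_def)
    obtain U where U: "open U" "T \<subseteq> U" "emeasure lborel (U - T) < ennreal \<eta>'"
      using outer_regular_lborel[OF T \<eta>'] by blast
    have Um: "emeasure lborel U \<le> emeasure lborel T + ennreal \<eta>'"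
    proof -
      have "emeasure lborel U = emeasure lborel T + emeasure lborel (U - T)"
        using U T by (subst plus_emeasure) (auto simp: Un_absorb1)
      then show ?thesis using U(3) by (auto intro: add_left_mono)
    qed
    obtain K :: "nat \<Rightarrow> 'a set" where K: "Z \<subseteq> (\<Union>i. K i)" "(\<Sum>i. emeasure lborel (K i)) \<le> emeasure lborel U"
      "\<And>i. bounded (K i)" "\<And>i. diameter (K i) \<le> \<delta>"
      "\<And>i. K i \<noteq> {} \<Longrightarrow> ennreal (diameter (K i) ^ ?n) \<le> ennreal (real ?n ^ ?n) * emeasure lborel (K i)"
      using small_cube_cover[OF Zb order_trans[OF ZT U(2)] U(1) \<delta>] by metis
    \<comment> \<open>\<open>A i\<close> is an interval of heights that contains all those at which \<open>K i\<close> is met.\<close>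
    define z where "z i = (SOME x. x \<in> K i)" for i
    define A where "A i = {s. \<bar>\<beta> + s - z i \<bullet> e\<bar> \<le> diameter (K i)}" for i
    have A: "A i = {z i \<bullet> e - \<beta> - diameter (K i) .. z i \<bullet> e - \<beta> + diameter (K i)}" for i
      by (auto simp: A_def abs_le_iff)
    have Ab: "A i \<in> sets borel" for i unfolding A by simp
    have mem: "s \<in> A i" if "x \<in> K i" "x \<bullet> e = \<beta> + s" for x s i
    proof -
      have "z i \<in> K i" using that(1) unfolding z_def by (rule someI)
      then have "norm (x - z i) \<le> diameter (K i)" using diameter_bounded_bound[OF K(3) that(1)] by (simp add: dist_norm)
      moreover have "\<bar>(x - z i) \<bullet> e\<bar> \<le> norm (x - z i)" using Cauchy_Schwarz_ineq2[of "x - z i" e] e by simp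
      ultimately show ?thesis using that(2) by (simp add: A_def inner_diff_left)
    qed
    define \<Phi> where "\<Phi> s = (\<Sum>i. hausdorff_term ?k (K i) * indicator (A i) s)" for s
    have int: "(\<integral>\<^sup>+s. \<Phi> s \<partial>lborel) \<le> ennreal ?\<kappa> * emeasure lborel T + ennreal (\<eta> / 2)"
    proof -
      have "(\<integral>\<^sup>+s. \<Phi> s \<partial>lborel) = (\<Sum>i. \<integral>\<^sup>+s. hausdorff_term ?k (K i) * indicator (A i) s \<partial>lborel)"
        unfolding \<Phi>_def using Ab by (intro nn_integral_suminf) auto
      also have "\<dots> = (\<Sum>i. hausdorff_term ?k (K i) * emeasure lborel (A i))"
        using Ab by (simp add: nn_integral_cmult_indicator)
      also have "\<dots> \<le> (\<Sum>i. ennreal ?\<kappa> * emeasure lborel (K i))"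
      proof (rule suminf_le)
        fix i
        show "hausdorff_term ?k (K i) * emeasure lborel (A i) \<le> ennreal ?\<kappa> * emeasure lborel (K i)"
        proof (cases "K i = {}")
          case False
          let ?d = "diameter (K i)"
          have d: "0 \<le> ?d" using K(3) by (rule diameter_ge_0)
          have "hausdorff_term ?k (K i) * emeasure lborel (A i) = ennreal (unit_ball_vol (real ?k) * (?d / 2) ^ ?k * (2 * ?d))"
            using False d by (simp add: hausdorff_term_def A ennreal_mult'[symmetric])
          also have "\<dots> \<le> ennreal (unit_ball_vol (real ?k) * 2 * ?d ^ ?n)"
          proof (rule ennreal_leI)
            have "(?d / 2) ^ ?k \<le> ?d ^ ?k" using d by (intro power_mono) auto
            then have "unit_ball_vol (real ?k) * (?d / 2) ^ ?k * (2 * ?d) \<le> unit_ball_vol (real ?k) * ?d ^ ?k * (2 * ?d)"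
              using d by (intro mult_right_mono mult_left_mono) auto
            also have "\<dots> = unit_ball_vol (real ?k) * 2 * (?d * ?d ^ ?k)" by simp
            also have "?d * ?d ^ ?k = ?d ^ ?n" using n by (simp add: power_Suc[symmetric] del: power_Suc)
            finally show "unit_ball_vol (real ?k) * (?d / 2) ^ ?k * (2 * ?d) \<le> unit_ball_vol (real ?k) * 2 * ?d ^ ?n" .
          qed
          also have "\<dots> = ennreal (unit_ball_vol (real ?k) * 2) * ennreal (?d ^ ?n)"
            by (rule ennreal_mult) (use d in auto)
          also have "\<dots> \<le> ennreal (unit_ball_vol (real ?k) * 2) * (ennreal (real ?n ^ ?n) * emeasure lborel (K i))"
            by (intro mult_left_mono K(5) False) auto
          also have "\<dots> = ennreal ?\<kappa> * emeasure lborel (K i)"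
            by (simp add: slab_const_def ennreal_mult mult.assoc)
          finally show ?thesis .
        qed (simp add: hausdorff_term_def)
      qed auto
      also have "\<dots> = ennreal ?\<kappa> * (\<Sum>i. emeasure lborel (K i))" by simp
      also have "\<dots> \<le> ennreal ?\<kappa> * (emeasure lborel T + ennreal \<eta>')"
        using K(2) Um by (intro mult_left_mono) auto
      also have "\<dots> = ennreal ?\<kappa> * emeasure lborel T + ennreal (\<eta> / 2)"
        using \<kappa> \<eta> by (simp add: distrib_left ennreal_mult'[symmetric] \<eta>'_def)
      finally show ?thesis .
    qed
    obtain s where s: "0 \<le> s" "s \<le> 1" "\<Phi> s \<le> ennreal ?\<kappa> * emeasure lborel T + ennreal \<eta>"
    proof (rule ccontr)
      assume "\<not> thesis"
      then have big: "ennreal ?\<kappa> * emeasure lborel T + ennreal \<eta> \<le> \<Phi> s" if "0 \<le> s" "s \<le> 1" for s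
        using that \<open>\<And>s. 0 \<le> s \<Longrightarrow> s \<le> 1 \<Longrightarrow> \<Phi> s \<le> ennreal ?\<kappa> * emeasure lborel T + ennreal \<eta> \<Longrightarrow> thesis\<close> le_cases by metis
      have "ennreal ?\<kappa> * emeasure lborel T + ennreal \<eta> =
        (\<integral>\<^sup>+s. (ennreal ?\<kappa> * emeasure lborel T + ennreal \<eta>) * indicator {0..1::real} s \<partial>lborel)"
        by (simp add: nn_integral_cmult_indicator)
      also have "\<dots> \<le> (\<integral>\<^sup>+s. \<Phi> s \<partial>lborel)" by (intro nn_integral_mono) (use big in \<open>auto simp: indicator_def\<close>)
      also note int
      finally have "ennreal \<eta> \<le> ennreal (\<eta> / 2)"
        using fin by (metis ennreal_add_left_cancel_le top.not_eq_extremum infinity_ennreal_def)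
      then show False using \<eta> by (simp add: ennreal_le_iff)
    qed
    let ?C = "\<lambda>i. if s \<in> A i then K i else {}"
    have "?C \<in> hausdorff_covers \<delta> ((\<lambda>y. y + s *\<^sub>R e) ` S)"
    proof -
      have "y + s *\<^sub>R e \<in> (\<Union>i. ?C i)" if y: "y \<in> S" for y
      proof -
        have "y + s *\<^sub>R e \<in> Z" using y s by (force simp: Z_def)
        then obtain i where i: "y + s *\<^sub>R e \<in> K i" using K(1) by blast
        have "e \<bullet> e = 1" using e by (simp add: dot_square_norm)
        then have "s \<in> A i" using S(2)[OF y] by (intro mem[OF i]) (simp add: inner_add_left)
        then show ?thesis using i by auto
      qed
      then show ?thesis using K(3,4) \<delta> by (auto simp: hausdorff_covers_def)
    qed
    then have "(INF C\<in>hausdorff_covers \<delta> ((\<lambda>y. y + s *\<^sub>R e) ` S). \<Sum>i. hausdorff_term ?k (C i)) \<le> (\<Sum>i. hausdorff_term ?k (?C i))"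
      by (rule INF_lower)
    also have "\<dots> = \<Phi> s"
      unfolding \<Phi>_def by (intro suminf_cong) (auto simp: hausdorff_term_def)
    also note s(3)
    finally have 1: "(INF C\<in>hausdorff_covers \<delta> ((\<lambda>y. y + s *\<^sub>R e) ` S). \<Sum>i. hausdorff_term ?k (C i)) \<le> ennreal ?\<kappa> * emeasure lborel T + ennreal \<eta>" .
    have "S = (\<lambda>y. y - s *\<^sub>R e) ` ((\<lambda>y. y + s *\<^sub>R e) ` S)" by (simp add: image_image)
    then have "(INF C\<in>hausdorff_covers \<delta> S. \<Sum>i. hausdorff_term ?k (C i)) \<le>
       (INF C\<in>hausdorff_covers \<delta> ((\<lambda>y. y + s *\<^sub>R e) ` S). \<Sum>i. hausdorff_term ?k (C i))"
      using hausdorff_premeasure_nonexpansive_image[where p = "\<lambda>y. y - s *\<^sub>R e" and E = "(\<lambda>y. y + s *\<^sub>R e) ` S"] by (simp add: dist_norm)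
    also have "\<dots> \<le> ennreal ?\<kappa> * emeasure lborel T + ennreal \<eta>" by (rule 1)
    finally show "(INF C\<in>hausdorff_covers \<delta> S. \<Sum>i. hausdorff_term ?k (C i)) \<le> ennreal ?\<kappa> * emeasure lborel T + ennreal \<eta>" .
  qed
  then show ?thesis unfolding hausdorff_measure_alt by (intro SUP_least) auto
qed

section \<open>Zero sets with large projection\<close>

text \<open>
  The integral of a difference quotient telescopes into averages of \<open>g\<close> near the two ends.
\<close>

lemma lipschitz_fundamental_theorem_le:
  fixes g :: "real \<Rightarrow> real"
  assumes lip: "L-lipschitz_on UNIV g" and ab: "a \<le> b"
  shows "ennreal (g b - g a) \<le> (\<integral>\<^sup>+x. ennreal \<bar>dir_deriv g 1 x\<bar> * indicator {a..<b} x \<partial>lborel)"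
proof -
  let ?h = "\<lambda>k. inverse (real (Suc k))"
  note [measurable] = lipschitz_borel_measurable[OF lip]
  have L: "0 \<le> L" using lip lipschitz_on_nonneg by blast
  have cont: "continuous_on UNIV g" using lip by (rule lipschitz_on_continuous_on)
  have step: "\<bar>g x - g y\<bar> \<le> L * \<bar>x - y\<bar>" for x y
    using lipschitz_onD[OF lip, of x y] by (simp add: dist_real_def)
  let ?I = "\<lambda>c d. integral {c..d} g"
  have gi: "g integrable_on {c..d}" for c d
    by (rule integrable_continuous_real) (rule continuous_on_subset[OF cont subset_UNIV])
  have lim: "(\<lambda>k. \<integral>x. dquot g 1 k x * indicator {a..<b} x \<partial>lborel) \<longlonglongrightarrow>
      (\<integral>x. dir_deriv g 1 x * indicator {a..<b} x \<partial>lborel)"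
  proof (rule integral_dominated_convergence[where w = "\<lambda>x. L * indicator {a..<b} x"])
    show "integrable lborel (\<lambda>x. L * indicator {a..<b} x)"
      by (rule bounded_indicator_integrable[where C = "\<bar>L\<bar>"]) auto
    show "AE x in lborel. (\<lambda>k. dquot g 1 k x * indicator {a..<b} x) \<longlonglongrightarrow> dir_deriv g 1 x * indicator {a..<b} x"
      using AE_dir_deriv[OF lip, of 1] by eventually_elim (intro tendsto_intros dquot_tendsto)
    show "AE x in lborel. norm (dquot g 1 k x * indicator {a..<b} x) \<le> L * indicator {a..<b} x" for k
      using dquot_bound[OF lip, of 1 k] by (auto simp: indicator_def)
  qed measurable
  have val: "\<bar>(\<integral>x. dquot g 1 k x * indicator {a..<b} x \<partial>lborel) - (g b - g a)\<bar> \<le> 2 * L * ?h k" for k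
  proof -
    define h where "h = ?h k"
    have h: "0 < h" by (simp add: h_def)
    have cd: "continuous_on UNIV (dquot g 1 k)"
      unfolding dquot_def[abs_def] by (intro continuous_intros continuous_on_compose2[OF cont]) auto
    have "(\<integral>x. dquot g 1 k x * indicator {a..<b} x \<partial>lborel) = (\<integral>x. indicator {a..b} x *\<^sub>R dquot g 1 k x \<partial>lborel)"
    proof (rule integral_cong_AE)
      have "AE x in lborel. x \<noteq> b" by (rule AE_lborel_singleton)
      then show "AE x in lborel. dquot g 1 k x * indicator {a..<b} x = indicator {a..b} x *\<^sub>R dquot g 1 k x"
        by eventually_elim (auto simp: indicator_def)
    qed measurable
    also have "\<dots> = integral {a..b} (dquot g 1 k)"
      using set_borel_integral_eq_integral(2)[OF borel_integrable_atLeastAtMost', of a b "dquot g 1 k"] continuous_on_subset[OF cd subset_UNIV]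
      by (simp add: set_lebesgue_integral_def)
    also have "\<dots> = (integral {a..b} (\<lambda>x. g (x + h)) - ?I a b) / h"
    proof -
      have s: "(\<lambda>x. g (x + h)) integrable_on {a..b}"
        by (intro integrable_continuous_real continuous_on_compose2[OF cont] continuous_intros) auto
      have "integral {a..b} (dquot g 1 k) = integral {a..b} (\<lambda>x. (g (x + h) - g x) / h)"
        by (simp add: dquot_def[abs_def] h_def)
      also have "\<dots> = integral {a..b} (\<lambda>x. g (x + h) - g x) / h" by (rule integral_divide)
      finally show ?thesis using Henstock_Kurzweil_Integration.integral_diff[OF s gi] by simp
    qed
    also have "integral {a..b} (\<lambda>x. g (x + h)) = ?I (a + h) (b + h)"
    proof -
      have "((\<lambda>x. g (x + h)) has_integral ?I (a + h) (b + h)) {a..b}"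
        using integrable_integral[OF gi, of "a + h" "b + h"] unfolding has_integral_shift_Icc_real[symmetric] comp_def
        by (simp add: add.commute)
      then show ?thesis by (rule integral_unique)
    qed
    also have "?I (a + h) (b + h) - ?I a b = ?I b (b + h) - ?I a (a + h)"
    proof -
      have "?I a (a + h) + ?I (a + h) (b + h) = ?I a (b + h)"
        by (rule Henstock_Kurzweil_Integration.integral_combine) (use ab h gi in auto)
      moreover have "?I a b + ?I b (b + h) = ?I a (b + h)"
        by (rule Henstock_Kurzweil_Integration.integral_combine) (use ab h gi in auto)
      ultimately show ?thesis by linarith
    qed
    finally have e: "(\<integral>x. dquot g 1 k x * indicator {a..<b} x \<partial>lborel) = (?I b (b + h) - ?I a (a + h)) / h" .
    have app: "\<bar>?I c (c + h) - g c * h\<bar> \<le> (L * h) * h" for c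
    proof -
      have "?I c (c + h) - g c * h = integral {c..c + h} (\<lambda>x. g x - g c)"
        using Henstock_Kurzweil_Integration.integral_diff[OF gi integrable_const_ivl, of c "c + h" "g c"] h by simp
      also have "norm \<dots> \<le> (L * h) * (c + h - c)"
      proof (rule integral_bound)
        show "continuous_on {c..c + h} (\<lambda>x. g x - g c)" by (intro continuous_intros continuous_on_subset[OF cont]) auto
        show "norm (g x - g c) \<le> L * h" if "x \<in> {c..c + h}" for x
          using step[of x c] mult_left_mono[of "\<bar>x - c\<bar>" h L] that L by auto
      qed (use h in auto)
      finally show ?thesis by simp
    qed
    have "\<bar>(?I b (b + h) - ?I a (a + h)) - (g b - g a) * h\<bar> \<le> 2 * ((L * h) * h)"
      using app[of a] app[of b] by (simp add: left_diff_distrib)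
    then have "\<bar>((?I b (b + h) - ?I a (a + h)) - (g b - g a) * h) / h\<bar> \<le> 2 * (L * h)"
      using h by (simp add: abs_divide pos_divide_le_eq mult_ac)
    then show ?thesis unfolding e h_def[symmetric] using h by (simp add: diff_divide_distrib)
  qed
  have "(\<lambda>k. (\<integral>x. dquot g 1 k x * indicator {a..<b} x \<partial>lborel) - (g b - g a)) \<longlonglongrightarrow> 0"
  proof (rule Lim_null_comparison)
    show "\<forall>\<^sub>F k in sequentially. norm ((\<integral>x. dquot g 1 k x * indicator {a..<b} x \<partial>lborel) - (g b - g a)) \<le> 2 * L * ?h k"
      using val by (intro always_eventually) (simp del: of_nat_Suc)
    show "(\<lambda>k. 2 * L * ?h k) \<longlonglongrightarrow> 0"
      using tendsto_mult[OF tendsto_const LIMSEQ_inverse_real_of_nat, of "2 * L"] by simp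
  qed
  then have "(\<lambda>k. \<integral>x. dquot g 1 k x * indicator {a..<b} x \<partial>lborel) \<longlonglongrightarrow> g b - g a"
    by (simp only: LIM_zero_iff)
  from LIMSEQ_unique[OF this lim]
  have "ennreal (g b - g a) \<le> ennreal (\<integral>x. \<bar>dir_deriv g 1 x * indicator {a..<b} x\<bar> \<partial>lborel)"
    by (metis ennreal_leI integral_abs_bound order_trans abs_ge_self)
  also have "\<dots> = (\<integral>\<^sup>+x. ennreal \<bar>dir_deriv g 1 x * indicator {a..<b} x\<bar> \<partial>lborel)"
  proof (rule nn_integral_eq_integral[symmetric])
    have "\<bar>dir_deriv g 1 x\<bar> \<le> L" for x using dir_deriv_bound[OF lip, of 1 x] by simp
    then have "integrable lborel (\<lambda>x. dir_deriv g 1 x * indicator {a..<b} x)"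
      by (intro bounded_indicator_integrable[where C = L]) auto
    then show "integrable lborel (\<lambda>x. \<bar>dir_deriv g 1 x * indicator {a..<b} x\<bar>)" by (rule integrable_abs)
  qed simp
  also have "\<dots> = (\<integral>\<^sup>+x. ennreal \<bar>dir_deriv g 1 x\<bar> * indicator {a..<b} x \<partial>lborel)"
    by (intro nn_integral_cong) (auto simp: indicator_def)
  finally show ?thesis .
qed

lemma orthogonal_projection_hyperplane:
  fixes a :: "'a::euclidean_space"
  assumes p: "orthogonal_projection_onto {x. a \<bullet> x = b} p" and a: "a \<noteq> 0"
  shows "p x = x - ((a \<bullet> x - b) / (a \<bullet> a)) *\<^sub>R a"
proof -
  let ?q = "x - ((a \<bullet> x - b) / (a \<bullet> a)) *\<^sub>R a"
  have aa: "a \<bullet> a \<noteq> 0" using a by simp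
  have q: "a \<bullet> ?q = b" using aa by (simp add: inner_diff_right)
  have p1: "a \<bullet> p x = b" and p2: "(x - p x) \<bullet> (y - p x) = 0" if "a \<bullet> y = b" for y
    using p that by (auto simp: orthogonal_projection_onto_def orthogonal_def)
  have "(x - p x) \<bullet> (?q - p x) = 0" using p2[OF q] .
  moreover have "(x - ?q) \<bullet> (?q - p x) = 0"
  proof -
    have "a \<bullet> (?q - p x) = 0" using q p1[OF q] by (simp add: inner_diff_right)
    moreover have "x - ?q = ((a \<bullet> x - b) / (a \<bullet> a)) *\<^sub>R a" by simp
    ultimately show ?thesis by (simp only: inner_scaleR_left mult_zero_right)
  qed
  ultimately have "((x - p x) - (x - ?q)) \<bullet> (?q - p x) = 0" by (simp only: inner_diff_left)
  moreover have "(x - p x) - (x - ?q) = ?q - p x" by simp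
  ultimately have "(?q - p x) \<bullet> (?q - p x) = 0" by (simp only:)
  then show ?thesis by simp
qed

lemma orthogonal_projection_hyperplane_nonexpansive:
  fixes a :: "'a::euclidean_space"
  assumes p: "orthogonal_projection_onto {x. a \<bullet> x = b} p" and a: "a \<noteq> 0"
  shows "dist (p x) (p y) \<le> dist x y"
proof -
  define c where "c = (a \<bullet> (x - y)) / (a \<bullet> a)"
  have aa: "a \<bullet> a \<noteq> 0" using a by simp
  have e: "p x - p y = (x - y) - c *\<^sub>R a"
    unfolding orthogonal_projection_hyperplane[OF p a] c_def
    by (simp add: inner_diff_right diff_divide_distrib scaleR_diff_left)
  have "orthogonal ((x - y) - c *\<^sub>R a) (c *\<^sub>R a)"
  proof -
    have "c * (a \<bullet> a) = a \<bullet> (x - y)" using aa by (simp add: c_def)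
    then have "((x - y) - c *\<^sub>R a) \<bullet> a = 0" by (simp only: inner_diff_left[of "x - y"] inner_scaleR_left inner_commute[of "x - y" a] diff_self)
    then show ?thesis by (simp only: orthogonal_def inner_scaleR_right mult_zero_right)
  qed
  from norm_add_Pythagorean[OF this]
  have "(norm ((x - y) - c *\<^sub>R a))\<^sup>2 \<le> (norm (x - y))\<^sup>2"
    unfolding diff_add_cancel using zero_le_power2[of "norm (c *\<^sub>R a)"] by linarith
  then have "norm (p x - p y) \<le> norm (x - y)" unfolding e by (rule power2_le_imp_le) simp
  then show ?thesis by (simp add: dist_norm)
qed

lemma first_exit:
  fixes \<Omega> :: "'a::euclidean_space set"
  assumes \<Omega>: "open \<Omega>" "bounded \<Omega>" and e: "norm e = 1" and x: "x \<in> \<Omega>"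
  obtains s where "0 < s" "\<And>r. 0 \<le> r \<Longrightarrow> r < s \<Longrightarrow> x + r *\<^sub>R e \<in> \<Omega>" "x + s *\<^sub>R e \<in> frontier \<Omega>"
proof -
  define X where "X = {r. 0 \<le> r \<and> x + r *\<^sub>R e \<notin> \<Omega>}"
  have "closed X"
  proof -
    have "X = {0..} \<inter> (\<lambda>r. x + r *\<^sub>R e) -` (- \<Omega>)" by (auto simp: X_def)
    moreover have "closed ((\<lambda>r. x + r *\<^sub>R e) -` (- \<Omega>))"
      using \<Omega>(1) by (intro continuous_closed_vimage) (auto intro!: continuous_intros)
    ultimately show ?thesis by auto
  qed
  moreover have "X \<noteq> {}"
  proof -
    obtain R where R: "\<And>y. y \<in> \<Omega> \<Longrightarrow> norm y \<le> R" using \<Omega>(2) by (auto simp: bounded_iff)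
    have "0 \<le> R" using R[OF x] norm_ge_zero order_trans by blast
    have "norm ((R + norm x + 1) *\<^sub>R e) \<le> norm (x + (R + norm x + 1) *\<^sub>R e) + norm x"
      using norm_triangle_ineq4[of "x + (R + norm x + 1) *\<^sub>R e" x] by simp
    then have "R < norm (x + (R + norm x + 1) *\<^sub>R e)" using e \<open>0 \<le> R\<close> by simp
    then have "R + norm x + 1 \<in> X" using R[of "x + (R + norm x + 1) *\<^sub>R e"] \<open>0 \<le> R\<close> by (auto simp: X_def)
    then show ?thesis by blast
  qed
  moreover have bb: "bdd_below X" by (rule bdd_belowI[of _ 0]) (simp add: X_def)
  ultimately have s: "Inf X \<in> X" by (intro closed_contains_Inf)
  let ?s = "Inf X"
  have pos: "0 < ?s" using s x by (cases "?s = 0") (auto simp: X_def)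
  have inside: "x + r *\<^sub>R e \<in> \<Omega>" if r: "0 \<le> r" "r < ?s" for r
  proof (rule ccontr)
    assume "\<not> ?thesis"
    then have "r \<in> X" using r by (simp add: X_def)
    then show False using cInf_lower[OF _ bb] r by fastforce
  qed
  have out: "x + ?s *\<^sub>R e \<notin> \<Omega>" using s by (simp add: X_def)
  have "x + ?s *\<^sub>R e \<in> closure \<Omega>"
    unfolding closure_approachable
  proof (intro allI impI)
    fix d :: real assume d: "0 < d"
    let ?r = "max 0 (?s - d / 2)"
    have "x + ?r *\<^sub>R e \<in> \<Omega>" using inside pos d by auto
    moreover have "dist (x + ?r *\<^sub>R e) (x + ?s *\<^sub>R e) < d"
    proof -
      have "(x + ?r *\<^sub>R e) - (x + ?s *\<^sub>R e) = (?r - ?s) *\<^sub>R e" by (simp add: scaleR_diff_left)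
      then have "dist (x + ?r *\<^sub>R e) (x + ?s *\<^sub>R e) = \<bar>?r - ?s\<bar>" using e by (simp add: dist_norm)
      then show ?thesis using pos d by (auto simp: max_def)
    qed
    ultimately show "\<exists>y\<in>\<Omega>. dist y (x + ?s *\<^sub>R e) < d" by blast
  qed
  then have "x + ?s *\<^sub>R e \<in> frontier \<Omega>" using out \<Omega>(1) by (simp add: frontier_def interior_open)
  then show thesis using that pos inside by blast
qed

text \<open>
  If \<open>u z < t\<close>, then near the boundary point \<open>z\<close> the sublevel set coincides with the domain, and a
  Lipschitz domain has positive density at its boundary points, as has its complement.
\<close>

lemma frontier_value_ge:
  fixes \<Omega> :: "'a::euclidean_space set" and u :: "'a \<Rightarrow> real"
  assumes \<Omega>: "bounded_lipschitz_domain \<Omega>" and cont: "continuous_on UNIV u"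
    and z: "z \<in> frontier \<Omega>" "z \<notin> essential_boundary {x\<in>\<Omega>. u x < t}"
  shows "t \<le> u z"
proof (rule ccontr)
  assume "\<not> t \<le> u z"
  moreover have op: "open {x. u x < t}" by (intro open_Collect_less cont continuous_intros)
  ultimately obtain s where s: "0 < s" "ball z s \<subseteq> {x. u x < t}" using openE[OF op, of z] by auto
  have "open \<Omega>" using \<Omega> by (simp add: bounded_lipschitz_domain_def)
  then have "open (\<Omega> \<inter> {x. u x < t})" using op by auto
  moreover have "\<Omega> \<inter> {x. u x < t} = {x\<in>\<Omega>. u x < t}" by blast
  ultimately have "{x\<in>\<Omega>. u x < t} \<in> sets lebesgue" by auto
  then have "z \<in> essential_boundary {x\<in>\<Omega>. u x < t}"
    using s by (intro frontier_subset_essential_boundary[OF \<Omega> z(1)]) auto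
  then show False using z(2) by blast
qed

text \<open>
  Averaging the line integrals over a slab of height 1 recovers the space integral of \<open>w\<close>, because each
  point is met along its line for a parameter set of length at most 1.
\<close>

lemma tonelli_slab:
  fixes w :: "'a::euclidean_space \<Rightarrow> ennreal" and T :: "'a set"
  assumes [measurable]: "w \<in> borel_measurable borel" "T \<in> sets borel" and e: "norm e = 1"
    and T: "\<And>x. x \<in> T \<Longrightarrow> \<beta> \<le> x \<bullet> e \<and> x \<bullet> e \<le> \<beta> + 1 \<and> c \<le> (\<integral>\<^sup>+s. w (x + s *\<^sub>R e) \<partial>lborel)"
  shows "c * emeasure lborel T \<le> (\<integral>\<^sup>+x. w x \<partial>lborel)"
proof -
  have ee: "e \<bullet> e = 1" using e by (simp add: dot_square_norm)
  have "c * emeasure lborel T = (\<integral>\<^sup>+x. c * indicator T x \<partial>lborel)"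
    by (simp add: nn_integral_cmult_indicator)
  also have "\<dots> \<le> (\<integral>\<^sup>+x. (\<integral>\<^sup>+s. indicator T x * w (x + s *\<^sub>R e) \<partial>lborel) \<partial>lborel)"
  proof (rule nn_integral_mono)
    fix x
    show "c * indicator T x \<le> (\<integral>\<^sup>+s. indicator T x * w (x + s *\<^sub>R e) \<partial>lborel)"
      using T[of x] by (cases "x \<in> T") auto
  qed
  also have "\<dots> = (\<integral>\<^sup>+s. (\<integral>\<^sup>+x. indicator T x * w (x + s *\<^sub>R e) \<partial>lborel) \<partial>lborel)"
    by (rule lborel_pair.Fubini'[symmetric]) measurable
  also have "\<dots> = (\<integral>\<^sup>+s. (\<integral>\<^sup>+x. indicator T (x - s *\<^sub>R e) * w x \<partial>lborel) \<partial>lborel)"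
  proof (rule nn_integral_cong)
    fix s :: real
    show "(\<integral>\<^sup>+x. indicator T x * w (x + s *\<^sub>R e) \<partial>lborel) = (\<integral>\<^sup>+x. indicator T (x - s *\<^sub>R e) * w x \<partial>lborel)"
      using nn_integral_lborel_translate[of "\<lambda>x. indicator T (x - s *\<^sub>R e) * w x" "s *\<^sub>R e"] by simp
  qed
  also have "\<dots> = (\<integral>\<^sup>+x. (\<integral>\<^sup>+s. indicator T (x - s *\<^sub>R e) * w x \<partial>lborel) \<partial>lborel)"
    by (rule lborel_pair.Fubini') measurable
  also have "\<dots> \<le> (\<integral>\<^sup>+x. w x \<partial>lborel)"
  proof (rule nn_integral_mono)
    fix x
    have "(\<integral>\<^sup>+s. indicator T (x - s *\<^sub>R e) * w x \<partial>lborel) \<le> (\<integral>\<^sup>+s. w x * indicator {x \<bullet> e - \<beta> - 1..x \<bullet> e - \<beta>} s \<partial>lborel)"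
    proof (rule nn_integral_mono)
      fix s
      show "indicator T (x - s *\<^sub>R e) * w x \<le> w x * indicator {x \<bullet> e - \<beta> - 1..x \<bullet> e - \<beta>} s"
        using T[of "x - s *\<^sub>R e"] by (cases "x - s *\<^sub>R e \<in> T") (auto simp: inner_diff_left ee)
    qed
    also have "\<dots> = w x" by (simp add: nn_integral_cmult_indicator)
    finally show "(\<integral>\<^sup>+s. indicator T (x - s *\<^sub>R e) * w x \<partial>lborel) \<le> w x" .
  qed
  finally show ?thesis .
qed

lemma level_band_measurable:
  fixes u :: "'a::euclidean_space \<Rightarrow> real"
  assumes "continuous_on UNIV u" "open \<Omega>"
  shows "{x\<in>\<Omega>. a \<le> u x \<and> u x < b} \<in> sets borel"
proof -
  note [measurable] = borel_measurable_continuous_onI[OF assms(1)]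
  have "\<Omega> \<in> sets borel" using assms(2) by simp
  moreover have "{x\<in>space borel. a \<le> u x \<and> u x < b} \<in> sets borel" by measurable
  ultimately have "\<Omega> \<inter> {x\<in>space borel. a \<le> u x \<and> u x < b} \<in> sets borel" by (rule sets.Int)
  moreover have "\<Omega> \<inter> {x\<in>space borel. a \<le> u x \<and> u x < b} = {x\<in>\<Omega>. a \<le> u x \<and> u x < b}" by auto
  ultimately show ?thesis by simp
qed

lemma gradient_norm_set_integrable:
  fixes u :: "'a::euclidean_space \<Rightarrow> real"
  assumes lip: "L-lipschitz_on UNIV u" and A: "A \<in> sets lebesgue" "bounded A"
  shows "set_integrable lebesgue A (\<lambda>x. norm (gradient u x))"
  unfolding set_integrable_def
proof (rule integrableI_bounded_set[of A _ _ L])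
  obtain R where "A \<subseteq> cball 0 R" using A(2) by (auto simp: bounded_iff subset_iff)
  then have "emeasure lebesgue A \<le> emeasure lebesgue (cball 0 R :: 'a set)" by (rule emeasure_mono) simp
  also have "\<dots> < \<infinity>" using emeasure_bounded_finite[of "cball 0 R :: 'a set"] by simp
  finally show "emeasure lebesgue A < \<infinity>" .
  have "(\<lambda>x. norm (gradient u x)) \<in> borel_measurable lebesgue"
    using gradient_measurable[OF lip] by measurable
  then show "(\<lambda>x. indicator A x *\<^sub>R norm (gradient u x)) \<in> borel_measurable lebesgue"
    using A(1) by (intro borel_measurable_scaleR borel_measurable_indicator)
qed (use A gradient_bound[OF lip] lipschitz_on_nonneg[OF lip] in \<open>auto simp: indicator_def\<close>)

text \<open>
  Let \<open>y\<close> be in the projection of \<open>G\<close> but not in that of the boundary part of the essential boundary.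
  Follow the line over \<open>y\<close> from a point of \<open>G\<close> to its first exit from \<open>\<Omega>\<close>.  The exit point is outside the
  essential boundary, so \<open>u \<ge> t\<close> there, and the clamped function rises by \<open>h\<close> along the line.  The set of
  such \<open>y\<close> is therefore controlled by the integral of the gradient, divided by \<open>h\<close>.
\<close>

lemma projection_of_zero_set_bound:
  fixes \<Omega> :: "'a::euclidean_space set" and u :: "'a \<Rightarrow> real"
  assumes \<Omega>: "bounded_lipschitz_domain \<Omega>" and lip: "L-lipschitz_on UNIV u"
    and G: "G \<subseteq> \<Omega>" "\<And>x. x \<in> G \<Longrightarrow> u x = 0" and h: "0 < h" "h \<le> t"
    and a: "a \<noteq> 0" and p: "orthogonal_projection_onto {x. a \<bullet> x = b} p" and n: "2 \<le> DIM('a)"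
  shows "hausdorff_measure (DIM('a) - 1) (p ` G) \<le>
     hausdorff_measure (DIM('a) - 1) (essential_boundary {x\<in>\<Omega>. u x < t} \<inter> frontier \<Omega>) +
     ennreal (slab_const DIM('a) * ((LINT x:{x\<in>\<Omega>. t - h \<le> u x \<and> u x < t}|lebesgue. norm (gradient u x)) / h))"
proof -
  let ?B = "essential_boundary {x\<in>\<Omega>. u x < t} \<inter> frontier \<Omega>"
  let ?I = "(LINT x:{x\<in>\<Omega>. t - h \<le> u x \<and> u x < t}|lebesgue. norm (gradient u x))"
  let ?k = "DIM('a) - 1"
  have op: "open \<Omega>" and bd: "bounded \<Omega>" using \<Omega> by (auto simp: bounded_lipschitz_domain_def)
  have cont: "continuous_on UNIV u" using lip by (rule lipschitz_on_continuous_on)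
  define e where "e = inverse (norm a) *\<^sub>R a"
  have e: "norm e = 1" using a by (simp add: e_def)
  have ee: "e \<bullet> e = 1" using e by (simp add: dot_square_norm)
  have ae: "a = norm a *\<^sub>R e" using a by (simp add: e_def)
  define \<beta> where "\<beta> = b / norm a"
  have pe: "p x = x - (x \<bullet> e - \<beta>) *\<^sub>R e" for x
  proof -
    have aa: "a \<bullet> a = norm a * norm a" by (simp add: dot_square_norm power2_eq_square)
    have ax: "a \<bullet> x = norm a * (x \<bullet> e)" by (subst ae) (simp add: inner_commute)
    have "((a \<bullet> x - b) / (a \<bullet> a)) *\<^sub>R a = ((norm a * (x \<bullet> e) - b) / (norm a * norm a) * norm a) *\<^sub>R e"
      unfolding ax aa using ae by (metis scaleR_scaleR)
    also have "(norm a * (x \<bullet> e) - b) / (norm a * norm a) * norm a = x \<bullet> e - \<beta>"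
      using a by (simp add: \<beta>_def field_simps)
    finally show ?thesis using orthogonal_projection_hyperplane[OF p a] by simp
  qed
  have pb: "p x \<bullet> e = \<beta>" for x by (simp add: pe inner_diff_left ee)
  have pline: "p (x + s *\<^sub>R e) = p x" for x s by (simp add: pe inner_add_left ee algebra_simps)
  have nonexp: "dist (p x) (p y) \<le> dist x y" for x y
    by (rule orthogonal_projection_hyperplane_nonexpansive[OF p a])
  define S where "S = p ` G - p ` ?B"
  define f where "f = clamp_between (t - h) t u"
  have lipf: "L-lipschitz_on UNIV f" unfolding f_def by (rule clamp_between_lipschitz[OF lip])
  note [measurable] = lipschitz_borel_measurable[OF lipf]
  have [measurable]: "\<Omega> \<in> sets borel" using op by simp
  define w where "w x = ennreal \<bar>dir_deriv f e x\<bar> * indicator \<Omega> x" for x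
  have wm [measurable]: "w \<in> borel_measurable borel" unfolding w_def[abs_def] by measurable
  define m where "m x = (\<integral>\<^sup>+s. w (x + s *\<^sub>R e) \<partial>lborel)" for x
  have mm [measurable]: "m \<in> borel_measurable borel"
    unfolding m_def[abs_def] by measurable
  define T where "T = {x\<in>space borel. \<beta> \<le> x \<bullet> e \<and> x \<bullet> e \<le> \<beta> + 1 \<and> ennreal h \<le> m x}"
  have T [measurable]: "T \<in> sets borel" unfolding T_def by measurable
  have m_line: "m (x + r *\<^sub>R e) = m x" for x r
  proof -
    have "(\<integral>\<^sup>+s. w (x + s *\<^sub>R e) \<partial>lborel) = (\<integral>\<^sup>+s. w (x + (s + r) *\<^sub>R e) \<partial>lborel)"
      using nn_integral_lborel_translate[of "\<lambda>s. w (x + s *\<^sub>R e)" r] by simp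
    then show ?thesis by (simp add: m_def scaleR_add_left add_ac)
  qed
  have m_big: "ennreal h \<le> m y" if y: "y \<in> S" for y
  proof -
    obtain x where x: "x \<in> G" "y = p x" using y by (auto simp: S_def)
    have xO: "x \<in> \<Omega>" using x G(1) by blast
    obtain s where s: "0 < s" "\<And>r. 0 \<le> r \<Longrightarrow> r < s \<Longrightarrow> x + r *\<^sub>R e \<in> \<Omega>" "x + s *\<^sub>R e \<in> frontier \<Omega>"
      using first_exit[OF op bd e xO] by blast
    have "x + s *\<^sub>R e \<notin> ?B"
    proof
      assume "x + s *\<^sub>R e \<in> ?B"
      then have "p (x + s *\<^sub>R e) \<in> p ` ?B" by (rule imageI)
      then show False using y x(2) pline by (simp add: S_def)
    qed
    then have ut: "t \<le> u (x + s *\<^sub>R e)"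
      using s(3) by (intro frontier_value_ge[OF \<Omega> cont]) auto
    define g where "g r = f (x + r *\<^sub>R e)" for r
    have lipg: "L-lipschitz_on UNIV g"
    proof (rule lipschitz_onI)
      show "dist (g r) (g r') \<le> L * dist r r'" for r r'
      proof -
        have "(x + r *\<^sub>R e) - (x + r' *\<^sub>R e) = (r - r') *\<^sub>R e" by (simp add: scaleR_diff_left)
        then have "dist (x + r *\<^sub>R e) (x + r' *\<^sub>R e) = dist r r'" using e by (simp add: dist_norm)
        then show ?thesis using lipschitz_onD[OF lipf, of "x + r *\<^sub>R e" "x + r' *\<^sub>R e"] by (simp add: g_def)
      qed
    qed (rule lipschitz_on_nonneg[OF lip])
    have dg: "dir_deriv g 1 r = dir_deriv f e (x + r *\<^sub>R e)" for r
      by (simp add: dir_deriv_def dquot_def g_def scaleR_add_left add_ac)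
    have "g s - g 0 = h"
      using ut G(2)[OF x(1)] h by (simp add: g_def f_def clamp_between_def)
    then have "ennreal h \<le> (\<integral>\<^sup>+r. ennreal \<bar>dir_deriv g 1 r\<bar> * indicator {0..<s} r \<partial>lborel)"
      using lipschitz_fundamental_theorem_le[OF lipg, of 0 s] s(1) by simp
    also have "\<dots> \<le> m x"
      unfolding m_def using s(2) by (intro nn_integral_mono) (auto simp: w_def dg indicator_def)
    also have "m x = m y"
    proof -
      have "y = x + (- (x \<bullet> e - \<beta>)) *\<^sub>R e"
        unfolding scaleR_minus_left x(2) pe[of x] by (rule diff_conv_add_uminus)
      then show ?thesis using m_line by metis
    qed
    finally show ?thesis .
  qed
  have "hausdorff_measure ?k S \<le> ennreal (slab_const DIM('a)) * emeasure lborel T"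
  proof (rule hausdorff_measure_le_slab[OF e _ _ T _ n])
    have "bounded (p ` G)"
      using nonexpansive_image_diameter(1)[OF nonexp bounded_subset[OF bd G(1)]] .
    then show "bounded S" unfolding S_def by (rule bounded_subset) auto
    show "y \<bullet> e = \<beta>" if "y \<in> S" for y using that pb by (auto simp: S_def)
    fix y s assume ys: "y \<in> S" "(0::real) \<le> s" "s \<le> 1"
    then have "y \<bullet> e = \<beta>" using pb by (auto simp: S_def)
    then show "y + s *\<^sub>R e \<in> T" using m_big[OF ys(1)] ys m_line by (simp add: T_def inner_add_left ee)
  qed
  also have "emeasure lborel T \<le> ennreal (?I / h)"
  proof -
    have "ennreal h * emeasure lborel T \<le> (\<integral>\<^sup>+x. w x \<partial>lborel)"
      by (rule tonelli_slab[OF wm T e]) (auto simp: T_def m_def)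
    also have "\<dots> = (\<integral>\<^sup>+x. w x \<partial>lebesgue)" by (rule nn_integral_completion[symmetric])
    also have "\<dots> \<le> (\<integral>\<^sup>+x. ennreal (indicator {x\<in>\<Omega>. t - h \<le> u x \<and> u x < t} x *\<^sub>R norm (gradient u x)) \<partial>lebesgue)"
    proof (rule nn_integral_mono_AE)
      have "AE x in lborel. dir_deriv f e x = gradient f x \<bullet> e"
        using rademacher[OF lipf]
      proof eventually_elim
        case (elim x)
        then have "GDERIV f x :> gradient f x" by blast
        from dir_deriv_eqI[OF dquot_tendsto[OF GDERIV_directional[OF this]]] show ?case .
      qed
      from AE_completion[OF this]
      show "AE x in lebesgue. w x \<le> ennreal (indicator {x\<in>\<Omega>. t - h \<le> u x \<and> u x < t} x *\<^sub>R norm (gradient u x))"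
      proof eventually_elim
        case (elim x)
        show ?case
        proof (cases "x \<in> \<Omega>")
          case True
          have "\<bar>dir_deriv f e x\<bar> \<le> norm (gradient f x)"
            using Cauchy_Schwarz_ineq2[of "gradient f x" e] e elim by simp
          also have "\<dots> \<le> indicator {x. t - h \<le> u x \<and> u x < t} x * norm (gradient u x)"
            unfolding f_def using h by (intro gradient_clamp_le[OF lip]) simp
          finally have "\<bar>dir_deriv f e x\<bar> \<le> indicator {x. t - h \<le> u x \<and> u x < t} x * norm (gradient u x)" .
          then show ?thesis using True by (auto simp: w_def indicator_def intro!: ennreal_leI)
        qed (simp add: w_def)
      qed
    qed
    also have "\<dots> = ennreal ?I"
      unfolding set_lebesgue_integral_def
    proof (rule nn_integral_eq_integral)
      show "integrable lebesgue (\<lambda>x. indicator {x\<in>\<Omega>. t - h \<le> u x \<and> u x < t} x *\<^sub>R norm (gradient u x))"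
        unfolding set_integrable_def[symmetric]
        by (rule gradient_norm_set_integrable[OF lip])
           (use level_band_measurable[OF cont op] bounded_subset[OF bd] in auto)
    qed simp
    finally have le: "ennreal h * emeasure lborel T \<le> ennreal ?I" .
    have "emeasure lborel T = ennreal (1 / h) * (ennreal h * emeasure lborel T)"
      using h(1) by (simp add: mult.assoc[symmetric] ennreal_mult'[symmetric])
    also have "\<dots> \<le> ennreal (1 / h) * ennreal ?I" using le by (rule mult_left_mono) simp
    also have "\<dots> = ennreal (?I / h)" using h(1) by (simp add: ennreal_mult'[symmetric])
    finally show ?thesis .
  qed
  finally have HS: "hausdorff_measure ?k S \<le> ennreal (slab_const DIM('a)) * ennreal (?I / h)"
    by (simp add: mult_left_mono)
  have "hausdorff_measure ?k (p ` G) \<le> hausdorff_measure ?k (p ` ?B \<union> S)"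
    by (rule hausdorff_measure_mono) (auto simp: S_def)
  also have "\<dots> \<le> hausdorff_measure ?k (p ` ?B) + hausdorff_measure ?k S"
    by (rule hausdorff_measure_Un_le)
  also have "\<dots> \<le> hausdorff_measure ?k ?B + ennreal (slab_const DIM('a)) * ennreal (?I / h)"
    by (intro add_mono HS hausdorff_measure_nonexpansive_image nonexp)
  also have "ennreal (slab_const DIM('a)) * ennreal (?I / h) = ennreal (slab_const DIM('a) * (?I / h))"
    using slab_const_pos[of "DIM('a)"] n by (intro ennreal_mult'[symmetric]) auto
  finally show ?thesis .
qed

section \<open>Auxiliary facts on monotone and convex functions\<close>

text \<open>
  Monotonicity replaces continuity: the infimum of the points from which the growth up to \<open>b\<close> is large
  enough belongs to this set, and the derivative bound moves it further to the left.
\<close>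

lemma left_dini_growth:
  fixes F :: "real \<Rightarrow> real"
  assumes ab: "a \<le> b" and mono: "\<And>x y. a \<le> x \<Longrightarrow> x \<le> y \<Longrightarrow> y \<le> b \<Longrightarrow> F x \<le> F y"
    and dini: "\<And>t. a < t \<Longrightarrow> t \<le> b \<Longrightarrow> \<exists>d>0. \<forall>h. 0 < h \<and> h < d \<longrightarrow> c * h \<le> F t - F (t - h)"
  shows "c * (b - a) \<le> F b - F a"
proof -
  define X where "X = {s. a \<le> s \<and> s \<le> b \<and> c * (b - s) \<le> F b - F s}"
  have bX: "b \<in> X" using ab by (simp add: X_def)
  have bdd: "bdd_below X" by (rule bdd_belowI[of _ a]) (simp add: X_def)
  let ?s = "Inf X"
  have s: "a \<le> ?s" "?s \<le> b"
  proof -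
    show "a \<le> ?s" by (rule cInf_greatest) (use bX in \<open>auto simp: X_def\<close>)
    show "?s \<le> b" by (rule cInf_lower[OF bX bdd])
  qed
  have sX: "c * (b - ?s) \<le> F b - F ?s"
  proof (rule field_le_epsilon)
    fix e :: real assume e: "0 < e"
    have "?s < ?s + e / (\<bar>c\<bar> + 1)" using e by simp
    then obtain r where r: "r \<in> X" "r < ?s + e / (\<bar>c\<bar> + 1)"
      using cInf_lessD[of X "?s + e / (\<bar>c\<bar> + 1)"] bX by blast
    have sr: "?s \<le> r" using cInf_lower[OF r(1) bdd] .
    have "c * (r - ?s) \<le> \<bar>c\<bar> * (r - ?s)" using sr by (intro mult_right_mono) auto
    also have "\<dots> \<le> \<bar>c\<bar> * (e / (\<bar>c\<bar> + 1))" using r(2) by (intro mult_left_mono) auto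
    also have "\<dots> \<le> e" using e by (simp add: field_simps)
    finally have "c * (r - ?s) \<le> e" .
    moreover have "c * (b - r) \<le> F b - F r" "r \<le> b" using r(1) by (auto simp: X_def)
    moreover have "F ?s \<le> F r" using mono s sr \<open>r \<le> b\<close> by blast
    ultimately show "c * (b - ?s) \<le> F b - F ?s + e" by (simp add: algebra_simps)
  qed
  have "?s = a"
  proof (rule ccontr)
    assume "?s \<noteq> a"
    then have "a < ?s" using s by simp
    then obtain d where d: "0 < d" "\<And>h. 0 < h \<Longrightarrow> h < d \<Longrightarrow> c * h \<le> F ?s - F (?s - h)"
      using dini s(2) by blast
    define h where "h = min (d / 2) (?s - a)"
    have h: "0 < h" "h < d" "h \<le> ?s - a" using d(1) \<open>a < ?s\<close> by (auto simp: h_def)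
    have "c * (b - (?s - h)) \<le> F b - F (?s - h)" using d(2)[OF h(1,2)] sX by (simp add: algebra_simps)
    then have "?s - h \<in> X" using h s by (simp add: X_def)
    then show False using cInf_lower[OF _ bdd] h(1) by fastforce
  qed
  then show ?thesis using sX by simp
qed

text \<open>
  On a fine uniform partition the ratios \<open>s / r\<close> of neighbouring points are close to 1.
\<close>

lemma telescoping_lipschitz:
  fixes g :: "real \<Rightarrow> real"
  assumes x: "0 < x" "x < y" and K: "0 \<le> K"
    and g: "\<And>r s. x \<le> r \<Longrightarrow> r < s \<Longrightarrow> s \<le> y \<Longrightarrow> g r - g s \<le> K * (s / r) ^ m * (s - r)"
  shows "g x - g y \<le> K * (y - x)"
proof -
  define d where "d = y - x"
  have d: "0 < d" using x by (simp add: d_def)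
  have bound: "g x - g y \<le> K * (1 + d / x * inverse (real (Suc N))) ^ m * d" for N
  proof -
    define D where "D = d * inverse (real (Suc N))"
    have D: "0 < D" "real (Suc N) * D = d" using d by (simp_all add: D_def field_simps)
    define p where "p i = x + real i * D" for i
    have p0: "p 0 = x" "p (Suc N) = y" using D by (simp_all add: p_def d_def)
    have px: "x \<le> p i" for i using D by (simp add: p_def)
    have step: "g (p i) - g (p (Suc i)) \<le> K * (1 + D / x) ^ m * D" if i: "i < Suc N" for i
    proof -
      have e: "p (Suc i) = p i + D" by (simp add: p_def algebra_simps)
      have "p (Suc i) \<le> p (Suc N)" using i D(1) by (simp add: p_def del: of_nat_Suc)
      then have "g (p i) - g (p (Suc i)) \<le> K * (p (Suc i) / p i) ^ m * (p (Suc i) - p i)"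
        using px[of i] D(1) e p0 by (intro g) auto
      also have "\<dots> \<le> K * (1 + D / x) ^ m * D"
      proof -
        have "p (Suc i) / p i = 1 + D / p i" using px[of i] x(1) by (simp add: e field_simps)
        also have "\<dots> \<le> 1 + D / x" using px[of i] x(1) D(1) by (simp add: frac_le)
        finally have "(p (Suc i) / p i) ^ m \<le> (1 + D / x) ^ m"
          using px[of i] px[of "Suc i"] x(1) by (intro power_mono) auto
        then show ?thesis using K D(1) by (simp add: e mult_left_mono mult_right_mono)
      qed
      finally show ?thesis .
    qed
    have "g x - g y = (\<Sum>i<Suc N. g (p i) - g (p (Suc i)))"
      using sum_lessThan_telescope'[of "\<lambda>i. g (p i)" "Suc N"] p0 by simp
    also have "\<dots> \<le> (\<Sum>i<Suc N. K * (1 + D / x) ^ m * D)"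
      by (rule sum_mono) (use step in simp)
    also have "\<dots> = K * (1 + D / x) ^ m * (real (Suc N) * D)" by simp
    also have "\<dots> = K * (1 + d / x * inverse (real (Suc N))) ^ m * d" by (simp only: D(2)) (simp add: D_def)
    finally show ?thesis .
  qed
  have "(\<lambda>N. K * (1 + d / x * inverse (real (Suc N))) ^ m * d) \<longlonglongrightarrow> K * (1 + d / x * 0) ^ m * d"
    by (intro tendsto_intros LIMSEQ_inverse_real_of_nat)
  then have "g x - g y \<le> K * (1 + d / x * 0) ^ m * d"
    by (rule LIMSEQ_le_const) (use bound in blast)
  then show ?thesis by (simp add: d_def)
qed

lemma straddle_quotient_tendsto:
  fixes g :: "real \<Rightarrow> real"
  assumes g: "(g has_real_derivative \<delta>) (at r)"
    and y: "y \<longlonglongrightarrow> r" and z: "z \<longlonglongrightarrow> r" and yz: "\<And>k. y k \<le> r" "\<And>k. r \<le> z k" "\<And>k. y k < z k"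
  shows "(\<lambda>k. (g (z k) - g (y k)) / (z k - y k)) \<longlonglongrightarrow> \<delta>"
proof -
  obtain \<phi> where \<phi>: "\<And>s. g s - g r = \<phi> s * (s - r)" "isCont \<phi> r" "\<phi> r = \<delta>"
    using g unfolding CARAT_DERIV by blast
  have ly: "(\<lambda>k. \<phi> (y k)) \<longlonglongrightarrow> \<delta>" and lz: "(\<lambda>k. \<phi> (z k)) \<longlonglongrightarrow> \<delta>"
    using isCont_tendsto_compose[OF \<phi>(2) y] isCont_tendsto_compose[OF \<phi>(2) z] \<phi>(3) by auto
  have "(\<lambda>k. (g (z k) - g (y k)) / (z k - y k) - \<delta>) \<longlonglongrightarrow> 0"
  proof (rule Lim_null_comparison)
    have "\<bar>(g (z k) - g (y k)) / (z k - y k) - \<delta>\<bar> \<le> \<bar>\<phi> (z k) - \<delta>\<bar> + \<bar>\<phi> (y k) - \<delta>\<bar>" for k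
    proof -
      let ?w = "z k - y k"
      have w: "0 < ?w" using yz(3)[of k] by simp
      have "g (z k) - g (y k) - \<delta> * ?w = (\<phi> (z k) - \<delta>) * (z k - r) + (\<phi> (y k) - \<delta>) * (r - y k)"
        using \<phi>(1)[of "z k"] \<phi>(1)[of "y k"] by (simp add: algebra_simps)
      then have "\<bar>g (z k) - g (y k) - \<delta> * ?w\<bar> \<le> \<bar>\<phi> (z k) - \<delta>\<bar> * (z k - r) + \<bar>\<phi> (y k) - \<delta>\<bar> * (r - y k)"
        using abs_triangle_ineq[of "(\<phi> (z k) - \<delta>) * (z k - r)" "(\<phi> (y k) - \<delta>) * (r - y k)"] yz[of k] by (simp add: abs_mult)
      also have "\<dots> \<le> \<bar>\<phi> (z k) - \<delta>\<bar> * ?w + \<bar>\<phi> (y k) - \<delta>\<bar> * ?w"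
        using yz[of k] by (intro add_mono mult_left_mono) auto
      finally have *: "\<bar>g (z k) - g (y k) - \<delta> * ?w\<bar> \<le> (\<bar>\<phi> (z k) - \<delta>\<bar> + \<bar>\<phi> (y k) - \<delta>\<bar>) * ?w" by (simp add: algebra_simps)
      have "(g (z k) - g (y k)) / ?w - \<delta> = (g (z k) - g (y k) - \<delta> * ?w) / ?w" using w by (simp add: field_simps)
      then have "\<bar>(g (z k) - g (y k)) / ?w - \<delta>\<bar> = \<bar>g (z k) - g (y k) - \<delta> * ?w\<bar> / ?w" using w by (simp add: abs_divide)
      then show ?thesis using * w by (simp add: pos_divide_le_eq)
    qed
    then show "\<forall>\<^sub>F k in sequentially. norm ((g (z k) - g (y k)) / (z k - y k) - \<delta>) \<le> \<bar>\<phi> (z k) - \<delta>\<bar> + \<bar>\<phi> (y k) - \<delta>\<bar>"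
      by (simp add: always_eventually)
    show "(\<lambda>k. \<bar>\<phi> (z k) - \<delta>\<bar> + \<bar>\<phi> (y k) - \<delta>\<bar>) \<longlonglongrightarrow> 0"
      using tendsto_add[OF tendsto_rabs[OF tendsto_diff[OF lz tendsto_const[of \<delta>]]] tendsto_rabs[OF tendsto_diff[OF ly tendsto_const[of \<delta>]]]] by simp
  qed
  then show ?thesis by (simp only: LIM_zero_iff)
qed

lemma convex_support_line:
  fixes B :: "real \<Rightarrow> real"
  assumes B: "convex_on {0..} B" and z: "0 < z"
  obtains k where "\<And>y. 0 \<le> y \<Longrightarrow> B z + k * (y - z) \<le> B y"
proof
  fix y :: real assume "0 \<le> y"
  then show "B z + Inf ((\<lambda>t. (B z - B t) / (z - t)) ` ({z<..} \<inter> {0..})) * (y - z) \<le> B y"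
    using convex_le_Inf_differential[OF B, of z y] z by simp
qed

text \<open>
  Jensen's inequality on \<open>E\<close>, extended by zero to a set of the larger measure \<open>\<tau>\<close>.  The supporting line at
  the mean value is nonpositive at 0 since \<open>\<Psi> 0 = 0\<close>, so increasing the measure only helps.
\<close>

lemma jensen_padded:
  fixes B w :: "'a::euclidean_space \<Rightarrow> real"
    and \<Psi> :: "real \<Rightarrow> real"
  assumes \<Psi>: "convex_on {0..} \<Psi>" "mono_on {0..} \<Psi>" "\<Psi> 0 = 0" "continuous_on {0..} \<Psi>"
    and w: "w \<in> borel_measurable lebesgue" "\<And>x. 0 \<le> w x" "\<And>x. w x \<le> L"
    and E: "E \<in> lmeasurable" "measure lebesgue E \<le> \<tau>" and \<tau>: "0 < \<tau>"
    and q: "0 \<le> q" "q * \<tau> \<le> (LINT x:E|lebesgue. w x)"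
  shows "ennreal (\<tau> * \<Psi> q) \<le> (\<integral>\<^sup>+x. ennreal (\<Psi> (w x)) * indicator E x \<partial>lebesgue)"
proof (cases "q = 0")
  case False
  define J where "J = (LINT x:E|lebesgue. w x)"
  define z where "z = J / \<tau>"
  have "q \<le> z" using q(2) \<tau> by (simp add: z_def J_def[symmetric] pos_le_divide_eq)
  moreover have "0 < q" using q(1) False by simp
  ultimately have z: "q \<le> z" "0 < z" "\<tau> * z = J" using \<tau> by (auto simp: z_def)
  obtain k where k: "\<And>y. 0 \<le> y \<Longrightarrow> \<Psi> z + k * (y - z) \<le> \<Psi> y"
    using convex_support_line[OF \<Psi>(1) z(2)] by blast
  have le0: "\<Psi> z - k * z \<le> 0" using k[of 0] \<Psi>(3) by simp
  have \<Psi>nn: "0 \<le> \<Psi> y" if "0 \<le> y" for y using \<Psi>(2,3) that by (metis atLeast_iff mono_onD order_refl)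
  have L: "0 \<le> L" using w(2,3) order_trans by blast
  have em: "emeasure lebesgue E < \<infinity>" "E \<in> sets lebesgue" using E(1) by (auto simp: fmeasurable_def)
  have iw: "integrable lebesgue (\<lambda>x. indicator E x *\<^sub>R w x)"
    by (rule integrableI_bounded_set[of E _ _ L])
       (use em w L in \<open>auto simp: indicator_def intro!: borel_measurable_scaleR borel_measurable_indicator\<close>)
  have m\<Psi>: "(\<lambda>x. \<Psi> (w x)) \<in> borel_measurable lebesgue"
  proof -
    have "continuous_on UNIV (\<lambda>y. \<Psi> (max 0 y))"
      by (rule continuous_on_compose2[OF \<Psi>(4)]) (auto intro!: continuous_intros)
    then have "(\<lambda>y. \<Psi> (max 0 y)) \<in> borel_measurable borel" by (rule borel_measurable_continuous_onI)
    from measurable_compose[OF w(1) this] show ?thesis using w(2) by (simp add: max_def)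
  qed
  have i\<Psi>: "integrable lebesgue (\<lambda>x. indicator E x *\<^sub>R \<Psi> (w x))"
  proof (rule integrableI_bounded_set[of E _ _ "\<Psi> L"])
    show "(\<lambda>x. indicator E x *\<^sub>R \<Psi> (w x)) \<in> borel_measurable lebesgue"
      using m\<Psi> em by (intro borel_measurable_scaleR borel_measurable_indicator)
    have "\<bar>\<Psi> (w x)\<bar> \<le> \<Psi> L" for x
      using mono_onD[OF \<Psi>(2), of "w x" L] \<Psi>nn[OF w(2)[of x]] w(2,3)[of x] L by simp
    then show "AE x\<in>E in lebesgue. norm (indicator E x *\<^sub>R \<Psi> (w x)) \<le> \<Psi> L" by (auto simp: indicator_def)
  qed (use em in \<open>auto simp: indicator_def\<close>)
  have iE: "integrable lebesgue (\<lambda>x. indicator E x :: real)" using integrable_real_indicator[OF em(2,1)] .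
  have "\<tau> * \<Psi> q \<le> \<tau> * \<Psi> z"
    using mono_onD[OF \<Psi>(2), of q z] z q(1) \<tau> by (intro mult_left_mono) auto
  also have "\<dots> = \<tau> * (\<Psi> z - k * z) + k * J" using z(3) by (simp add: algebra_simps)
  also have "\<dots> \<le> measure lebesgue E * (\<Psi> z - k * z) + k * J"
    using mult_right_mono_neg[OF E(2) le0] by simp
  also have "\<dots> = (\<integral>x. (\<Psi> z - k * z) * indicator E x + k * (indicator E x *\<^sub>R w x) \<partial>lebesgue)"
    using iw iE em by (simp add: J_def set_lebesgue_integral_def mult.commute)
  also have "\<dots> \<le> (\<integral>x. indicator E x *\<^sub>R \<Psi> (w x) \<partial>lebesgue)"
  proof (rule integral_mono)
    show "integrable lebesgue (\<lambda>x. (\<Psi> z - k * z) * indicator E x + k * (indicator E x *\<^sub>R w x))"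
      using iw iE by simp
    show "(\<Psi> z - k * z) * indicator E x + k * (indicator E x *\<^sub>R w x) \<le> indicator E x *\<^sub>R \<Psi> (w x)" for x
      using k[OF w(2)[of x]] by (cases "x \<in> E") (auto simp: algebra_simps)
  qed (rule i\<Psi>)
  finally have "ennreal (\<tau> * \<Psi> q) \<le> ennreal (\<integral>x. indicator E x *\<^sub>R \<Psi> (w x) \<partial>lebesgue)" by (rule ennreal_leI)
  also have "\<dots> = (\<integral>\<^sup>+x. ennreal (indicator E x *\<^sub>R \<Psi> (w x)) \<partial>lebesgue)"
    by (rule nn_integral_eq_integral[symmetric, OF i\<Psi>]) (use \<Psi>nn w(2) in \<open>auto simp: indicator_def\<close>)
  also have "\<dots> = (\<integral>\<^sup>+x. ennreal (\<Psi> (w x)) * indicator E x \<partial>lebesgue)"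
    by (intro nn_integral_cong) (auto simp: indicator_def)
  finally show ?thesis .
qed (use \<Psi>(3) in simp)

section \<open>The rearrangement under a differential isoperimetric inequality\<close>

text \<open>
  The numbers \<open>\<alpha>\<close>, \<open>cn\<close>, \<open>K\<close> and \<open>N\<close> are parameters determined by equations, because a constant
  defined inside the locale from the dimension of the type alone would receive the type as an
  additional argument.
\<close>

locale level_set_isoperimetry =
  fixes \<Omega> :: "'a::euclidean_space set" and u :: "'a \<Rightarrow> real" and L \<gamma> \<alpha> cn K :: real and N :: nat
  assumes op: "open \<Omega>" and bd: "bounded \<Omega>" and ne: "\<Omega> \<noteq> {}"
    and lip: "L-lipschitz_on UNIV u" and u_nonneg: "\<And>x. x \<in> \<Omega> \<Longrightarrow> 0 \<le> u x"
    and dim_eq [simp]: "DIM('a) = N" and dim: "2 \<le> N" and \<gamma>: "0 < \<gamma>"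
    and \<alpha>_def: "\<alpha> = 1 - 1 / real N" and cn_def: "cn = unit_ball_vol (real N)"
    and K_def: "K = real N * root N cn / \<gamma>"
    and dini: "\<And>t c. 0 < t \<Longrightarrow> c < \<gamma> * measure lebesgue {x\<in>\<Omega>. t \<le> u x} powr \<alpha> \<Longrightarrow>
      \<exists>d>0. \<forall>h. 0 < h \<and> h < d \<longrightarrow>
        c * h \<le> (LINT x:{x\<in>\<Omega>. t - h \<le> u x \<and> u x < t}|lebesgue. norm (gradient u x))"
begin

abbreviation "grad_mass A \<equiv> (LINT x:A|lebesgue. norm (gradient u x))"
abbreviation "vol \<equiv> measure lebesgue \<Omega>"
abbreviation "\<mu> \<equiv> distribution_function \<Omega> u"
abbreviation "ustar \<equiv> decreasing_rearrangement \<Omega> u"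
abbreviation "superlevel t \<equiv> measure lebesgue {x\<in>\<Omega>. t \<le> u x}"

lemma \<alpha>_nonneg: "0 \<le> \<alpha>" using dim by (simp add: \<alpha>_def)

lemma cont_u: "continuous_on UNIV u" using lip by (rule lipschitz_on_continuous_on)

lemma subset_lmeasurable: "A \<in> sets borel \<Longrightarrow> A \<subseteq> \<Omega> \<Longrightarrow> A \<in> lmeasurable"
  using bounded_subset[OF bd] by (intro bounded_set_imp_lmeasurable) auto

lemma level_sets [measurable]:
  "{x\<in>\<Omega>. t < u x} \<in> sets borel" "{x\<in>\<Omega>. t \<le> u x} \<in> sets borel"
  "{x\<in>\<Omega>. a < u x \<and> u x < b} \<in> sets borel" "{x\<in>\<Omega>. a \<le> u x \<and> u x < b} \<in> sets borel"
proof -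
  note [measurable] = borel_measurable_continuous_onI[OF cont_u]
  have [measurable]: "\<Omega> \<in> sets borel" using op by simp
  have e: "{x\<in>\<Omega>. P x} = \<Omega> \<inter> {x\<in>space borel. P x}" for P by auto
  have "{x\<in>space borel. t < u x} \<in> sets borel" "{x\<in>space borel. t \<le> u x} \<in> sets borel"
    "{x\<in>space borel. a < u x \<and> u x < b} \<in> sets borel" "{x\<in>space borel. a \<le> u x \<and> u x < b} \<in> sets borel" by measurable
  then show "{x\<in>\<Omega>. t < u x} \<in> sets borel" "{x\<in>\<Omega>. t \<le> u x} \<in> sets borel"
    "{x\<in>\<Omega>. a < u x \<and> u x < b} \<in> sets borel" "{x\<in>\<Omega>. a \<le> u x \<and> u x < b} \<in> sets borel"
    unfolding e[of "\<lambda>x. t < u x"] e[of "\<lambda>x. t \<le> u x"] e[of "\<lambda>x. a < u x \<and> u x < b"] e[of "\<lambda>x. a \<le> u x \<and> u x < b"]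
    by (auto intro!: sets.Int simp: op)
qed

lemma level_lmeasurable:
  "{x\<in>\<Omega>. t < u x} \<in> lmeasurable" "{x\<in>\<Omega>. t \<le> u x} \<in> lmeasurable"
  "{x\<in>\<Omega>. a < u x \<and> u x < b} \<in> lmeasurable" "{x\<in>\<Omega>. a \<le> u x \<and> u x < b} \<in> lmeasurable" "\<Omega> \<in> lmeasurable"
  by (rule subset_lmeasurable; use op in auto)+

lemma grad_set_integrable: "A \<in> sets borel \<Longrightarrow> A \<subseteq> \<Omega> \<Longrightarrow> set_integrable lebesgue A (\<lambda>x. norm (gradient u x))"
  by (rule gradient_norm_set_integrable[OF lip]) (use bounded_subset[OF bd] in auto)

lemma grad_mass_mono:
  assumes "A \<in> sets borel" "B \<in> sets borel" "A \<subseteq> B" "B \<subseteq> \<Omega>"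
  shows "grad_mass A \<le> grad_mass B"
  unfolding set_lebesgue_integral_def
proof (rule integral_mono)
  show "integrable lebesgue (\<lambda>x. indicator A x *\<^sub>R norm (gradient u x))"
    "integrable lebesgue (\<lambda>x. indicator B x *\<^sub>R norm (gradient u x))"
    using grad_set_integrable assms unfolding set_integrable_def by auto
  show "indicator A x *\<^sub>R norm (gradient u x) \<le> indicator B x *\<^sub>R norm (gradient u x)" for x
    using assms(3) by (auto simp: indicator_def)
qed

lemma grad_mass_nonneg: "0 \<le> grad_mass A"
  unfolding set_lebesgue_integral_def by (rule integral_nonneg_AE) (auto simp: indicator_def)

lemma superlevel_antimono: "s \<le> t \<Longrightarrow> superlevel t \<le> superlevel s"
  using level_lmeasurable by (intro measure_mono_fmeasurable) auto

text \<open>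
  Since \<open>superlevel\<close> is antimonotone, the lower bound at the level \<open>b\<close> holds at all levels below \<open>b\<close>.
\<close>

lemma closed_band_estimate:
  assumes "0 \<le> a" "a < b"
  shows "\<gamma> * superlevel b powr \<alpha> * (b - a) \<le> grad_mass {x\<in>\<Omega>. a \<le> u x \<and> u x < b}"
proof (rule field_le_epsilon)
  fix e :: real assume e: "0 < e"
  define c where "c = \<gamma> * superlevel b powr \<alpha> - e / (b - a)"
  define F where "F t = grad_mass {x\<in>\<Omega>. a \<le> u x \<and> u x < t}" for t
  have diff: "F t - F s = grad_mass {x\<in>\<Omega>. s \<le> u x \<and> u x < t}" if "a \<le> s" "s \<le> t" for s t
  proof -
    have "{x\<in>\<Omega>. a \<le> u x \<and> u x < t} = {x\<in>\<Omega>. a \<le> u x \<and> u x < s} \<union> {x\<in>\<Omega>. s \<le> u x \<and> u x < t}"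
      using that by auto
    then have "F t = F s + grad_mass {x\<in>\<Omega>. s \<le> u x \<and> u x < t}"
      unfolding F_def by (simp only:) (rule set_integral_Un; use grad_set_integrable level_sets in auto)
    then show ?thesis by simp
  qed
  have "c * (b - a) \<le> F b - F a"
  proof (rule left_dini_growth)
    show "F s \<le> F t" if "a \<le> s" "s \<le> t" "t \<le> b" for s t
      unfolding F_def by (rule grad_mass_mono) (use that level_sets in auto)
    fix t assume t: "a < t" "t \<le> b"
    have "superlevel b powr \<alpha> \<le> superlevel t powr \<alpha>"
      using superlevel_antimono[OF t(2)] \<alpha>_nonneg by (intro powr_mono2) auto
    then have "c < \<gamma> * superlevel t powr \<alpha>"
    proof -
      have "\<gamma> * superlevel b powr \<alpha> \<le> \<gamma> * superlevel t powr \<alpha>"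
        using \<open>superlevel b powr \<alpha> \<le> superlevel t powr \<alpha>\<close> \<gamma> by (intro mult_left_mono) auto
      moreover have "0 < e / (b - a)" using e assms by simp
      ultimately show ?thesis unfolding c_def by linarith
    qed
    then obtain d where d: "0 < d" "\<And>h. 0 < h \<Longrightarrow> h < d \<Longrightarrow> c * h \<le> grad_mass {x\<in>\<Omega>. t - h \<le> u x \<and> u x < t}"
      using dini[of t c] t assms by auto
    show "\<exists>d>0. \<forall>h. 0 < h \<and> h < d \<longrightarrow> c * h \<le> F t - F (t - h)"
    proof (intro exI[of _ "min d (t - a)"] conjI allI impI)
      fix h assume "0 < h \<and> h < min d (t - a)"
      then show "c * h \<le> F t - F (t - h)" using d(2)[of h] diff[of "t - h" t] by auto
    qed (use d t in auto)
  qed (use assms in simp)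
  also have "F b - F a = grad_mass {x\<in>\<Omega>. a \<le> u x \<and> u x < b}" using diff[of a b] assms by simp
  finally show "\<gamma> * superlevel b powr \<alpha> * (b - a) \<le> grad_mass {x\<in>\<Omega>. a \<le> u x \<and> u x < b} + e"
    using assms by (simp add: c_def left_diff_distrib)
qed

text \<open>
  The level \<open>a\<close> has to be excluded: the set \<open>{u = a}\<close> may have positive measure, and then the closed
  band would be too large for the rearrangement.
\<close>

lemma open_band_estimate:
  assumes "0 \<le> a" "a \<le> b"
  shows "\<gamma> * superlevel b powr \<alpha> * (b - a) \<le> grad_mass {x\<in>\<Omega>. a < u x \<and> u x < b}"
proof (cases "a = b")
  case False
  then have ab: "a < b" using assms by simp
  let ?c = "\<gamma> * superlevel b powr \<alpha>"
  have "?c * (b - a') \<le> grad_mass {x\<in>\<Omega>. a < u x \<and> u x < b}" if "a < a'" "a' < b" for a'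
    by (rule order_trans[OF closed_band_estimate grad_mass_mono]) (use that assms level_sets in auto)
  then have "\<forall>\<^sub>F a' in at_right a. ?c * (b - a') \<le> grad_mass {x\<in>\<Omega>. a < u x \<and> u x < b}"
    unfolding eventually_at_right_field using ab by blast
  moreover have "((\<lambda>a'. ?c * (b - a')) \<longlongrightarrow> ?c * (b - a)) (at_right a)" by (intro tendsto_intros)
  ultimately show ?thesis by (intro tendsto_upperbound) auto
qed (simp add: grad_mass_nonneg)

lemma \<mu>_antimono: "s \<le> t \<Longrightarrow> \<mu> t \<le> \<mu> s"
  unfolding distribution_function_def using level_lmeasurable by (intro measure_mono_fmeasurable) auto

lemma \<mu>_below_zero: "t < 0 \<Longrightarrow> \<mu> t = vol"
proof -
  assume "t < 0"
  then have "{x\<in>\<Omega>. t < u x} = \<Omega>" using u_nonneg by force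
  then show ?thesis by (simp add: distribution_function_def)
qed

lemma \<mu>_vanishes: "\<exists>t. \<mu> t = 0"
proof -
  have "bounded (u ` closure \<Omega>)"
    using bd by (intro compact_imp_bounded compact_continuous_image) (auto intro: continuous_on_subset[OF cont_u])
  then obtain M where M: "\<forall>y\<in>u ` closure \<Omega>. norm y \<le> M" unfolding bounded_iff by blast
  have "{x\<in>\<Omega>. M < u x} = {}" using M closure_subset[of \<Omega>] by fastforce
  then have "\<mu> M = 0" by (simp only: distribution_function_def measure_empty)
  then show ?thesis ..
qed

lemma vol_pos: "0 < vol"
proof (rule ccontr)
  assume "\<not> 0 < vol"
  then have "vol = 0" by (simp add: not_less measure_le_0_iff)
  then have "negligible \<Omega>" using level_lmeasurable(5) by (simp add: negligible_iff_measure)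
  then show False using open_not_negligible[OF op ne] by blast
qed

context
  fixes s :: real
  assumes s: "0 \<le> s" "s < vol"
begin

lemma levels_below: "{t. \<mu> t \<le> s} \<noteq> {}" "\<And>t. \<mu> t \<le> s \<Longrightarrow> 0 \<le> t" "bdd_below {t. \<mu> t \<le> s}"
proof -
  show "{t. \<mu> t \<le> s} \<noteq> {}" using \<mu>_vanishes s(1) by (metis (mono_tags) empty_Collect_eq)
  show pos: "0 \<le> t" if "\<mu> t \<le> s" for t using that \<mu>_below_zero[of t] s(2) by (cases "t < 0") auto
  show "bdd_below {t. \<mu> t \<le> s}" by (rule bdd_belowI[of _ 0]) (use pos in auto)
qed

lemma ustar_nonneg: "0 \<le> ustar s"
  unfolding decreasing_rearrangement_def by (rule cInf_greatest) (use levels_below in auto)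

lemma ustar_le: "\<mu> t \<le> s \<Longrightarrow> ustar s \<le> t"
  unfolding decreasing_rearrangement_def by (rule cInf_lower) (use levels_below in auto)

lemma le_ustar: "s < \<mu> t \<Longrightarrow> t \<le> ustar s"
  unfolding decreasing_rearrangement_def
proof (rule cInf_greatest)
  fix t' assume "s < \<mu> t" "t' \<in> {t. \<mu> t \<le> s}"
  then show "t \<le> t'" using \<mu>_antimono[of t' t] by (cases "t \<le> t'") auto
qed (use levels_below in auto)

text \<open>
  The infimum defining \<open>ustar s\<close> is attained because the distribution function is right continuous.
\<close>

lemma \<mu>_ustar: "\<mu> (ustar s) \<le> s"
proof -
  let ?\<epsilon> = "\<lambda>k. inverse (real (Suc k))"
  let ?A = "\<lambda>k. {x\<in>\<Omega>. ustar s + ?\<epsilon> k < u x}"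
  have "(\<lambda>k. measure lebesgue (?A k)) \<longlonglongrightarrow> measure lebesgue (\<Union>k. ?A k)"
  proof (rule Lim_measure_incseq)
    show "range ?A \<subseteq> sets lebesgue" using level_lmeasurable(1) by auto
    have "x \<in> ?A k'" if k: "k \<le> k'" "x \<in> ?A k" for k k' x
    proof -
      have "?\<epsilon> k' \<le> ?\<epsilon> k" using k(1) by (simp add: le_imp_inverse_le)
      moreover have "ustar s + ?\<epsilon> k < u x" "x \<in> \<Omega>" using k(2) by blast+
      ultimately have "ustar s + ?\<epsilon> k' < u x" by linarith
      then show ?thesis using \<open>x \<in> \<Omega>\<close> by blast
    qed
    then show "incseq ?A" unfolding incseq_def by blast
    have "emeasure lebesgue (\<Union>k. ?A k) \<le> emeasure lebesgue \<Omega>"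
      using op by (intro emeasure_mono) auto
    also have "\<dots> < \<infinity>" using fmeasurableD2[OF level_lmeasurable(5)] unfolding less_top infinity_ennreal_def .
    finally show "emeasure lebesgue (\<Union>k. ?A k) \<noteq> \<infinity>" by simp
  qed
  also have "(\<Union>k. ?A k) = {x\<in>\<Omega>. ustar s < u x}"
  proof (intro equalityI subsetI)
    fix x assume x: "x \<in> {x\<in>\<Omega>. ustar s < u x}"
    then obtain k where "?\<epsilon> k < u x - ustar s" using reals_Archimedean[of "u x - ustar s"] by auto
    then show "x \<in> (\<Union>k. ?A k)" using x by (auto intro!: exI[of _ k])
  next
    fix x assume "x \<in> (\<Union>k. ?A k)"
    then obtain k where k: "x \<in> \<Omega>" "ustar s + ?\<epsilon> k < u x" by blast
    have "0 < ?\<epsilon> k" by simp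
    then have "ustar s < u x" using k(2) by linarith
    then show "x \<in> {x\<in>\<Omega>. ustar s < u x}" using k(1) by simp
  qed
  finally have "(\<lambda>k. \<mu> (ustar s + ?\<epsilon> k)) \<longlonglongrightarrow> \<mu> (ustar s)" by (simp add: distribution_function_def)
  moreover have "\<mu> (ustar s + ?\<epsilon> k) \<le> s" for k
  proof -
    have "Inf {t. \<mu> t \<le> s} < ustar s + ?\<epsilon> k" by (simp add: decreasing_rearrangement_def)
    then obtain t where "\<mu> t \<le> s" "t < ustar s + ?\<epsilon> k"
      using cInf_lessD[OF levels_below(1)] by blast
    then show ?thesis using \<mu>_antimono[of t "ustar s + ?\<epsilon> k"] by simp
  qed
  ultimately show ?thesis by (intro LIMSEQ_le_const2) auto
qed

text \<open>
  Every level below \<open>ustar s\<close> has a superlevel set of measure greater than \<open>s\<close>, and these sets decrease to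
  the one at \<open>ustar s\<close>.
\<close>

lemma superlevel_ustar: "s \<le> superlevel (ustar s)"
proof -
  let ?\<epsilon> = "\<lambda>k. inverse (real (Suc k))"
  let ?A = "\<lambda>k. {x\<in>\<Omega>. ustar s - ?\<epsilon> k < u x}"
  have "(\<lambda>k. measure lebesgue (?A k)) \<longlonglongrightarrow> measure lebesgue (\<Inter>k. ?A k)"
  proof (rule Lim_measure_decseq)
    show "range ?A \<subseteq> sets lebesgue" using level_lmeasurable(1) by auto
    have "x \<in> ?A k" if k: "k \<le> k'" "x \<in> ?A k'" for k k' x
    proof -
      have "?\<epsilon> k' \<le> ?\<epsilon> k" using k(1) by (simp add: le_imp_inverse_le)
      moreover have "ustar s - ?\<epsilon> k' < u x" "x \<in> \<Omega>" using k(2) by blast+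
      ultimately have "ustar s - ?\<epsilon> k < u x" by linarith
      then show ?thesis using \<open>x \<in> \<Omega>\<close> by blast
    qed
    then show "decseq ?A" unfolding decseq_def by blast
    show "emeasure lebesgue (?A k) \<noteq> \<infinity>" for k using level_lmeasurable(1) by (simp add: fmeasurable_def less_top)
  qed
  also have "(\<Inter>k. ?A k) = {x\<in>\<Omega>. ustar s \<le> u x}"
  proof (intro equalityI subsetI)
    fix x assume x: "x \<in> (\<Inter>k. ?A k)"
    have "ustar s \<le> u x"
    proof (rule ccontr)
      assume "\<not> ?thesis"
      then obtain k where "?\<epsilon> k < ustar s - u x" using reals_Archimedean[of "ustar s - u x"] by auto
      moreover have "ustar s - ?\<epsilon> k < u x" using x by blast
      ultimately show False by simp
    qed
    then show "x \<in> {x\<in>\<Omega>. ustar s \<le> u x}" using x by simp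
  next
    fix x assume x: "x \<in> {x\<in>\<Omega>. ustar s \<le> u x}"
    have "0 < ?\<epsilon> k" for k by simp
    then show "x \<in> (\<Inter>k. ?A k)" using x by (auto intro: less_le_trans[of _ "ustar s"] simp del: of_nat_Suc)
  qed
  finally have "(\<lambda>k. \<mu> (ustar s - ?\<epsilon> k)) \<longlonglongrightarrow> superlevel (ustar s)" by (simp add: distribution_function_def)
  moreover have "s \<le> \<mu> (ustar s - ?\<epsilon> k)" for k
  proof (rule ccontr)
    assume "\<not> ?thesis"
    then have "ustar s \<le> ustar s - ?\<epsilon> k" by (intro ustar_le) simp
    moreover have "0 < ?\<epsilon> k" by simp
    ultimately show False by linarith
  qed
  ultimately show ?thesis by (intro LIMSEQ_le_const) auto
qed

end

lemma ustar_antimono: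
  assumes "0 \<le> s" "s \<le> s'" "s' < vol"
  shows "ustar s' \<le> ustar s"
proof (rule ustar_le)
  have "\<mu> (ustar s) \<le> s" by (rule \<mu>_ustar) (use assms in auto)
  then show "\<mu> (ustar s) \<le> s'" using assms by simp
qed (use assms in auto)

text \<open>
  The flat parts of \<open>u\<close> at the two ends of the band are excluded from it; this is what makes its measure at
  most \<open>s' - s\<close>.
\<close>

lemma ustar_band:
  assumes s: "0 \<le> s" "s \<le> s'" "s' < vol"
  defines "E \<equiv> {x\<in>\<Omega>. ustar s' < u x \<and> u x < ustar s}"
  shows "measure lebesgue E \<le> s' - s" "\<gamma> * s powr \<alpha> * (ustar s - ustar s') \<le> grad_mass E"
proof -
  have s1: "0 \<le> s" "s < vol" and s2: "0 \<le> s'" "s' < vol" using s by auto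
  have le: "ustar s' \<le> ustar s" by (rule ustar_antimono[OF s])
  show "measure lebesgue E \<le> s' - s"
  proof (cases "ustar s' < ustar s")
    case True
    have "emeasure lebesgue {x\<in>\<Omega>. ustar s' < u x \<and> u x < ustar s} \<noteq> \<infinity>" "emeasure lebesgue {x\<in>\<Omega>. ustar s \<le> u x} \<noteq> \<infinity>"
      unfolding infinity_ennreal_def by (intro fmeasurableD2 level_lmeasurable)+
    then have "measure lebesgue E + superlevel (ustar s) = measure lebesgue (E \<union> {x\<in>\<Omega>. ustar s \<le> u x})"
      unfolding E_def by (intro measure_Union[symmetric] fmeasurableD level_lmeasurable) auto
    also have "E \<union> {x\<in>\<Omega>. ustar s \<le> u x} = {x\<in>\<Omega>. ustar s' < u x}" using True by (auto simp: E_def)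
    also have "measure lebesgue \<dots> \<le> s'" using \<mu>_ustar[OF s2] by (simp add: distribution_function_def)
    finally show ?thesis using superlevel_ustar[OF s1] by simp
  next
    case False
    then have "E = {}" by (auto simp: E_def)
    then show ?thesis using s by simp
  qed
  have "s powr \<alpha> \<le> superlevel (ustar s) powr \<alpha>"
    using superlevel_ustar[OF s1] s(1) \<alpha>_nonneg by (intro powr_mono2) auto
  then have "\<gamma> * s powr \<alpha> * (ustar s - ustar s') \<le> \<gamma> * superlevel (ustar s) powr \<alpha> * (ustar s - ustar s')"
    using \<gamma> le by (intro mult_right_mono mult_left_mono) auto
  also have "\<dots> \<le> grad_mass E"
    unfolding E_def by (rule open_band_estimate[OF ustar_nonneg[OF s2] le])
  finally show "\<gamma> * s powr \<alpha> * (ustar s - ustar s') \<le> grad_mass E" .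
qed

definition radius :: real where "radius = root N (vol / cn)"
definition ballvol :: "real \<Rightarrow> real" where "ballvol r = cn * r ^ N"
definition profile :: "real \<Rightarrow> real" where "profile r = ustar (ballvol r)"

lemma cn_pos: "0 < cn" by (simp add: cn_def)

lemma radius_pos: "0 < radius"
  using vol_pos cn_pos dim by (simp add: radius_def)

lemma ballvol_radius: "ballvol radius = vol"
  using vol_pos cn_pos dim less_imp_neq[OF cn_pos] by (simp add: ballvol_def radius_def)

lemma ballvol_strict_mono: "0 \<le> r \<Longrightarrow> r < r' \<Longrightarrow> ballvol r < ballvol r'"
  using dim cn_pos by (simp add: ballvol_def power_strict_mono)

lemma ballvol_mono: "0 \<le> r \<Longrightarrow> r \<le> r' \<Longrightarrow> ballvol r \<le> ballvol r'"
  using cn_pos by (simp add: ballvol_def power_mono)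

lemma ballvol_range: "0 \<le> r \<Longrightarrow> r < radius \<Longrightarrow> 0 \<le> ballvol r \<and> ballvol r < vol"
proof -
  assume r: "0 \<le> r" "r < radius"
  have "ballvol r < vol" using ballvol_strict_mono[OF r] unfolding ballvol_radius .
  moreover have "0 \<le> ballvol r" using r cn_pos by (simp add: ballvol_def)
  ultimately show ?thesis by simp
qed

lemma symmetrized_ball_eq: "symmetrized_ball \<Omega> = ball 0 radius"
  by (simp add: symmetrized_ball_def radius_def cn_def[symmetric])

lemma schwarz_eq: "schwarz_symmetrization \<Omega> u x = profile (norm x)"
  by (simp add: schwarz_symmetrization_def profile_def ballvol_def cn_def[symmetric])

lemma K_pos: "0 < K" using dim cn_pos \<gamma> by (simp add: K_def)

lemma ballvol_powr: "0 < r \<Longrightarrow> ballvol r powr \<alpha> * root N cn = cn * r ^ (N - 1)"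
proof -
  assume r: "0 < r"
  have n0: "real N \<noteq> 0" using dim by simp
  have "ballvol r powr \<alpha> = cn powr \<alpha> * (r powr real N) powr \<alpha>"
    using r cn_pos by (simp add: ballvol_def powr_mult powr_realpow)
  also have "(r powr real N) powr \<alpha> = r powr (real (N - 1))"
    using dim n0 by (simp add: powr_powr right_diff_distrib of_nat_diff \<alpha>_def)
  also have "\<dots> = r ^ (N - 1)" using r by (rule powr_realpow)
  finally have "ballvol r powr \<alpha> = cn powr \<alpha> * r ^ (N - 1)" .
  moreover have "root N cn = cn powr (1 / real N)"
    using dim cn_pos by (subst root_powr_inverse) (auto simp: inverse_eq_divide)
  moreover have "cn powr \<alpha> * cn powr (1 / real N) = cn"
    using cn_pos by (simp add: powr_add[symmetric] \<alpha>_def)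
  ultimately show ?thesis by (simp add: mult_ac)
qed

lemma profile_antimono: "0 \<le> r \<Longrightarrow> r \<le> r' \<Longrightarrow> r' < radius \<Longrightarrow> profile r' \<le> profile r"
  unfolding profile_def using ballvol_range[of r] ballvol_range[of r'] ballvol_mono[of r r'] by (intro ustar_antimono) auto

lemma ballvol_diff_le:
  assumes "0 \<le> r" "r \<le> r'"
  shows "ballvol r' - ballvol r \<le> cn * real N * r' ^ (N - 1) * (r' - r)"
proof -
  have "r' ^ N - r ^ N = (r' - r) * (\<Sum>i<N. r' ^ (N - Suc i) * r ^ i)"
    using power_diff_sumr2[of r N r'] by (simp only: left_diff_distrib)
  also have "\<dots> \<le> (r' - r) * (\<Sum>i<N. r' ^ (N - 1))"
  proof (intro mult_left_mono sum_mono)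
    fix i assume i: "i \<in> {..<N}"
    have "r' ^ (N - Suc i) * r ^ i \<le> r' ^ (N - Suc i) * r' ^ i"
      using assms by (intro mult_left_mono power_mono) auto
    also have "\<dots> = r' ^ (N - 1)" using i by (simp add: power_add[symmetric])
    finally show "r' ^ (N - Suc i) * r ^ i \<le> r' ^ (N - 1)" .
  qed (use assms in simp)
  finally have "r' ^ N - r ^ N \<le> (r' - r) * (real N * r' ^ (N - 1))" by simp
  from mult_left_mono[OF this less_imp_le[OF cn_pos]] show ?thesis by (simp add: ballvol_def algebra_simps)
qed

text \<open>
  The factor \<open>ballvol x powr \<alpha>\<close> from the band estimate is proportional to the surface of the sphere of
  radius \<open>x\<close>, and the increment of \<open>ballvol\<close> is bounded by the surface at \<open>y\<close>.  The resulting factor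
  \<open>(y / x) ^ (N - 1)\<close> is removed by subdivision.
\<close>

lemma profile_lipschitz_pos:
  assumes r: "0 < r" "r < r'" "r' < radius"
  shows "profile r - profile r' \<le> (K * L) * (r' - r)"
proof (rule telescoping_lipschitz[OF r(1,2), of _ _ "N - 1"])
  show "0 \<le> K * L" using K_pos lipschitz_on_nonneg[OF lip] by simp
  fix x y assume xy: "r \<le> x" "x < y" "y \<le> r'"
  let ?s = "ballvol x" and ?s' = "ballvol y"
  have x0: "0 < x" using r xy by simp
  have s: "0 \<le> ?s" "?s \<le> ?s'" "?s' < vol"
    using ballvol_range[of x] ballvol_range[of y] ballvol_mono[of x y] r xy by auto
  let ?E = "{z\<in>\<Omega>. ustar ?s' < u z \<and> u z < ustar ?s}"
  have L: "0 \<le> L" using lipschitz_on_nonneg[OF lip] .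
  have "grad_mass ?E \<le> L * measure lebesgue ?E"
  proof -
    have "grad_mass ?E \<le> (\<integral>z. L * indicator ?E z \<partial>lebesgue)"
      unfolding set_lebesgue_integral_def
    proof (rule integral_mono)
      show "integrable lebesgue (\<lambda>x. indicator ?E x *\<^sub>R norm (gradient u x))"
        using grad_set_integrable[of ?E] level_sets(3) unfolding set_integrable_def by auto
      show "integrable lebesgue (\<lambda>z. L * indicator ?E z)"
        using level_lmeasurable(3) by (auto simp: fmeasurable_def integrable_indicator_iff)
      show "indicator ?E z *\<^sub>R norm (gradient u z) \<le> L * indicator ?E z" for z
        using gradient_bound[OF lip, of z] by (auto simp: indicator_def)
    qed
    then show ?thesis by simp
  qed
  also have "\<dots> \<le> L * (?s' - ?s)" by (intro mult_left_mono ustar_band(1)[OF s] L)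
  also have "\<dots> \<le> L * (cn * real N * y ^ (N - 1) * (y - x))"
    by (intro mult_left_mono ballvol_diff_le L) (use x0 xy in auto)
  finally have "\<gamma> * ?s powr \<alpha> * (profile x - profile y) \<le> L * (cn * real N * y ^ (N - 1) * (y - x))"
    using ustar_band(2)[OF s] unfolding profile_def by (rule order_trans[rotated])
  from mult_right_mono[OF this, of "root N cn"]
  have "\<gamma> * (?s powr \<alpha> * root N cn) * (profile x - profile y) \<le> (L * (cn * real N * y ^ (N - 1) * (y - x))) * root N cn"
    using real_root_ge_zero[of cn N] cn_pos by (simp add: mult_ac)
  then have "(\<gamma> * cn * x ^ (N - 1)) * (profile x - profile y) \<le> (L * (cn * real N * y ^ (N - 1) * (y - x))) * root N cn"
    unfolding ballvol_powr[OF x0] by (simp add: mult_ac)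
  then have "profile x - profile y \<le> (L * (cn * real N * y ^ (N - 1) * (y - x))) * root N cn / (\<gamma> * cn * x ^ (N - 1))"
    using \<gamma> cn_pos x0 by (simp add: pos_le_divide_eq mult.commute)
  also have "\<dots> = (K * L) * (y / x) ^ (N - 1) * (y - x)"
    using \<gamma> x0 less_imp_neq[OF cn_pos] by (simp add: K_def power_divide field_simps)
  finally show "profile x - profile y \<le> (K * L) * (y / x) ^ (N - 1) * (y - x)" .
qed

lemma profile_lipschitz:
  assumes r: "0 \<le> r" "r \<le> r'" "r' < radius"
  shows "profile r - profile r' \<le> (K * L) * (r' - r)"
proof -
  have KL: "0 \<le> K * L" using K_pos lipschitz_on_nonneg[OF lip] by simp
  consider "r = r'" | "0 < r" "r < r'" | "r = 0" "0 < r'" using r by linarith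
  then show ?thesis
  proof cases
    case 2 then show ?thesis using profile_lipschitz_pos r by simp
  next
    case 3
    have R: "0 \<le> ballvol 0" "ballvol 0 < vol" using ballvol_range[of 0] radius_pos by auto
    have "profile 0 \<le> profile r' + K * L * r'"
    proof (rule dense_le)
      fix t assume t: "t < profile 0"
      have "\<not> \<mu> t \<le> ballvol 0" using ustar_le[OF R, of t] t by (auto simp: profile_def)
      moreover have b0: "ballvol 0 = 0" using dim by (simp add: ballvol_def zero_power)
      ultimately have \<mu>t: "0 < \<mu> t" by simp
      have "(\<lambda>\<rho>. ballvol \<rho>) \<midarrow>0\<rightarrow> ballvol 0" unfolding ballvol_def by (intro tendsto_intros)
      then have "\<forall>\<^sub>F \<rho> in at 0. ballvol \<rho> < \<mu> t"
        using \<mu>t b0 by (intro order_tendstoD(2)) auto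
      then obtain d where d: "0 < d" "\<And>\<rho>. \<rho> \<noteq> 0 \<Longrightarrow> \<bar>\<rho>\<bar> < d \<Longrightarrow> ballvol \<rho> < \<mu> t"
        unfolding eventually_at by (auto simp: dist_real_def)
      define \<rho> where "\<rho> = min (d / 2) (r' / 2)"
      have \<rho>: "0 < \<rho>" "\<rho> < r'" "ballvol \<rho> < \<mu> t" using d(1) 3 d(2)[of \<rho>] by (auto simp: \<rho>_def)
      have "t \<le> profile \<rho>"
        unfolding profile_def using ballvol_range[of \<rho>] \<rho> r by (intro le_ustar) auto
      also have "\<dots> \<le> profile r' + K * L * (r' - \<rho>)"
        using profile_lipschitz_pos[OF \<rho>(1,2) r(3)] by simp
      also have "\<dots> \<le> profile r' + K * L * r'" using KL \<rho>(1) by (intro add_left_mono mult_left_mono) auto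
      finally show "t \<le> profile r' + K * L * r'" .
    qed
    then show ?thesis using 3 by simp
  qed simp
qed

lemma schwarz_lipschitz: "(K * L)-lipschitz_on (symmetrized_ball \<Omega>) (schwarz_symmetrization \<Omega> u)"
proof (rule lipschitz_onI)
  show KL: "0 \<le> K * L" using K_pos lipschitz_on_nonneg[OF lip] by simp
  fix x y assume "x \<in> symmetrized_ball \<Omega>" "y \<in> symmetrized_ball \<Omega>"
  then have xy: "norm x < radius" "norm y < radius" by (auto simp: symmetrized_ball_eq)
  have one: "\<bar>profile r - profile r'\<bar> \<le> (K * L) * (r' - r)" if "0 \<le> r" "r \<le> r'" "r' < radius" for r r'
    using profile_lipschitz[OF that] profile_antimono[OF that] by simp
  have "\<bar>profile (norm x) - profile (norm y)\<bar> \<le> (K * L) * \<bar>norm x - norm y\<bar>"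
    using one[of "norm x" "norm y"] one[of "norm y" "norm x"] xy by (cases "norm x \<le> norm y") auto
  also have "\<dots> \<le> (K * L) * norm (x - y)" using KL by (intro mult_left_mono norm_triangle_ineq3)
  finally show "dist (schwarz_symmetrization \<Omega> u x) (schwarz_symmetrization \<Omega> u y) \<le> (K * L) * dist x y"
    by (simp add: schwarz_eq dist_norm)
qed

text \<open>
  The symmetrization is the profile composed with the norm.  Approaching \<open>x\<close> along its ray shows that
  the profile is differentiable, and the chain rule then identifies the gradient as radial.
\<close>

lemma gradient_schwarz_derivative:
  assumes x: "x \<noteq> 0" and D: "GDERIV (schwarz_symmetrization \<Omega> u) x :> D"
  obtains \<delta> where "(profile has_real_derivative \<delta>) (at (norm x))" "norm D = \<bar>\<delta>\<bar>"
proof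
  let ?r = "norm x"
  have r: "0 < ?r" using x by simp
  have e: "norm (x + h *\<^sub>R sgn x) = ?r + h" if "\<bar>h\<bar> < ?r" for h
  proof -
    have "x + h *\<^sub>R sgn x = (1 + h / ?r) *\<^sub>R x" using r by (simp add: sgn_div_norm algebra_simps divide_inverse)
    then have "norm (x + h *\<^sub>R sgn x) = \<bar>1 + h / ?r\<bar> * ?r" by simp
    also have "\<bar>1 + h / ?r\<bar> = 1 + h / ?r" using that r by (simp add: field_simps abs_less_iff)
    finally show ?thesis using r by (simp add: field_simps)
  qed
  have "((\<lambda>h. (profile (norm (x + h *\<^sub>R sgn x)) - profile ?r) / h) \<longlongrightarrow> D \<bullet> sgn x) (at 0)"
    using GDERIV_directional[OF D, of "sgn x"] by (simp add: schwarz_eq)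
  moreover have "\<forall>\<^sub>F h in at 0. (profile (norm (x + h *\<^sub>R sgn x)) - profile ?r) / h = (profile (?r + h) - profile ?r) / h"
    unfolding eventually_at using r e by (intro exI[of _ ?r]) (auto simp: dist_real_def)
  ultimately have "((\<lambda>h. (profile (?r + h) - profile ?r) / h) \<longlongrightarrow> D \<bullet> sgn x) (at 0)"
    by (rule Lim_transform_eventually)
  then show d: "(profile has_real_derivative (D \<bullet> sgn x)) (at ?r)" by (simp add: DERIV_def)
  have "GDERIV (\<lambda>x. profile (norm x)) x :> (D \<bullet> sgn x) *\<^sub>R sgn x"
  proof -
    have "((\<lambda>x. profile (norm x)) has_derivative (\<lambda>h. (h \<bullet> sgn x) * (D \<bullet> sgn x))) (at x)"
      by (rule has_derivative_compose[OF has_derivative_norm[OF x]])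
         (use d in \<open>simp add: has_field_derivative_def mult_commute_abs\<close>)
    then show ?thesis by (simp add: gderiv_def mult.commute)
  qed
  moreover have "GDERIV (\<lambda>x. profile (norm x)) x :> D" using D by (simp add: schwarz_eq[abs_def])
  ultimately have "D = (D \<bullet> sgn x) *\<^sub>R sgn x" using GDERIV_unique by blast
  then have "norm D = \<bar>D \<bullet> sgn x\<bar> * norm (sgn x)" by (metis norm_scaleR)
  then show "norm D = \<bar>D \<bullet> sgn x\<bar>" using x by (simp add: norm_sgn)
qed

end

section \<open>Comparison of Orlicz norms\<close>

context level_set_isoperimetry
begin

text \<open>
  The symmetrized ball is cut at the radii \<open>knot m i\<close>.  \<open>step_slope m i\<close> is the difference quotient of the
  rearrangement between two neighbouring radii, in the normalization in which it tends to
  \<open>|D| / K\<close> for the gradient \<open>D\<close> of the symmetrization.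
\<close>

abbreviation "knot m i \<equiv> radius * real i / real m"

definition step_slope :: "nat \<Rightarrow> nat \<Rightarrow> real" where
  "step_slope m i = \<gamma> * ballvol (knot m i) powr \<alpha> * (profile (knot m i) - profile (knot m (Suc i)))
      / (ballvol (knot m (Suc i)) - ballvol (knot m i))"

definition annulus :: "nat \<Rightarrow> nat \<Rightarrow> 'a set" where
  "annulus m i = ball 0 (knot m (Suc i)) - ball 0 (knot m i)"

lemma knot_range:
  assumes "0 < m" "i < m"
  shows "0 \<le> knot m i" "knot m i < radius"
  using assms radius_pos by (auto simp: field_simps)

lemma knot_mono: "i \<le> j \<Longrightarrow> knot m i \<le> knot m j"
  using radius_pos by (intro divide_right_mono mult_left_mono) auto

lemma knot_strict: "0 < m \<Longrightarrow> knot m i < knot m (Suc i)"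
  using radius_pos by (intro divide_strict_right_mono mult_strict_left_mono) auto

lemma emeasure_annulus:
  assumes "0 < m"
  shows "emeasure lborel (annulus m i) = ennreal (ballvol (knot m (Suc i)) - ballvol (knot m i))"
proof -
  have r: "0 \<le> knot m i" "knot m i \<le> knot m (Suc i)" using radius_pos knot_mono[of i "Suc i" m] by auto
  have "emeasure lborel (annulus m i) = emeasure lborel (ball 0 (knot m (Suc i)) :: 'a set) - emeasure lborel (ball 0 (knot m i) :: 'a set)"
    unfolding annulus_def
    by (rule emeasure_Diff) (use r emeasure_bounded_finite[OF bounded_ball, of "0::'a" "knot m i"] in \<open>auto simp: less_top[symmetric]\<close>)
  also have "\<dots> = ennreal (ballvol (knot m (Suc i))) - ennreal (ballvol (knot m i))"
    using r emeasure_ball[of "knot m i" "0::'a"] emeasure_ball[of "knot m (Suc i)" "0::'a"] by (simp add: ballvol_def cn_def[symmetric])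
  also have "\<dots> = ennreal (ballvol (knot m (Suc i)) - ballvol (knot m i))"
    using r cn_pos by (intro ennreal_minus) (simp add: ballvol_def)
  finally show ?thesis .
qed

lemma step_slope_jensen:
  assumes \<Psi>: "convex_on {0..} \<Psi>" "mono_on {0..} \<Psi>" "\<Psi> 0 = 0" "continuous_on {0..} \<Psi>"
    and m: "0 < m" "Suc i < m"
  shows "ennreal ((ballvol (knot m (Suc i)) - ballvol (knot m i)) * \<Psi> (step_slope m i)) \<le>
    (\<integral>\<^sup>+x. ennreal (\<Psi> (norm (gradient u x))) * indicator {x\<in>\<Omega>. profile (knot m (Suc i)) < u x \<and> u x < profile (knot m i)} x \<partial>lebesgue)"
proof -
  let ?s = "ballvol (knot m i)" and ?s' = "ballvol (knot m (Suc i))"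
  have b: "0 \<le> knot m i" "knot m i < knot m (Suc i)" "knot m (Suc i) < radius"
    using knot_range[of m i] knot_range[of m "Suc i"] knot_strict[of m i] m by auto
  have s: "0 \<le> ?s" "?s < ?s'" "?s' < vol"
    using ballvol_range[of "knot m i"] ballvol_range[of "knot m (Suc i)"] ballvol_strict_mono[OF b(1,2)] b by auto
  have band: "measure lebesgue {x\<in>\<Omega>. profile (knot m (Suc i)) < u x \<and> u x < profile (knot m i)} \<le> ?s' - ?s"
    "\<gamma> * ?s powr \<alpha> * (profile (knot m i) - profile (knot m (Suc i))) \<le> grad_mass {x\<in>\<Omega>. profile (knot m (Suc i)) < u x \<and> u x < profile (knot m i)}"
    using ustar_band[of ?s ?s'] s unfolding profile_def by auto
  show ?thesis
  proof (rule jensen_padded[OF \<Psi>, where L = L])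
    show "(\<lambda>x. norm (gradient u x)) \<in> borel_measurable lebesgue" using gradient_measurable[OF lip] by measurable
    show "0 \<le> step_slope m i"
      unfolding step_slope_def using \<gamma> s profile_antimono[of "knot m i" "knot m (Suc i)"] b by (intro divide_nonneg_pos mult_nonneg_nonneg) auto
    show "step_slope m i * (?s' - ?s) \<le> grad_mass {x\<in>\<Omega>. profile (knot m (Suc i)) < u x \<and> u x < profile (knot m i)}"
      using band(2) s by (simp add: step_slope_def)
  qed (use gradient_bound[OF lip] level_lmeasurable(3) band(1) s in auto)
qed

text \<open>
  The outermost annulus is left out: at the radius of the ball the rearrangement is the infimum of all
  real numbers, which has no meaning.  Every point of the open ball is eventually inside the remaining
  annuli.
\<close>

definition step_fun :: "(real \<Rightarrow> real) \<Rightarrow> nat \<Rightarrow> 'a \<Rightarrow> ennreal" where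
  "step_fun \<Psi> m x = (\<Sum>i<m - 1. ennreal (\<Psi> (step_slope m i)) * indicator (annulus m i) x)"

text \<open>
  Jensen's inequality compares each annulus with the band of values of \<open>u\<close> between the two profile values,
  and the bands for different annuli are disjoint.
\<close>

lemma step_fun_integral_le:
  assumes \<Psi>: "convex_on {0..} \<Psi>" "mono_on {0..} \<Psi>" "\<Psi> 0 = 0" "continuous_on {0..} \<Psi>"
    and m: "0 < m"
  shows "(\<integral>\<^sup>+x. step_fun \<Psi> m x \<partial>lborel) \<le> (\<integral>\<^sup>+x\<in>\<Omega>. ennreal (\<Psi> (norm (gradient u x))) \<partial>lebesgue)"
proof -
  let ?E = "\<lambda>i. {x\<in>\<Omega>. profile (knot m (Suc i)) < u x \<and> u x < profile (knot m i)}"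
  let ?f = "\<lambda>x. ennreal (\<Psi> (norm (gradient u x)))"
  have am: "annulus m i \<in> sets borel" for i by (simp add: annulus_def)
  have \<Psi>nn: "0 \<le> \<Psi> y" if "0 \<le> y" for y using \<Psi>(2,3) that by (metis atLeast_iff mono_onD order_refl)
  have fm: "?f \<in> borel_measurable lebesgue"
  proof -
    have "continuous_on UNIV (\<lambda>y. \<Psi> (max 0 y))"
      by (rule continuous_on_compose2[OF \<Psi>(4)]) (auto intro!: continuous_intros)
    then have "(\<lambda>y. \<Psi> (max 0 y)) \<in> borel_measurable borel" by (rule borel_measurable_continuous_onI)
    moreover have "(\<lambda>x. norm (gradient u x)) \<in> borel_measurable lebesgue" using gradient_measurable[OF lip] by measurable
    ultimately have "(\<lambda>x. \<Psi> (max 0 (norm (gradient u x)))) \<in> borel_measurable lebesgue" by (rule measurable_compose[rotated])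
    then show ?thesis by simp
  qed
  have "(\<integral>\<^sup>+x. step_fun \<Psi> m x \<partial>lborel) = (\<Sum>i<m - 1. \<integral>\<^sup>+x. ennreal (\<Psi> (step_slope m i)) * indicator (annulus m i) x \<partial>lborel)"
    unfolding step_fun_def by (intro nn_integral_sum) (use am in auto)
  also have "\<dots> = (\<Sum>i<m - 1. ennreal (\<Psi> (step_slope m i)) * ennreal (ballvol (knot m (Suc i)) - ballvol (knot m i)))"
    using am by (simp add: nn_integral_cmult_indicator emeasure_annulus[OF m])
  also have "\<dots> \<le> (\<Sum>i<m - 1. \<integral>\<^sup>+x. ?f x * indicator (?E i) x \<partial>lebesgue)"
  proof (rule sum_mono)
    fix i assume "i \<in> {..<m - 1}"
    then have i: "Suc i < m" by auto
    have "0 \<le> ballvol (knot m (Suc i)) - ballvol (knot m i)"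
      using ballvol_mono[OF _ knot_mono[of i "Suc i" m]] radius_pos by simp
    then have "ennreal (\<Psi> (step_slope m i)) * ennreal (ballvol (knot m (Suc i)) - ballvol (knot m i)) =
      ennreal ((ballvol (knot m (Suc i)) - ballvol (knot m i)) * \<Psi> (step_slope m i))"
      by (subst ennreal_mult') (simp_all only: mult.commute)
    then show "ennreal (\<Psi> (step_slope m i)) * ennreal (ballvol (knot m (Suc i)) - ballvol (knot m i)) \<le> (\<integral>\<^sup>+x. ?f x * indicator (?E i) x \<partial>lebesgue)"
      using step_slope_jensen[OF \<Psi> m i] by simp
  qed
  also have "\<dots> = (\<integral>\<^sup>+x. (\<Sum>i<m - 1. ?f x * indicator (?E i) x) \<partial>lebesgue)"
    using fm level_sets(3) by (intro nn_integral_sum[symmetric] borel_measurable_times_ennreal borel_measurable_indicator) auto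
  also have "\<dots> \<le> (\<integral>\<^sup>+x\<in>\<Omega>. ?f x \<partial>lebesgue)"
  proof (rule nn_integral_mono)
    fix x
    show "(\<Sum>i<m - 1. ?f x * indicator (?E i) x) \<le> ?f x * indicator \<Omega> x"
    proof (cases "\<exists>i<m - 1. x \<in> ?E i")
      case True
      then obtain i where i: "i < m - 1" "x \<in> ?E i" by blast
      have "x \<notin> ?E j" if j: "j < m - 1" "j \<noteq> i" for j
      proof
        assume xj: "x \<in> ?E j"
        have anti: "profile (knot m b) \<le> profile (knot m a)" if "a \<le> b" "b < m" for a b
          using that m knot_range[of m a] knot_range[of m b] knot_mono[of a b m] by (intro profile_antimono) auto
        have lt: "i < m" "j < m" using i(1) j(1) by simp_all
        from j(2) consider "Suc i \<le> j" | "Suc j \<le> i" by linarith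
        then show False
        proof cases
          case 1 then show False using anti[of "Suc i" j] i(2) xj lt by auto
        next
          case 2 then show False using anti[of "Suc j" i] i(2) xj lt by auto
        qed
      qed
      then have "(\<Sum>j<m - 1. ?f x * indicator (?E j) x) = (\<Sum>j<m - 1. if j = i then ?f x else 0)"
        using i(2) by (intro sum.cong) (auto simp: indicator_def)
      also have "\<dots> = ?f x" using i(1) by simp
      finally show ?thesis using i(2) by simp
    next
      case False
      then have e: "(\<Sum>j<m - 1. ?f x * indicator (?E j) x) = 0" by (intro sum.neutral) (auto simp: indicator_def)
      show ?thesis unfolding e by simp
    qed
  qed
  finally show ?thesis .
qed

lemma step_fun_eq:
  assumes m: "0 < m" and x: "knot m i \<le> norm x" "norm x < knot m (Suc i)" and i: "Suc i < m"
  shows "step_fun \<Psi> m x = ennreal (\<Psi> (step_slope m i))"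
proof -
  have "x \<in> annulus m j \<longleftrightarrow> j = i" for j
  proof
    assume "x \<in> annulus m j"
    then have j: "knot m j \<le> norm x" "norm x < knot m (Suc j)" by (auto simp: annulus_def)
    show "j = i"
    proof (rule ccontr)
      assume "j \<noteq> i"
      then consider "Suc i \<le> j" | "Suc j \<le> i" by linarith
      then show False using knot_mono[of "Suc i" j m] knot_mono[of "Suc j" i m] j x by cases auto
    qed
  qed (use x in \<open>auto simp: annulus_def\<close>)
  then have "step_fun \<Psi> m x = (\<Sum>j<m - 1. if j = i then ennreal (\<Psi> (step_slope m i)) else 0)"
    unfolding step_fun_def by (intro sum.cong) (auto simp: indicator_def)
  then show ?thesis using i by simp
qed

lemma step_fun_tendsto:
  assumes \<Psi>: "continuous_on {0..} \<Psi>"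
    and x: "x \<noteq> 0" "norm x < radius" and d: "(profile has_real_derivative \<delta>) (at (norm x))"
  shows "(\<lambda>m. step_fun \<Psi> (Suc m) x) \<longlonglongrightarrow> ennreal (\<Psi> (\<bar>\<delta>\<bar> / K))"
proof -
  let ?r = "norm x"
  have r: "0 < ?r" using x by simp
  define i where "i m = nat \<lfloor>?r * real (Suc m) / radius\<rfloor>" for m
  define y where "y m = knot (Suc m) (i m)" for m
  define z where "z m = knot (Suc m) (Suc (i m))" for m
  have fl: "real (i m) = of_int \<lfloor>?r * real (Suc m) / radius\<rfloor>" for m
    unfolding i_def using r radius_pos by (intro of_nat_nat) simp
  have yr: "y m \<le> ?r" and rz: "?r < z m" for m
  proof -
    have "real (i m) \<le> ?r * real (Suc m) / radius" "?r * real (Suc m) / radius < real (i m) + 1"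
      unfolding fl by linarith+
    then show "y m \<le> ?r" "?r < z m" unfolding y_def z_def using radius_pos
      by (simp_all add: field_simps)
  qed
  have zy: "z m = y m + radius * inverse (real (Suc m))" for m
  proof -
    have "radius * real (Suc (i m)) = radius * real (i m) + radius" by (simp add: algebra_simps)
    then show ?thesis unfolding y_def z_def by (simp only: divide_inverse distrib_right)
  qed
  have gap: "(\<lambda>m. radius * inverse (real (Suc m))) \<longlonglongrightarrow> 0"
    using tendsto_mult[OF tendsto_const LIMSEQ_inverse_real_of_nat, of radius] by simp
  have ylim: "y \<longlonglongrightarrow> ?r"
  proof (rule tendsto_sandwich[of "\<lambda>m. ?r - radius * inverse (real (Suc m))" _ _ "\<lambda>_. ?r"])
    show "\<forall>\<^sub>F m in sequentially. ?r - radius * inverse (real (Suc m)) \<le> y m"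
    proof (intro always_eventually allI)
      show "?r - radius * inverse (real (Suc m)) \<le> y m" for m using rz[of m] unfolding zy by linarith
    qed
    show "(\<lambda>m. ?r - radius * inverse (real (Suc m))) \<longlonglongrightarrow> ?r" using tendsto_diff[OF tendsto_const gap, of ?r] by simp
  qed (use yr in \<open>auto intro: always_eventually\<close>)
  have zlim: "z \<longlonglongrightarrow> ?r" using tendsto_add[OF ylim gap] unfolding zy[symmetric] by simp
  have yz: "y m < z m" for m using yr[of m] rz[of m] by linarith
  have q1: "(\<lambda>m. (profile (z m) - profile (y m)) / (z m - y m)) \<longlonglongrightarrow> \<delta>"
    by (rule straddle_quotient_tendsto[OF d ylim zlim]) (rule yr less_imp_le[OF rz] yz)+
  have dv: "(ballvol has_real_derivative cn * (real N * ?r ^ (N - 1))) (at ?r)"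
    unfolding ballvol_def[abs_def] by (auto intro!: derivative_eq_intros)
  have q2: "(\<lambda>m. (ballvol (z m) - ballvol (y m)) / (z m - y m)) \<longlonglongrightarrow> cn * (real N * ?r ^ (N - 1))"
    by (rule straddle_quotient_tendsto[OF dv ylim zlim]) (rule yr less_imp_le[OF rz] yz)+
  have nz: "cn * (real N * ?r ^ (N - 1)) \<noteq> 0" using cn_pos dim r by simp
  have q3: "(\<lambda>m. ballvol (y m) powr \<alpha>) \<longlonglongrightarrow> ballvol ?r powr \<alpha>"
    unfolding ballvol_def using cn_pos r by (intro tendsto_intros ylim) auto
  have "(\<lambda>m. \<gamma> * ballvol (y m) powr \<alpha> * (- ((profile (z m) - profile (y m)) / (z m - y m))) /
     ((ballvol (z m) - ballvol (y m)) / (z m - y m))) \<longlonglongrightarrow> \<gamma> * ballvol ?r powr \<alpha> * (- \<delta>) / (cn * (real N * ?r ^ (N - 1)))"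
    by (intro tendsto_intros q1 q2 q3 nz)
  moreover have "\<gamma> * ballvol (y m) powr \<alpha> * (- ((profile (z m) - profile (y m)) / (z m - y m))) /
     ((ballvol (z m) - ballvol (y m)) / (z m - y m)) = step_slope (Suc m) (i m)" for m
  proof -
    have "z m - y m \<noteq> 0" using yz[of m] by simp
    then show ?thesis unfolding step_slope_def y_def[symmetric] z_def[symmetric]
      by (simp add: minus_divide_left)
  qed
  moreover have "\<gamma> * ballvol ?r powr \<alpha> * (- \<delta>) / (cn * (real N * ?r ^ (N - 1))) = \<bar>\<delta>\<bar> / K"
  proof -
    have "\<delta> \<le> 0"
    proof (rule tendsto_upperbound[OF q1])
      have "\<forall>\<^sub>F m in sequentially. z m < radius" using order_tendstoD(2)[OF zlim x(2)] .
      then show "\<forall>\<^sub>F m in sequentially. (profile (z m) - profile (y m)) / (z m - y m) \<le> 0"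
      proof eventually_elim
        case (elim m)
        have "0 \<le> y m" using radius_pos by (simp add: y_def)
        then show ?case using profile_antimono[of "y m" "z m"] yz[of m] elim by (intro divide_nonpos_pos) auto
      qed
    qed simp
    moreover have "ballvol ?r powr \<alpha> = cn * ?r ^ (N - 1) / root N cn"
      using ballvol_powr[OF r] cn_pos dim by (simp add: eq_divide_eq)
    ultimately show ?thesis using cn_pos r dim \<gamma> by (simp add: K_def field_simps)
  qed
  ultimately have qlim: "(\<lambda>m. step_slope (Suc m) (i m)) \<longlonglongrightarrow> \<bar>\<delta>\<bar> / K" by simp
  have ev: "\<forall>\<^sub>F m in sequentially. Suc (i m) < Suc m"
    using order_tendstoD(2)[OF zlim x(2)]
  proof eventually_elim
    case (elim m)
    then have "radius * real (Suc (i m)) < radius * real (Suc m)" by (simp add: z_def pos_divide_less_eq)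
    then show ?case using radius_pos by simp
  qed
  have "(\<lambda>m. \<Psi> (step_slope (Suc m) (i m))) \<longlonglongrightarrow> \<Psi> (\<bar>\<delta>\<bar> / K)"
  proof (rule continuous_on_tendsto_compose[OF \<Psi> qlim])
    show "\<bar>\<delta>\<bar> / K \<in> {0..}" using K_pos by simp
    show "\<forall>\<^sub>F m in sequentially. step_slope (Suc m) (i m) \<in> {0..}"
      using ev
    proof eventually_elim
      case (elim m)
      have b: "0 \<le> knot (Suc m) (i m)" "knot (Suc m) (i m) < knot (Suc m) (Suc (i m))" "knot (Suc m) (Suc (i m)) < radius"
        using knot_range[of "Suc m" "i m"] knot_range[of "Suc m" "Suc (i m)"] knot_strict[of "Suc m" "i m"] elim by auto
      have "0 \<le> step_slope (Suc m) (i m)"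
        unfolding step_slope_def using \<gamma> b profile_antimono[of "knot (Suc m) (i m)" "knot (Suc m) (Suc (i m))"]
          ballvol_strict_mono[OF b(1,2)] by (intro divide_nonneg_pos mult_nonneg_nonneg) auto
      then show ?case by simp
    qed
  qed
  then have "(\<lambda>m. ennreal (\<Psi> (step_slope (Suc m) (i m)))) \<longlonglongrightarrow> ennreal (\<Psi> (\<bar>\<delta>\<bar> / K))"
    by (rule tendsto_ennrealI)
  moreover have "\<forall>\<^sub>F m in sequentially. ennreal (\<Psi> (step_slope (Suc m) (i m))) = step_fun \<Psi> (Suc m) x"
    using ev
  proof eventually_elim
    case (elim m)
    show ?case by (rule step_fun_eq[symmetric]) (use yr[of m] rz[of m] elim in \<open>auto simp: y_def z_def\<close>)
  qed
  ultimately show ?thesis by (rule Lim_transform_eventually)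
qed

text \<open>
  Fatou's lemma needs convergence of the step functions only where the symmetrization is differentiable;
  elsewhere \<open>gradient\<close> is 0 by definition and \<open>\<Psi> 0 = 0\<close>.
\<close>

lemma schwarz_convex_integral_le:
  assumes \<Psi>: "convex_on {0..} \<Psi>" "mono_on {0..} \<Psi>" "\<Psi> 0 = 0" "continuous_on {0..} \<Psi>"
  shows "(\<integral>\<^sup>+x\<in>symmetrized_ball \<Omega>. ennreal (\<Psi> (norm (gradient (schwarz_symmetrization \<Omega> u) x) / K)) \<partial>lebesgue)
    \<le> (\<integral>\<^sup>+x\<in>\<Omega>. ennreal (\<Psi> (norm (gradient u x))) \<partial>lebesgue)"
proof -
  let ?v = "schwarz_symmetrization \<Omega> u"
  have sm: "step_fun \<Psi> m \<in> borel_measurable borel" for m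
  proof -
    have [measurable]: "annulus m i \<in> sets borel" for i by (simp add: annulus_def)
    show ?thesis unfolding step_fun_def[abs_def] by measurable
  qed
  have "AE x in lebesgue. ennreal (\<Psi> (norm (gradient ?v x) / K)) * indicator (symmetrized_ball \<Omega>) x \<le> liminf (\<lambda>m. step_fun \<Psi> (Suc m) x)"
  proof -
    have "AE x in (lborel :: 'a measure). x \<noteq> 0" by (rule AE_lborel_singleton)
    from AE_completion[OF this] show ?thesis
    proof eventually_elim
      case (elim x)
      show ?case
      proof (cases "x \<in> symmetrized_ball \<Omega> \<and> (\<exists>D. GDERIV ?v x :> D)")
        case True
        then obtain D where D: "GDERIV ?v x :> D" and xr: "norm x < radius" by (auto simp: symmetrized_ball_eq)
        obtain \<delta> where \<delta>: "(profile has_real_derivative \<delta>) (at (norm x))" "norm D = \<bar>\<delta>\<bar>"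
          using gradient_schwarz_derivative[OF elim D] by blast
        have "liminf (\<lambda>m. step_fun \<Psi> (Suc m) x) = ennreal (\<Psi> (\<bar>\<delta>\<bar> / K))"
          by (rule lim_imp_Liminf[OF _ step_fun_tendsto[OF \<Psi>(4) elim xr \<delta>(1)]]) simp
        then show ?thesis using gradient_eqI[OF D] \<delta>(2) by (simp add: indicator_def)
      next
        case False
        then show ?thesis using \<Psi>(3) by (auto simp: gradient_def indicator_def)
      qed
    qed
  qed
  then have "(\<integral>\<^sup>+x\<in>symmetrized_ball \<Omega>. ennreal (\<Psi> (norm (gradient ?v x) / K)) \<partial>lebesgue) \<le> (\<integral>\<^sup>+x. liminf (\<lambda>m. step_fun \<Psi> (Suc m) x) \<partial>lebesgue)"
    by (rule nn_integral_mono_AE)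
  also have "\<dots> = (\<integral>\<^sup>+x. liminf (\<lambda>m. step_fun \<Psi> (Suc m) x) \<partial>lborel)"
    by (rule nn_integral_completion)
  also have "\<dots> \<le> liminf (\<lambda>m. \<integral>\<^sup>+x. step_fun \<Psi> (Suc m) x \<partial>lborel)"
    using sm by (intro nn_integral_liminf) auto
  also have "\<dots> \<le> limsup (\<lambda>m. \<integral>\<^sup>+x. step_fun \<Psi> (Suc m) x \<partial>lborel)"
    by (rule Liminf_le_Limsup) simp
  also have "\<dots> \<le> (\<integral>\<^sup>+x\<in>\<Omega>. ennreal (\<Psi> (norm (gradient u x))) \<partial>lebesgue)"
    by (rule Limsup_bounded) (use step_fun_integral_le[OF \<Psi>] in \<open>auto intro: always_eventually\<close>)
  finally show ?thesis .
qed

text \<open>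
  Every \<open>l\<close> admissible for the gradient of \<open>u\<close> gives the admissible \<open>K * l\<close> for the symmetrization, by the
  preceding lemma with \<open>\<Psi> y = A (y / l)\<close>; the behaviour of \<open>A\<close> at 0 yields \<open>A 0 = 0\<close>.
\<close>

lemma schwarz_orlicz_norm_le:
  assumes A: "N_function A"
  shows "orlicz_norm A (symmetrized_ball \<Omega>) (\<lambda>x. norm (gradient (schwarz_symmetrization \<Omega> u) x))
      \<le> ennreal K * orlicz_norm A \<Omega> (\<lambda>x. norm (gradient u x))"
proof -
  let ?v = "schwarz_symmetrization \<Omega> u"
  have A1: "mono_on {0..} A" "continuous_on {0..} A" "convex_on {0..} A" "\<And>t. 0 \<le> t \<Longrightarrow> 0 \<le> A t"
    "((\<lambda>t. A t / t) \<longlongrightarrow> 0) (at_right 0)"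
    using A by (auto simp: N_function_def)
  have A0: "A 0 = 0"
  proof -
    have "((\<lambda>t. A t / t * t) \<longlongrightarrow> 0 * 0) (at_right 0)" by (intro tendsto_mult A1(5)) (auto intro: tendsto_ident_at)
    moreover have "\<forall>\<^sub>F t in at_right (0::real). A t / t * t = A t"
      unfolding eventually_at_right_field by (intro exI[of _ 1]) auto
    ultimately have "(A \<longlongrightarrow> 0 * 0) (at_right 0)" by (rule Lim_transform_eventually)
    then have "(A \<longlongrightarrow> 0) (at_right 0)" by simp
    moreover have "(A \<longlongrightarrow> A 0) (at_right 0)"
    proof -
      have "(A \<longlongrightarrow> A 0) (at 0 within {0..})" using A1(2) by (simp add: continuous_on_def)
      then show ?thesis by (rule tendsto_within_subset) auto
    qed
    ultimately show ?thesis using tendsto_unique[of "at_right (0::real)"] by (metis trivial_limit_at_right_real)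
  qed
  have le: "orlicz_norm A (symmetrized_ball \<Omega>) (\<lambda>x. norm (gradient ?v x)) \<le> ennreal K * ennreal l"
    if l: "0 < l" "(\<integral>\<^sup>+x\<in>\<Omega>. ennreal (A (\<bar>norm (gradient u x)\<bar> / l)) \<partial>lebesgue) \<le> 1" for l
  proof -
    define \<Psi> where "\<Psi> y = A (y / l)" for y
    have \<Psi>: "convex_on {0..} \<Psi>" "mono_on {0..} \<Psi>" "\<Psi> 0 = 0" "continuous_on {0..} \<Psi>"
    proof -
      show "convex_on {0..} \<Psi>"
      proof (rule convex_onI)
        fix t x y :: real assume t: "0 < t" "t < 1" "x \<in> {0..}" "y \<in> {0..}"
        have "((1 - t) *\<^sub>R x + t *\<^sub>R y) / l = (1 - t) *\<^sub>R (x / l) + t *\<^sub>R (y / l)" by (simp add: add_divide_distrib)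
        then show "\<Psi> ((1 - t) *\<^sub>R x + t *\<^sub>R y) \<le> (1 - t) * \<Psi> x + t * \<Psi> y"
          unfolding \<Psi>_def using convex_onD[OF A1(3), of t "x / l" "y / l"] t l(1) by simp
      qed simp
      show "mono_on {0..} \<Psi>" unfolding \<Psi>_def using l(1) by (intro mono_onI mono_onD[OF A1(1)]) (auto simp: divide_right_mono)
      show "\<Psi> 0 = 0" by (simp add: \<Psi>_def A0)
      show "continuous_on {0..} \<Psi>" unfolding \<Psi>_def
        by (rule continuous_on_compose2[OF A1(2)]) (use l(1) in \<open>auto intro!: continuous_intros\<close>)
    qed
    have "(\<integral>\<^sup>+x\<in>symmetrized_ball \<Omega>. ennreal (A (\<bar>norm (gradient ?v x)\<bar> / (K * l))) \<partial>lebesgue) \<le> 1"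
      using schwarz_convex_integral_le[OF \<Psi>] l(2) unfolding \<Psi>_def by (simp add: divide_divide_eq_left) 
    then have "orlicz_norm A (symmetrized_ball \<Omega>) (\<lambda>x. norm (gradient ?v x)) \<le> ennreal (K * l)"
      unfolding orlicz_norm_def using K_pos l(1) by (intro INF_lower) auto
    then show ?thesis using K_pos l(1) by (simp add: ennreal_mult)
  qed
  have "ennreal (1 / K) * orlicz_norm A (symmetrized_ball \<Omega>) (\<lambda>x. norm (gradient ?v x)) \<le> orlicz_norm A \<Omega> (\<lambda>x. norm (gradient u x))"
    unfolding orlicz_norm_def[of A \<Omega>]
  proof (rule INF_greatest, clarify)
    fix l assume l: "0 < l" "(\<integral>\<^sup>+x\<in>\<Omega>. ennreal (A (\<bar>norm (gradient u x)\<bar> / l)) \<partial>lebesgue) \<le> 1"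
    have "ennreal (1 / K) * orlicz_norm A (symmetrized_ball \<Omega>) (\<lambda>x. norm (gradient ?v x)) \<le> ennreal (1 / K) * (ennreal K * ennreal l)"
      by (intro mult_left_mono le l) simp
    also have "\<dots> = ennreal l" using K_pos by (simp add: mult.assoc[symmetric] ennreal_mult'[symmetric])
    finally show "ennreal (1 / K) * orlicz_norm A (symmetrized_ball \<Omega>) (\<lambda>x. norm (gradient ?v x)) \<le> ennreal l" .
  qed
  from mult_left_mono[OF this, of "ennreal K"]
  show ?thesis using K_pos by (simp add: mult.assoc[symmetric] ennreal_mult'[symmetric])
qed

end

section \<open>The isoperimetric constant and the symmetrization theorem\<close>

lemma mcshane_extension:
  fixes u :: "'a::metric_space \<Rightarrow> real"
  assumes lip: "L-lipschitz_on S u" and ne: "S \<noteq> {}"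
  obtains v where "L-lipschitz_on UNIV v" "\<And>x. x \<in> S \<Longrightarrow> v x = u x"
proof -
  define v where "v x = (INF y\<in>S. u y + L * dist x y)" for x
  have L: "0 \<le> L" using lip by (rule lipschitz_on_nonneg)
  obtain x0 where x0: "x0 \<in> S" using ne by blast
  have lower: "u z - L * dist x z \<le> u y + L * dist x y" if "y \<in> S" "z \<in> S" for x y z
  proof -
    have "u z - u y \<le> L * dist z y"
      using lipschitz_onD[OF lip that(2,1)] by (simp add: dist_real_def)
    also have "\<dots> \<le> L * (dist x z + dist x y)"
      using L by (intro mult_left_mono) (metis dist_commute dist_triangle)
    finally show ?thesis by (simp add: algebra_simps)
  qed
  have bdd: "bdd_below ((\<lambda>y. u y + L * dist x y) ` S)" for x
    by (rule bdd_belowI2[of _ "u x0 - L * dist x x0"]) (use lower x0 in auto)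
  have one: "v x \<le> v x' + L * dist x x'" for x x'
  proof -
    have "v x - L * dist x x' \<le> v x'"
      unfolding v_def[of x']
    proof (rule cINF_greatest[OF ne])
      fix y assume y: "y \<in> S"
      have "v x \<le> u y + L * dist x y" unfolding v_def by (rule cINF_lower[OF bdd y])
      also have "\<dots> \<le> u y + L * (dist x x' + dist x' y)" using L by (intro add_left_mono mult_left_mono dist_triangle)
      finally show "v x - L * dist x x' \<le> u y + L * dist x' y" by (simp add: algebra_simps)
    qed
    then show ?thesis by simp
  qed
  show thesis
  proof (rule that)
    show "L-lipschitz_on UNIV v"
    proof (rule lipschitz_onI)
      show "dist (v x) (v y) \<le> L * dist x y" for x y
        using one[of x y] one[of y x] unfolding dist_real_def dist_commute[of y x] abs_le_iff by linarith
    qed (rule L)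
    fix x assume x: "x \<in> S"
    show "v x = u x"
    proof (rule antisym)
      show "v x \<le> u x" using cINF_lower[OF bdd x, of x] by (simp add: v_def)
      show "u x \<le> v x" unfolding v_def by (rule cINF_greatest[OF ne]) (use lower[OF _ x, of _ x] in auto)
    qed
  qed
qed

lemma continuous_extension_eq:
  fixes u v :: "'a::euclidean_space \<Rightarrow> real"
  assumes "open \<Omega>" "x \<in> frontier \<Omega>" "continuous_on UNIV v" "\<And>y. y \<in> \<Omega> \<Longrightarrow> v y = u y"
  shows "continuous_extension \<Omega> u x = v x"
proof -
  have x: "x \<notin> \<Omega>" "x \<in> closure \<Omega>" using assms(1,2) by (auto simp: frontier_def interior_open)
  have "(v \<longlongrightarrow> v x) (at x within \<Omega>)"
    using assms(3) by (meson continuous_on_def UNIV_I tendsto_within_subset subset_UNIV)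
  moreover have "\<forall>\<^sub>F y in at x within \<Omega>. v y = u y"
    unfolding eventually_at_filter using assms(4) by (simp add: eventually_mono)
  ultimately have "(u \<longlongrightarrow> v x) (at x within \<Omega>)" by (rule Lim_transform_eventually)
  moreover have "at x within \<Omega> \<noteq> bot" using x by (simp add: closure_def trivial_limit_within)
  ultimately have "Lim (at x within \<Omega>) u = v x" by (intro tendsto_Lim)
  then show ?thesis using x(1) by (simp add: continuous_extension_def)
qed

lemma orlicz_norm_cong:
  assumes "\<And>x. x \<in> \<Omega> \<Longrightarrow> f x = g x"
  shows "orlicz_norm A \<Omega> f = orlicz_norm A \<Omega> g"
proof -
  have "(\<integral>\<^sup>+x\<in>\<Omega>. ennreal (A (\<bar>f x\<bar> / l)) \<partial>lebesgue) = (\<integral>\<^sup>+x\<in>\<Omega>. ennreal (A (\<bar>g x\<bar> / l)) \<partial>lebesgue)" for l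
    by (intro nn_integral_cong) (use assms in \<open>auto simp: indicator_def\<close>)
  then show ?thesis by (simp add: orlicz_norm_def)
qed

lemma ennreal_less_of_mult_le:
  assumes "ennreal x \<le> ennreal q * P" "0 \<le> q" "0 \<le> c" "c * q < x"
  shows "ennreal c < P"
proof (rule ccontr)
  assume "\<not> ?thesis"
  then have "ennreal q * P \<le> ennreal q * ennreal c" by (intro mult_left_mono) auto
  also have "\<dots> = ennreal (q * c)" using assms by (simp add: ennreal_mult)
  finally have "ennreal x \<le> ennreal (q * c)" using assms(1) by (rule order_trans[rotated])
  moreover have "0 \<le> q * c" using assms by simp
  ultimately have "x \<le> q * c" by (simp add: ennreal_le_iff)
  then show False using assms(4) by (simp add: mult.commute)
qed

text \<open>
  The three terms belong to the levels above which at most half of the domain lies, to a zero set of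
  positive measure, and to zero sets on the boundary or with positive projection.
\<close>

definition symmetrization_const :: "nat \<Rightarrow> real \<Rightarrow> real \<Rightarrow> real \<Rightarrow> real \<Rightarrow> real" where
  "symmetrization_const n Q C V \<epsilon> =
     (let \<alpha> = 1 - 1 / real n in
      min (1 / Q) (min ((\<epsilon> / V) powr \<alpha> / Q) (\<epsilon> / ((C + slab_const n) * V powr \<alpha>))))"

lemma symmetrization_const_pos:
  assumes "2 \<le> n" "0 < Q" "0 < C" "0 < V" "0 < \<epsilon>"
  shows "0 < symmetrization_const n Q C V \<epsilon>"
  using assms slab_const_pos[of n] by (simp add: symmetrization_const_def Let_def)

text \<open>
  If \<open>c\<close> is smaller than the perimeter of the superlevel set, the clamping argument applies directly.
  Under the projection hypothesis the perimeter may be smaller than \<open>c\<close>; then the trace inequality bounds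
  the essential boundary by \<open>C c\<close>, and the lines of \<open>projection_of_zero_set_bound\<close> provide the rest.
\<close>

lemma level_set_dini:
  fixes \<Omega> :: "'a::euclidean_space set" and u v :: "'a \<Rightarrow> real"
  assumes n: "2 \<le> DIM('a)" and pos: "0 < Q" "0 < C" "0 < V" "0 < \<epsilon>"
    and \<Omega>: "bounded_lipschitz_domain \<Omega>" and V: "measure lebesgue \<Omega> = V"
    and iso: "\<forall>E\<in>sets lebesgue. E \<subseteq> \<Omega> \<longrightarrow>
       ennreal Q * perimeter \<Omega> E \<ge>
       ennreal (min (measure lebesgue E) (measure lebesgue (\<Omega> - E)) powr (1 - 1 / real DIM('a)))"
    and tr: "\<forall>E\<in>sets lebesgue. E \<subseteq> \<Omega> \<longrightarrow> measure lebesgue E \<le> measure lebesgue \<Omega> / 2 \<longrightarrow>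
       hausdorff_measure (DIM('a) - 1) (essential_boundary E \<inter> frontier \<Omega>)
         \<le> ennreal C * perimeter \<Omega> E"
    and lip: "L-lipschitz_on UNIV v" and uv: "\<And>x. x \<in> \<Omega> \<Longrightarrow> v x = u x"
    and zero: "(\<exists>E\<in>sets lebesgue. E \<subseteq> \<Omega> \<and> (\<forall>x\<in>E. u x = 0) \<and> measure lebesgue E = \<epsilon>)
    \<or> (\<exists>F. F \<subseteq> frontier \<Omega> \<and> (\<forall>x\<in>F. continuous_extension \<Omega> u x = 0) \<and>
          hausdorff_measure (DIM('a) - 1) F = ennreal \<epsilon>)
    \<or> (\<exists>G p a b. G \<subseteq> \<Omega> \<and> (\<forall>x\<in>G. u x = 0) \<and>
          a \<noteq> 0 \<and> orthogonal_projection_onto {x. a \<bullet> x = b} p \<and>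
          hausdorff_measure (DIM('a) - 1) (p ` G) = ennreal \<epsilon>)"
    and t: "0 < t"
    and c: "c < symmetrization_const DIM('a) Q C V \<epsilon> * measure lebesgue {x\<in>\<Omega>. t \<le> v x} powr (1 - 1 / real DIM('a))"
  shows "\<exists>d>0. \<forall>h. 0 < h \<and> h < d \<longrightarrow>
        c * h \<le> (LINT x:{x\<in>\<Omega>. t - h \<le> v x \<and> v x < t}|lebesgue. norm (gradient v x))"
proof -
  let ?\<alpha> = "1 - 1 / real DIM('a)"
  let ?\<kappa> = "slab_const DIM('a)"
  let ?\<gamma> = "symmetrization_const DIM('a) Q C V \<epsilon>"
  let ?E = "{x\<in>\<Omega>. t \<le> v x}"
  let ?W = "{x\<in>\<Omega>. v x < t}"
  let ?I = "\<lambda>h. (LINT x:{x\<in>\<Omega>. t - h \<le> v x \<and> v x < t}|lebesgue. norm (gradient v x))"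
  let ?k = "DIM('a) - 1"
  define \<nu> where "\<nu> = measure lebesgue ?E"
  have op: "open \<Omega>" and bd: "bounded \<Omega>" using \<Omega> by (auto simp: bounded_lipschitz_domain_def)
  have \<kappa>: "0 < ?\<kappa>" using n by (intro slab_const_pos) auto
  have \<alpha>: "0 \<le> ?\<alpha>" using n by simp
  have cont: "continuous_on UNIV v" using lip by (rule lipschitz_on_continuous_on)
  have Wo: "open ?W"
  proof -
    have "?W = \<Omega> \<inter> {x. v x < t}" by blast
    then show ?thesis using op by (auto intro!: open_Int open_Collect_less cont continuous_intros)
  qed
  have EW: "?E = \<Omega> - ?W" "?W = \<Omega> - ?E" by auto
  have Wm: "?W \<in> sets lebesgue" using Wo by auto
  have Om: "\<Omega> \<in> lmeasurable" using op bd by (intro bounded_set_imp_lmeasurable) auto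
  have Em: "?E \<in> sets lebesgue" unfolding EW(1) using Wm Om by (intro sets.Diff) (auto dest: fmeasurableD)
  have Wl: "?W \<in> lmeasurable" using Wm bd by (intro bounded_set_imp_lmeasurable) (auto intro: bounded_subset)
  have mW: "measure lebesgue ?W = V - \<nu>"
  proof -
    have "measure lebesgue ?W = measure lebesgue \<Omega> - measure lebesgue ?E"
      unfolding EW(2) using Em Om by (intro measurable_measure_Diff) auto
    then show ?thesis by (simp add: V \<nu>_def)
  qed
  have \<nu>: "0 \<le> \<nu>" "\<nu> \<le> V" using mW measure_nonneg[of lebesgue ?W] by (auto simp: \<nu>_def)
  have per: "perimeter \<Omega> ?W = perimeter \<Omega> ?E"
    unfolding EW(2) using perimeter_complement[OF Em _ fmeasurableD[OF Om]] by (simp add: EW(2)[symmetric])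
  have Inn: "0 \<le> ?I h" for h
    unfolding set_lebesgue_integral_def by (rule integral_nonneg_AE) (auto simp: indicator_def)
  have done_if: ?thesis if "ennreal c < perimeter \<Omega> ?E"
    by (rule perimeter_superlevel_lower_bound[OF lip op bd that])
  have \<gamma>1: "?\<gamma> \<le> 1 / Q" "?\<gamma> \<le> (\<epsilon> / V) powr ?\<alpha> / Q" "?\<gamma> \<le> \<epsilon> / ((C + ?\<kappa>) * V powr ?\<alpha>)"
    by (simp_all add: symmetrization_const_def Let_def)
  have isoE: "ennreal (min \<nu> (V - \<nu>) powr ?\<alpha>) \<le> ennreal Q * perimeter \<Omega> ?E"
    using iso Em mW by (auto simp: \<nu>_def EW(2)[symmetric])
  show ?thesis
  proof (cases "c < 0")
    case True
    have "c * h \<le> ?I h" if "0 < h" for h using Inn[of h] True that by (meson mult_neg_pos order_less_imp_le order_trans)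
    then show ?thesis by (intro exI[of _ 1]) auto
  next
    case False
    then have c0: "0 \<le> c" by simp
    show ?thesis
    proof (cases "\<nu> \<le> V / 2")
      case True
      have "c < (1 / Q) * \<nu> powr ?\<alpha>"
        using c mult_right_mono[OF \<gamma>1(1), of "\<nu> powr ?\<alpha>"] by (simp add: \<nu>_def)
      then have "c * Q < \<nu> powr ?\<alpha>" using pos by (simp add: pos_less_divide_eq)
      moreover have "min \<nu> (V - \<nu>) = \<nu>" using True by simp
      ultimately show ?thesis using isoE pos c0 by (intro done_if ennreal_less_of_mult_le[of "\<nu> powr ?\<alpha>" Q]) auto
    next
      case big: False
      have W2: "measure lebesgue ?W \<le> measure lebesgue \<Omega> / 2" using big mW V by simp
      have \<nu>V: "\<nu> powr ?\<alpha> \<le> V powr ?\<alpha>" using \<nu> \<alpha> by (intro powr_mono2) auto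
      have \<gamma>0: "0 < ?\<gamma>" using n pos by (rule symmetrization_const_pos)
      have cV: "c < ?\<gamma> * V powr ?\<alpha>"
        using less_le_trans[OF c[folded \<nu>_def] mult_left_mono[OF \<nu>V less_imp_le[OF \<gamma>0]]] .
      have cV3: "c < \<epsilon> / (C + ?\<kappa>)"
      proof -
        have "?\<gamma> * V powr ?\<alpha> \<le> \<epsilon> / ((C + ?\<kappa>) * V powr ?\<alpha>) * V powr ?\<alpha>"
          by (rule mult_right_mono[OF \<gamma>1(3)]) simp
        also have "\<dots> = \<epsilon> / (C + ?\<kappa>)" using pos by simp
        finally show ?thesis using cV by simp
      qed
      have trW: "hausdorff_measure ?k (essential_boundary ?W \<inter> frontier \<Omega>) \<le> ennreal C * perimeter \<Omega> ?E"
        using tr Wm W2 per by auto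
      from zero show ?thesis
      proof (elim disjE)
        assume "\<exists>E\<in>sets lebesgue. E \<subseteq> \<Omega> \<and> (\<forall>x\<in>E. u x = 0) \<and> measure lebesgue E = \<epsilon>"
        then obtain Z where interior: "Z \<in> sets lebesgue" "Z \<subseteq> \<Omega>" "\<forall>x\<in>Z. u x = 0" "measure lebesgue Z = \<epsilon>" by blast
        have "\<epsilon> \<le> V - \<nu>"
          unfolding interior(4)[symmetric] mW[symmetric]
          using interior uv t Wl by (intro measure_mono_fmeasurable) auto
        then have "\<epsilon> powr ?\<alpha> \<le> min \<nu> (V - \<nu>) powr ?\<alpha>"
          using big pos \<alpha> by (intro powr_mono2) auto
        then have "ennreal (\<epsilon> powr ?\<alpha>) \<le> ennreal Q * perimeter \<Omega> ?E"
          using isoE by (meson ennreal_leI order_trans)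
        moreover have "c * Q < \<epsilon> powr ?\<alpha>"
        proof -
          have "?\<gamma> * V powr ?\<alpha> \<le> ((\<epsilon> / V) powr ?\<alpha> / Q) * V powr ?\<alpha>"
            by (rule mult_right_mono[OF \<gamma>1(2)]) simp
          also have "\<dots> = \<epsilon> powr ?\<alpha> / Q" using pos by (simp add: powr_divide)
          finally have "c < \<epsilon> powr ?\<alpha> / Q" using cV by simp
          then show ?thesis using pos by (simp add: pos_less_divide_eq)
        qed
        ultimately show ?thesis using pos c0 by (intro done_if ennreal_less_of_mult_le[of "\<epsilon> powr ?\<alpha>" Q]) auto
      next
        assume "\<exists>F. F \<subseteq> frontier \<Omega> \<and> (\<forall>x\<in>F. continuous_extension \<Omega> u x = 0) \<and> hausdorff_measure ?k F = ennreal \<epsilon>"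
        then obtain F where boundary: "F \<subseteq> frontier \<Omega>" "\<forall>x\<in>F. continuous_extension \<Omega> u x = 0" "hausdorff_measure ?k F = ennreal \<epsilon>" by blast
        have "F \<subseteq> essential_boundary ?W \<inter> frontier \<Omega>"
        proof
          fix x assume x: "x \<in> F"
          have "continuous_extension \<Omega> u x = v x"
            by (rule continuous_extension_eq[OF op _ cont uv]) (use boundary(1) x in auto)
          then have "v x = 0" using boundary(2) x by simp
          then have "t > v x" using t by simp
          then have "x \<in> essential_boundary ?W" using frontier_value_ge[OF \<Omega> cont, of x t] boundary(1) x by force
          then show "x \<in> essential_boundary ?W \<inter> frontier \<Omega>" using boundary(1) x by blast
        qed
        then have "ennreal \<epsilon> \<le> ennreal C * perimeter \<Omega> ?E"
          using trW hausdorff_measure_mono boundary(3) by (metis order_trans)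
        moreover have "c * C < \<epsilon>"
        proof -
          have "c * (C + ?\<kappa>) < \<epsilon>" using cV3 pos \<kappa> by (simp add: pos_less_divide_eq)
          moreover have "c * C \<le> c * (C + ?\<kappa>)" using c0 \<kappa> by (intro mult_left_mono) auto
          ultimately show ?thesis by simp
        qed
        ultimately show ?thesis using pos c0 by (intro done_if ennreal_less_of_mult_le[of \<epsilon> C]) auto
      next
        assume "\<exists>G p a b. G \<subseteq> \<Omega> \<and> (\<forall>x\<in>G. u x = 0) \<and> a \<noteq> 0 \<and> orthogonal_projection_onto {x. a \<bullet> x = b} p \<and>
          hausdorff_measure ?k (p ` G) = ennreal \<epsilon>"
        then obtain G p a b where projection: "G \<subseteq> \<Omega>" "\<forall>x\<in>G. u x = 0" "a \<noteq> 0"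
            "orthogonal_projection_onto {x. a \<bullet> x = b} p" "hausdorff_measure ?k (p ` G) = ennreal \<epsilon>" by blast
        show ?thesis
        proof (cases "ennreal c < perimeter \<Omega> ?E")
          case False
          then have Pc: "perimeter \<Omega> ?E \<le> ennreal c" by simp
          have vG: "v x = 0" if "x \<in> G" for x using projection(1,2) uv that by auto
          have "c * h \<le> ?I h" if h: "0 < h" "h < t" for h
          proof -
            have "ennreal \<epsilon> \<le> hausdorff_measure ?k (essential_boundary ?W \<inter> frontier \<Omega>) + ennreal (?\<kappa> * (?I h / h))"
              using projection_of_zero_set_bound[OF \<Omega> lip projection(1) vG h(1) less_imp_le[OF h(2)] projection(3,4) n]
              unfolding projection(5) .
            also have "\<dots> \<le> ennreal C * ennreal c + ennreal (?\<kappa> * (?I h / h))"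
              by (intro add_right_mono order_trans[OF trW] mult_left_mono Pc) simp
            also have "\<dots> = ennreal (C * c + ?\<kappa> * (?I h / h))"
              using pos c0 \<kappa> Inn[of h] h by (simp add: ennreal_mult' ennreal_plus)
            finally have "\<epsilon> \<le> C * c + ?\<kappa> * (?I h / h)"
              using pos c0 \<kappa> Inn[of h] h by (subst (asm) ennreal_le_iff) auto
            moreover have "c * (C + ?\<kappa>) < \<epsilon>" using cV3 pos \<kappa> by (simp add: pos_less_divide_eq)
            ultimately have "?\<kappa> * c < ?\<kappa> * (?I h / h)" by (simp add: algebra_simps)
            then have "c < ?I h / h" using mult_less_cancel_left_pos[OF \<kappa>] by blast
            then show ?thesis using h by (simp add: pos_less_divide_eq)
          qed
          then show ?thesis using t by (intro exI[of _ t]) auto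
        qed (rule done_if)
      qed
    qed
  qed
qed

theorem theorem3p1:
  fixes Q \<C> V \<epsilon> :: real
  assumes "CARD('n::finite) \<ge> 2" and "Q > 0" and "\<C> > 0" and "V > 0" and "\<epsilon> > 0"
  shows "\<exists>\<gamma>>0. \<forall>(\<Omega> :: (real^'n) set) (A :: real \<Rightarrow> real) (u :: real^'n \<Rightarrow> real).
    bounded_lipschitz_domain \<Omega> \<longrightarrow>
    measure lebesgue \<Omega> = V \<longrightarrow>
    (\<forall>E\<in>sets lebesgue. E \<subseteq> \<Omega> \<longrightarrow>
       ennreal Q * perimeter \<Omega> E \<ge>
       ennreal (min (measure lebesgue E) (measure lebesgue (\<Omega> - E)) powr (1 - 1 / real CARD('n)))) \<longrightarrow>
    (\<forall>E\<in>sets lebesgue. E \<subseteq> \<Omega> \<longrightarrow> measure lebesgue E \<le> measure lebesgue \<Omega> / 2 \<longrightarrow>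
       hausdorff_measure (CARD('n) - 1) (essential_boundary E \<inter> frontier \<Omega>)
         \<le> ennreal \<C> * perimeter \<Omega> E) \<longrightarrow>
    N_function A \<longrightarrow>
    (\<exists>L. L-lipschitz_on \<Omega> u) \<longrightarrow>
    (\<forall>x\<in>\<Omega>. 0 \<le> u x) \<longrightarrow>
    (\<exists>E\<in>sets lebesgue. E \<subseteq> \<Omega> \<and> (\<forall>x\<in>E. u x = 0) \<and> measure lebesgue E = \<epsilon>)
    \<or> (\<exists>F. F \<subseteq> frontier \<Omega> \<and> (\<forall>x\<in>F. continuous_extension \<Omega> u x = 0) \<and>
          hausdorff_measure (CARD('n) - 1) F = ennreal \<epsilon>)
    \<or> (\<exists>G p a b. G \<subseteq> \<Omega> \<and> (\<forall>x\<in>G. u x = 0) \<and>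
          a \<noteq> 0 \<and> orthogonal_projection_onto {x. a \<bullet> x = b} p \<and>
          hausdorff_measure (CARD('n) - 1) (p ` G) = ennreal \<epsilon>) \<longrightarrow>
    (\<exists>L. L-lipschitz_on (symmetrized_ball \<Omega>) (schwarz_symmetrization \<Omega> u)) \<and>
    orlicz_norm A (symmetrized_ball \<Omega>) (\<lambda>x. norm (gradient (schwarz_symmetrization \<Omega> u) x))
      \<le> ennreal (real CARD('n) * root CARD('n) (unit_ball_vol (real CARD('n))) / \<gamma>)
         * orlicz_norm A \<Omega> (\<lambda>x. norm (gradient u x))"
proof (rule exI[of _ "symmetrization_const CARD('n) Q \<C> V \<epsilon>"], intro conjI allI impI)
  let ?\<gamma> = "symmetrization_const CARD('n) Q \<C> V \<epsilon>"
  show \<gamma>: "0 < ?\<gamma>" using assms by (intro symmetrization_const_pos)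
  fix \<Omega> :: "(real^'n) set" and A :: "real \<Rightarrow> real" and u :: "real^'n \<Rightarrow> real"
  assume \<Omega>: "bounded_lipschitz_domain \<Omega>" and V: "measure lebesgue \<Omega> = V"
    and iso: "\<forall>E\<in>sets lebesgue. E \<subseteq> \<Omega> \<longrightarrow>
       ennreal Q * perimeter \<Omega> E \<ge>
       ennreal (min (measure lebesgue E) (measure lebesgue (\<Omega> - E)) powr (1 - 1 / real CARD('n)))"
    and tr: "\<forall>E\<in>sets lebesgue. E \<subseteq> \<Omega> \<longrightarrow> measure lebesgue E \<le> measure lebesgue \<Omega> / 2 \<longrightarrow>
       hausdorff_measure (CARD('n) - 1) (essential_boundary E \<inter> frontier \<Omega>)
         \<le> ennreal \<C> * perimeter \<Omega> E"
    and A: "N_function A" and lipu: "\<exists>L. L-lipschitz_on \<Omega> u" and u0: "\<forall>x\<in>\<Omega>. 0 \<le> u x"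
    and zero: "(\<exists>E\<in>sets lebesgue. E \<subseteq> \<Omega> \<and> (\<forall>x\<in>E. u x = 0) \<and> measure lebesgue E = \<epsilon>)
    \<or> (\<exists>F. F \<subseteq> frontier \<Omega> \<and> (\<forall>x\<in>F. continuous_extension \<Omega> u x = 0) \<and>
          hausdorff_measure (CARD('n) - 1) F = ennreal \<epsilon>)
    \<or> (\<exists>G p a b. G \<subseteq> \<Omega> \<and> (\<forall>x\<in>G. u x = 0) \<and>
          a \<noteq> 0 \<and> orthogonal_projection_onto {x. a \<bullet> x = b} p \<and>
          hausdorff_measure (CARD('n) - 1) (p ` G) = ennreal \<epsilon>)"
  have op: "open \<Omega>" and bd: "bounded \<Omega>" and ne: "\<Omega> \<noteq> {}" using \<Omega> by (auto simp: bounded_lipschitz_domain_def)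
  obtain L where L: "L-lipschitz_on \<Omega> u" using lipu ..
  obtain v where lip: "L-lipschitz_on UNIV v" and uv: "\<And>x. x \<in> \<Omega> \<Longrightarrow> v x = u x"
    using mcshane_extension[OF L ne] by blast
  have dim: "DIM(real^'n) = CARD('n)" by simp
  interpret level_set_isoperimetry \<Omega> v L ?\<gamma> "1 - 1 / real CARD('n)" "unit_ball_vol (real CARD('n))"
    "real CARD('n) * root CARD('n) (unit_ball_vol (real CARD('n))) / ?\<gamma>" "CARD('n)"
  proof
    show "\<exists>d>0. \<forall>h. 0 < h \<and> h < d \<longrightarrow>
        c * h \<le> (LINT x:{x\<in>\<Omega>. t - h \<le> v x \<and> v x < t}|lebesgue. norm (gradient v x))"
      if "0 < t" "c < ?\<gamma> * measure lebesgue {x\<in>\<Omega>. t \<le> v x} powr (1 - 1 / real CARD('n))" for t c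
      using level_set_dini[where \<Omega> = \<Omega> and u = u and v = v and t = t and c = c, unfolded dim,
          OF assms \<Omega> V iso tr lip uv zero that] .
  qed (use op bd ne lip u0 uv assms \<gamma> in auto)
  have sym: "schwarz_symmetrization \<Omega> u = schwarz_symmetrization \<Omega> v"
  proof -
    have "{x\<in>\<Omega>. t < u x} = {x\<in>\<Omega>. t < v x}" for t using uv by auto
    then have "distribution_function \<Omega> u = distribution_function \<Omega> v" by (simp add: distribution_function_def fun_eq_iff)
    then show ?thesis by (simp add: schwarz_symmetrization_def decreasing_rearrangement_def fun_eq_iff)
  qed
  show "\<exists>L. L-lipschitz_on (symmetrized_ball \<Omega>) (schwarz_symmetrization \<Omega> u)"
    unfolding sym using schwarz_lipschitz by blast
  have "orlicz_norm A \<Omega> (\<lambda>x. norm (gradient v x)) = orlicz_norm A \<Omega> (\<lambda>x. norm (gradient u x))"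
    by (rule orlicz_norm_cong) (use gradient_cong_open[OF op _ uv] in auto)
  then show "orlicz_norm A (symmetrized_ball \<Omega>) (\<lambda>x. norm (gradient (schwarz_symmetrization \<Omega> u) x))
      \<le> ennreal (real CARD('n) * root CARD('n) (unit_ball_vol (real CARD('n))) / ?\<gamma>)
         * orlicz_norm A \<Omega> (\<lambda>x. norm (gradient u x))"
    using schwarz_orlicz_norm_le[OF A] by (simp add: sym)
qed

end
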